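(* Let $f:\mathbb{N}^n\to\mathbb{N}$ be a computable function that is provably total in $HA_2$, via a type $A$ as in the definition of provably total. Then there exists a scheme $t$ such that for all natural numbers $p_1,\ldots,p_n$, the normal form (with respect to the rewrite rules $\mathit{Pred}(0)\to 0$, $\mathit{Pred}(S(x))\to x$) of the witness extracted from the scheme $(t\ \underline{p_1}\ \rho_{p_1}\ \underline{p_2}\ \rho_{p_2}\ \cdots\ \underline{p_n}\ \rho_{p_n})$ is $\underline{f(p_1,\ldots,p_n)}$.
   Context: Scheme calculus: many-sorted terms and types $A::=P(a_1,\ldots,a_n)\mid A\Rightarrow A'\mid\forall x\,A$; contexts are finite SETS of types; schemes $t::=\mathbf{v}_A\mid\lambda_A t\mid(t\ t')\mid\Lambda x\,t\mid(t\ a)$ ($\mathbf{v}_A$ the canonical variable of type $A$, $a$ a term), typed by natural deduction rules: $\Gamma\vdash\mathbf{v}_A:A$ if $A\in\Gamma$; from $\Gamma\cup\{A\}\vdash t:B$ infer $\Gamma\vdash\lambda_At:A\Rightarrow B$; from $\Gamma\vdash t:A\Rightarrow B,\ \Gamma\vdash u:A$ infer $\Gamma\vdash(t\ u):B$; from $\Gamma\vdash t:A$ infer $\Gamma\vdash\Lambda x\,t:\forall x\,A$ if $x$ not free in $\Gamma$; from $\Gamma\vdash t:\forall x\,A$ infer $\Gamma\vdash(t\ a):[a/x]A$; from $\Gamma\vdash t:A$, $A\equiv B$ infer $\Gamma\vdash t:B$. Weak minimal reduction $\twoheadrightarrow$ (deterministic): $((\lambda_At)\ u)_\Gamma\twoheadrightarrow(\underline{[u/A]}_\Gamma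 t)_\Gamma$, $((\Lambda x\,t)\ a)_\Gamma\twoheadrightarrow([a/x]t)_\Gamma$, and reduction in the head: if $t_\Gamma\twoheadrightarrow t'_\Gamma$ then $(t\ u)_\Gamma\twoheadrightarrow(t'\ u)_\Gamma$ and $(t\ a)_\Gamma\twoheadrightarrow(t'\ a)_\Gamma$; here the minimal substitution $\underline{[u/A]}_\Gamma t$ replaces $\mathbf{v}_A$ by $u$ exactly at occurrences where $A$ is not in the current context (which starts at $\Gamma$ and is extended by $B$ when passing under $\lambda_B$), and renames bound term variables to avoid capture. $HA_2$: sorts $\iota$ and $\kappa_n$ ($n\ge0$); function symbols $0:\iota$, $S,\mathit{Pred}:\langle\iota,\iota\rangle$; predicate symbols $=$ of arity $\langle\iota,\iota\rangle$, $N,\mathit{Null}$ of arity $\langle\iota\rangle$, $\epsilon_n$ of arity $\langle\iota,\ldots,\iota,\kappa_n\rangle$ (written $x_1,\ldots,x_n\,\epsilon_n\,c$; $\epsilon_0(c)$ for $n=0$); and for each type $A$ containing no symbol of this last kind with free variables among $x_1,\ldots,x_p$ (of sort $\iota$), $y_1,\ldots,y_n$, a function symbol $f_{\langle x_1..x_p\rangle,\langle y_1..y_n\rangle,A}$ with values in $\kappa_p$. The congruence $\equiv$ is the one generated by the rewrite rules $x_1,\ldots,x_p\,\epsilon_p\,f_{\langle x_1..x_p\rangle,\langle y_1..y_n\rangle,A}(y_1,\ldots,y_n)\to A$; $x=y\to\forall c\,(x\,\epsilon_1\,c\Rightarrow y\,\epsilon_1\,c)$; $N(x)\to\forall c\,(0\,\epsilon_1\,c\Rightarrow\forall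 y\,(N(y)\Rightarrow y\,\epsilon_1\,c\Rightarrow S(y)\,\epsilon_1\,c)\Rightarrow x\,\epsilon_1\,c)$; $\mathit{Null}(0)\to\forall c\,(\epsilon_0(c)\Rightarrow\epsilon_0(c))$; $\mathit{Null}(S(x))\to\forall c\,\epsilon_0(c)$; $\mathit{Pred}(0)\to0$; $\mathit{Pred}(S(x))\to x$. Abbreviations: $A\wedge B=\forall c\,((A\Rightarrow B\Rightarrow\epsilon_0(c))\Rightarrow\epsilon_0(c))$, $\exists x\,A=\forall c\,((\forall x\,(A\Rightarrow\epsilon_0(c)))\Rightarrow\epsilon_0(c))$ ($c$ of sort $\kappa_0$, fresh). A type is provable in $HA_2$ if some scheme has that type in the empty context. $\underline{n}=S^n(0)$. Parigot numerals: with $A_0=(0\,\epsilon_1\,c)$ and $B_0=\forall y\,(N(y)\Rightarrow y\,\epsilon_1\,c\Rightarrow S(y)\,\epsilon_1\,c)$, $\rho_0=\Lambda c\,\lambda_{A_0}\lambda_{B_0}\,\mathbf{v}_{A_0}$ and $\rho_{n+1}=\Lambda c\,\lambda_{A_0}\lambda_{B_0}\,(\mathbf{v}_{B_0}\ \underline{n}\ \rho_n\ (\rho_n\ c\ \mathbf{v}_{A_0}\ \mathbf{v}_{B_0}))$; $\rho_n$ has type $N(\underline{n})$. Witness extraction: given a closed type $\exists y\,B$ and a scheme $s$ with $\vdash s:\exists y\,B$, let $c$ be a variable of sort $\kappa_0$ and $g=\mathbf{v}_{\forall y\,(B\Rightarrow\epsilon_0(c))}$; the weak minimal normal form of $(s\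 c\ g)$ in context $\{\forall y\,(B\Rightarrow\epsilon_0(c))\}$ has the form $(g\ a\ u)$ with $a$ a term; the extracted witness is $[e/c]a$ where $e=f_{\langle\rangle,\langle\rangle,\exists y\,B}$. Provably total: $f:\mathbb{N}^n\to\mathbb{N}$ is provably total in $HA_2$ if there is a type $A$ with free variables among $x_1,\ldots,x_n,y$ (sort $\iota$) such that $[\underline{p_1}/x_1,\ldots,\underline{p_n}/x_n,\underline{q}/y]A$ is provable in $HA_2$ iff $q=f(p_1,\ldots,p_n)$, and $\forall x_1\,(N(x_1)\Rightarrow\cdots\Rightarrow\forall x_n\,(N(x_n)\Rightarrow\exists y\,(N(y)\wedge A))\ldots)$ is provable in $HA_2$. *)

theory Defs
  imports "HOL-Library.FSet"
begin

text \<open>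
  Variables of sort \<open>\<sigma>\<close> are written \<open>Var \<sigma> i\<close>. De Bruijn indices are counted separately for
  each sort: a binder of sort \<open>\<sigma>\<close> binds index 0 of sort \<open>\<sigma>\<close> and shifts only the variables of
  sort \<open>\<sigma>\<close>. So every variable carries its sort, each sort has infinitely many variables, and
  alpha-equivalent types (or schemes) are equal. A free variable is named by its index at top
  level; \<open>abs_var\<close> below binds a named free variable.

  In \<open>Comp xs ys A bs\<close>, the triple \<open>xs\<close>, \<open>ys\<close>, \<open>A\<close> is the index of the function symbol
  \<open>f\<close> with values in \<open>Kappa (length xs)\<close>: \<open>xs\<close> names variables of sort \<open>Iota\<close>, \<open>ys\<close>
  names variables of any sort. Only \<open>bs\<close> are subterms; substitution and rewriting never touch
  the index \<open>A\<close>.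
\<close>

datatype srt = Iota | Kappa nat

datatype tm =
    Var srt nat
  | Zero
  | Succ tm
  | Pred tm
  | Comp "nat list" "(srt \<times> nat) list" ty "tm list"
and ty =
    Eq tm tm
  | N tm
  | Null tm
  | Eps "tm list" tm
  | Imp ty ty
  | Forall srt ty

datatype sch =
    V ty
  | Lam ty sch
  | App sch sch
  | TLam srt sch
  | TApp sch tm

subsection \<open>Substitution and free variables\<close>

type_synonym sub = "srt \<Rightarrow> nat \<Rightarrow> tm"

fun subst_tm :: "sub \<Rightarrow> tm \<Rightarrow> tm" where
  "subst_tm \<theta> (Var \<sigma> i) = \<theta> \<sigma> i"
| "subst_tm \<theta> Zero = Zero"
| "subst_tm \<theta> (Succ a) = Succ (subst_tm \<theta> a)"
| "subst_tm \<theta> (Pred a) = Pred (subst_tm \<theta> a)"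
| "subst_tm \<theta> (Comp xs ys A bs) = Comp xs ys A (map (subst_tm \<theta>) bs)"

definition shift :: "srt \<Rightarrow> sub" where
  "shift \<sigma> \<tau> i = Var \<tau> (if \<tau> = \<sigma> then Suc i else i)"

definition up :: "srt \<Rightarrow> sub \<Rightarrow> sub" where
  "up \<sigma> \<theta> \<tau> i =
    (if \<tau> = \<sigma>
     then (case i of 0 \<Rightarrow> Var \<sigma> 0 | Suc j \<Rightarrow> subst_tm (shift \<sigma>) (\<theta> \<sigma> j))
     else subst_tm (shift \<sigma>) (\<theta> \<tau> i))"

primrec subst_ty :: "sub \<Rightarrow> ty \<Rightarrow> ty" where
  "subst_ty \<theta> (Eq a b) = Eq (subst_tm \<theta> a) (subst_tm \<theta> b)"
| "subst_ty \<theta> (N a) = N (subst_tm \<theta> a)"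
| "subst_ty \<theta> (Null a) = Null (subst_tm \<theta> a)"
| "subst_ty \<theta> (Eps as c) = Eps (map (subst_tm \<theta>) as) (subst_tm \<theta> c)"
| "subst_ty \<theta> (Imp A B) = Imp (subst_ty \<theta> A) (subst_ty \<theta> B)"
| "subst_ty \<theta> (Forall \<sigma> A) = Forall \<sigma> (subst_ty (up \<sigma> \<theta>) A)"

primrec subst_sch :: "sub \<Rightarrow> sch \<Rightarrow> sch" where
  "subst_sch \<theta> (V A) = V (subst_ty \<theta> A)"
| "subst_sch \<theta> (Lam A t) = Lam (subst_ty \<theta> A) (subst_sch \<theta> t)"
| "subst_sch \<theta> (App t u) = App (subst_sch \<theta> t) (subst_sch \<theta> u)"
| "subst_sch \<theta> (TLam \<sigma> t) = TLam \<sigma> (subst_sch (up \<sigma> \<theta>) t)"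
| "subst_sch \<theta> (TApp t a) = TApp (subst_sch \<theta> t) (subst_tm \<theta> a)"

abbreviation lift_tm :: "srt \<Rightarrow> tm \<Rightarrow> tm" where
  "lift_tm \<sigma> \<equiv> subst_tm (shift \<sigma>)"

abbreviation lift_ty :: "srt \<Rightarrow> ty \<Rightarrow> ty" where
  "lift_ty \<sigma> \<equiv> subst_ty (shift \<sigma>)"

abbreviation lift_sch :: "srt \<Rightarrow> sch \<Rightarrow> sch" where
  "lift_sch \<sigma> \<equiv> subst_sch (shift \<sigma>)"

text \<open>Instantiates a bound variable when its binder is removed.\<close>

definition inst :: "srt \<Rightarrow> tm \<Rightarrow> sub" where
  "inst \<sigma> a \<tau> i =
    (if \<tau> = \<sigma> then (case i of 0 \<Rightarrow> a | Suc j \<Rightarrow> Var \<sigma> j) else Var \<tau> i)"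

text \<open>Simultaneous substitution for named free variables, leaving all others unchanged.\<close>

definition subst_of :: "((srt \<times> nat) \<times> tm) list \<Rightarrow> sub" where
  "subst_of ps \<sigma> i = (case map_of ps (\<sigma>, i) of None \<Rightarrow> Var \<sigma> i | Some a \<Rightarrow> a)"

text \<open>Turns the free variable \<open>Var \<sigma> k\<close> into the variable bound by a new binder of sort \<open>\<sigma>\<close>.\<close>

definition abs_var :: "srt \<Rightarrow> nat \<Rightarrow> ty \<Rightarrow> ty" where
  "abs_var \<sigma> k A =
    subst_ty (\<lambda>\<tau> i. if \<tau> = \<sigma> then (if i = k then Var \<sigma> 0 else Var \<sigma> (Suc i)) else Var \<tau> i) A"

fun fv_tm :: "tm \<Rightarrow> (srt \<times> nat) set" where
  "fv_tm (Var \<sigma> i) = {(\<sigma>, i)}"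
| "fv_tm Zero = {}"
| "fv_tm (Succ a) = fv_tm a"
| "fv_tm (Pred a) = fv_tm a"
| "fv_tm (Comp xs ys A bs) = (\<Union>b \<in> set bs. fv_tm b)"

primrec fv_ty :: "ty \<Rightarrow> (srt \<times> nat) set" where
  "fv_ty (Eq a b) = fv_tm a \<union> fv_tm b"
| "fv_ty (N a) = fv_tm a"
| "fv_ty (Null a) = fv_tm a"
| "fv_ty (Eps as c) = (\<Union>a \<in> set as. fv_tm a) \<union> fv_tm c"
| "fv_ty (Imp A B) = fv_ty A \<union> fv_ty B"
| "fv_ty (Forall \<sigma> A) = {(\<tau>, i). (\<tau>, if \<tau> = \<sigma> then Suc i else i) \<in> fv_ty A}"

subsection \<open>Well-sorted terms and types\<close>

fun comp_free_tm :: "tm \<Rightarrow> bool" where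
  "comp_free_tm (Var \<sigma> i) \<longleftrightarrow> True"
| "comp_free_tm Zero \<longleftrightarrow> True"
| "comp_free_tm (Succ a) \<longleftrightarrow> comp_free_tm a"
| "comp_free_tm (Pred a) \<longleftrightarrow> comp_free_tm a"
| "comp_free_tm (Comp xs ys A bs) \<longleftrightarrow> False"

primrec comp_free :: "ty \<Rightarrow> bool" where
  "comp_free (Eq a b) \<longleftrightarrow> comp_free_tm a \<and> comp_free_tm b"
| "comp_free (N a) \<longleftrightarrow> comp_free_tm a"
| "comp_free (Null a) \<longleftrightarrow> comp_free_tm a"
| "comp_free (Eps as c) \<longleftrightarrow> (\<forall>a \<in> set as. comp_free_tm a) \<and> comp_free_tm c"
| "comp_free (Imp A B) \<longleftrightarrow> comp_free A \<and> comp_free B"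
| "comp_free (Forall \<sigma> A) \<longleftrightarrow> comp_free A"

inductive has_sort :: "tm \<Rightarrow> srt \<Rightarrow> bool" and wf_ty :: "ty \<Rightarrow> bool" where
  sort_Var: "has_sort (Var \<sigma> i) \<sigma>"
| sort_Zero: "has_sort Zero Iota"
| sort_Succ: "has_sort a Iota \<Longrightarrow> has_sort (Succ a) Iota"
| sort_Pred: "has_sort a Iota \<Longrightarrow> has_sort (Pred a) Iota"
| sort_Comp: "distinct (map (Pair Iota) xs @ ys) \<Longrightarrow> wf_ty A \<Longrightarrow> comp_free A \<Longrightarrow>
    fv_ty A \<subseteq> set (map (Pair Iota) xs @ ys) \<Longrightarrow>
    list_all2 has_sort bs (map fst ys) \<Longrightarrow>
    has_sort (Comp xs ys A bs) (Kappa (length xs))"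
| wf_Eq: "has_sort a Iota \<Longrightarrow> has_sort b Iota \<Longrightarrow> wf_ty (Eq a b)"
| wf_N: "has_sort a Iota \<Longrightarrow> wf_ty (N a)"
| wf_Null: "has_sort a Iota \<Longrightarrow> wf_ty (Null a)"
| wf_Eps: "\<forall>a \<in> set as. has_sort a Iota \<Longrightarrow> has_sort c (Kappa (length as)) \<Longrightarrow> wf_ty (Eps as c)"
| wf_Imp: "wf_ty A \<Longrightarrow> wf_ty B \<Longrightarrow> wf_ty (Imp A B)"
| wf_Forall: "wf_ty A \<Longrightarrow> wf_ty (Forall \<sigma> A)"

subsection \<open>The congruence\<close>

text \<open>
  The side conditions restrict the rules to well-sorted instances, so that rewriting, in either
  direction, does not leave the well-sorted terms and types.
\<close>

inductive tm_red :: "tm \<Rightarrow> tm \<Rightarrow> bool" where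
  Pred_Zero: "tm_red (Pred Zero) Zero"
| Pred_Succ: "has_sort a Iota \<Longrightarrow> tm_red (Pred (Succ a)) a"
| in_Succ: "tm_red a a' \<Longrightarrow> tm_red (Succ a) (Succ a')"
| in_Pred: "tm_red a a' \<Longrightarrow> tm_red (Pred a) (Pred a')"
| in_Comp: "tm_red b b' \<Longrightarrow> tm_red (Comp xs ys A (bs @ b # cs)) (Comp xs ys A (bs @ b' # cs))"

definition par_zero :: "tm \<Rightarrow> ty" where
  "par_zero c = Eps [Zero] c"

definition par_succ :: "tm \<Rightarrow> ty" where
  "par_succ c =
    Forall Iota (Imp (N (Var Iota 0))
      (Imp (Eps [Var Iota 0] (lift_tm Iota c)) (Eps [Succ (Var Iota 0)] (lift_tm Iota c))))"

inductive ty_red :: "ty \<Rightarrow> ty \<Rightarrow> bool" where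
  red_Comp: "has_sort (Comp xs ys A bs) (Kappa (length as)) \<Longrightarrow> \<forall>a \<in> set as. has_sort a Iota \<Longrightarrow>
    ty_red (Eps as (Comp xs ys A bs))
      (subst_ty (subst_of (zip (map (Pair Iota) xs @ ys) (as @ bs))) A)"
| red_Eq: "has_sort a Iota \<Longrightarrow> has_sort b Iota \<Longrightarrow>
    ty_red (Eq a b)
      (Forall (Kappa 1) (Imp (Eps [lift_tm (Kappa 1) a] (Var (Kappa 1) 0))
        (Eps [lift_tm (Kappa 1) b] (Var (Kappa 1) 0))))"
| red_N: "has_sort a Iota \<Longrightarrow>
    ty_red (N a)
      (Forall (Kappa 1) (Imp (par_zero (Var (Kappa 1) 0)) (Imp (par_succ (Var (Kappa 1) 0))
        (Eps [lift_tm (Kappa 1) a] (Var (Kappa 1) 0)))))"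
| red_Null_Zero:
    "ty_red (Null Zero) (Forall (Kappa 0) (Imp (Eps [] (Var (Kappa 0) 0)) (Eps [] (Var (Kappa 0) 0))))"
| red_Null_Succ: "has_sort a Iota \<Longrightarrow>
    ty_red (Null (Succ a)) (Forall (Kappa 0) (Eps [] (Var (Kappa 0) 0)))"
| in_Eq1: "tm_red a a' \<Longrightarrow> ty_red (Eq a b) (Eq a' b)"
| in_Eq2: "tm_red b b' \<Longrightarrow> ty_red (Eq a b) (Eq a b')"
| in_N: "tm_red a a' \<Longrightarrow> ty_red (N a) (N a')"
| in_Null: "tm_red a a' \<Longrightarrow> ty_red (Null a) (Null a')"
| in_Eps1: "tm_red a a' \<Longrightarrow> ty_red (Eps (as @ a # bs) c) (Eps (as @ a' # bs) c)"
| in_Eps2: "tm_red c c' \<Longrightarrow> ty_red (Eps as c) (Eps as c')"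
| in_Imp1: "ty_red A A' \<Longrightarrow> ty_red (Imp A B) (Imp A' B)"
| in_Imp2: "ty_red B B' \<Longrightarrow> ty_red (Imp A B) (Imp A B')"
| in_Forall: "ty_red A A' \<Longrightarrow> ty_red (Forall \<sigma> A) (Forall \<sigma> A')"

definition ty_cong :: "ty \<Rightarrow> ty \<Rightarrow> bool" where
  "ty_cong = equivclp ty_red"

subsection \<open>Typing and weak minimal reduction\<close>

text \<open>
  In \<open>ty_TLam\<close>, shifting the context expresses that the bound variable is not free in it.
\<close>

inductive typed :: "ty fset \<Rightarrow> sch \<Rightarrow> ty \<Rightarrow> bool" where
  ty_V: "A |\<in>| \<Gamma> \<Longrightarrow> wf_ty A \<Longrightarrow> typed \<Gamma> (V A) A"
| ty_Lam: "wf_ty A \<Longrightarrow> typed (finsert A \<Gamma>) t B \<Longrightarrow> typed \<Gamma> (Lam A t) (Imp A B)"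
| ty_App: "typed \<Gamma> t (Imp A B) \<Longrightarrow> typed \<Gamma> u A \<Longrightarrow> typed \<Gamma> (App t u) B"
| ty_TLam: "typed (lift_ty \<sigma> |`| \<Gamma>) t A \<Longrightarrow> typed \<Gamma> (TLam \<sigma> t) (Forall \<sigma> A)"
| ty_TApp: "typed \<Gamma> t (Forall \<sigma> A) \<Longrightarrow> has_sort a \<sigma> \<Longrightarrow> typed \<Gamma> (TApp t a) (subst_ty (inst \<sigma> a) A)"
| ty_conv: "typed \<Gamma> t A \<Longrightarrow> ty_cong A B \<Longrightarrow> typed \<Gamma> t B"

definition provable :: "ty \<Rightarrow> bool" where
  "provable A \<longleftrightarrow> (\<exists>t. typed {||} t A)"

text \<open>
  \<open>msubst \<Gamma> A u t\<close> is the minimal substitution of \<open>u\<close> for the variable of type \<open>A\<close> in \<open>t\<close>,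
  in the context \<open>\<Gamma>\<close>. Scheme variables free in \<open>u\<close> may be captured by \<open>Lam\<close>; only capture of
  term variables is avoided.
\<close>

primrec msubst :: "ty fset \<Rightarrow> ty \<Rightarrow> sch \<Rightarrow> sch \<Rightarrow> sch" where
  "msubst \<Gamma> A u (V B) = (if B = A \<and> A |\<notin>| \<Gamma> then u else V B)"
| "msubst \<Gamma> A u (Lam B t) = Lam B (msubst (finsert B \<Gamma>) A u t)"
| "msubst \<Gamma> A u (App t t') = App (msubst \<Gamma> A u t) (msubst \<Gamma> A u t')"
| "msubst \<Gamma> A u (TLam \<sigma> t) = TLam \<sigma> (msubst (lift_ty \<sigma> |`| \<Gamma>) (lift_ty \<sigma> A) (lift_sch \<sigma> u) t)"
| "msubst \<Gamma> A u (TApp t a) = TApp (msubst \<Gamma> A u t) a"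

inductive wred :: "ty fset \<Rightarrow> sch \<Rightarrow> sch \<Rightarrow> bool" for \<Gamma> where
  wred_Lam: "wred \<Gamma> (App (Lam A t) u) (msubst \<Gamma> A u t)"
| wred_TLam: "wred \<Gamma> (TApp (TLam \<sigma> t) a) (subst_sch (inst \<sigma> a) t)"
| wred_App: "wred \<Gamma> t t' \<Longrightarrow> wred \<Gamma> (App t u) (App t' u)"
| wred_TApp: "wred \<Gamma> t t' \<Longrightarrow> wred \<Gamma> (TApp t a) (TApp t' a)"

definition normal_form_of :: "('a \<Rightarrow> 'a \<Rightarrow> bool) \<Rightarrow> 'a \<Rightarrow> 'a \<Rightarrow> bool" where
  "normal_form_of r s t \<longleftrightarrow> r\<^sup>*\<^sup>* s t \<and> (\<nexists>t'. r t t')"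

subsection \<open>Conjunction, existential quantification, numerals\<close>

definition Conj :: "ty \<Rightarrow> ty \<Rightarrow> ty" where
  "Conj A B =
    Forall (Kappa 0) (Imp
      (Imp (lift_ty (Kappa 0) A) (Imp (lift_ty (Kappa 0) B) (Eps [] (Var (Kappa 0) 0))))
      (Eps [] (Var (Kappa 0) 0)))"

text \<open>
  \<open>to_eps \<sigma> B c\<close> is the type \<open>\<forall>y (B \<Rightarrow> \<epsilon>\<^sub>0(c))\<close>, where \<open>B\<close> is a body in which \<open>y\<close> is the
  bound variable of sort \<open>\<sigma>\<close> with index 0, and \<open>c\<close> is a term outside the quantifier.
\<close>

definition to_eps :: "srt \<Rightarrow> ty \<Rightarrow> tm \<Rightarrow> ty" where
  "to_eps \<sigma> B c = Forall \<sigma> (Imp B (Eps [] (lift_tm \<sigma> c)))"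

definition Exists :: "srt \<Rightarrow> ty \<Rightarrow> ty" where
  "Exists \<sigma> B =
    Forall (Kappa 0) (Imp
      (to_eps \<sigma> (subst_ty (up \<sigma> (shift (Kappa 0))) B) (Var (Kappa 0) 0))
      (Eps [] (Var (Kappa 0) 0)))"

primrec num :: "nat \<Rightarrow> tm" where
  "num 0 = Zero"
| "num (Suc n) = Succ (num n)"

text \<open>Parigot numerals; \<open>num n\<close> and \<open>rho n\<close> are closed, hence not lifted under the binder.\<close>

primrec rho :: "nat \<Rightarrow> sch" where
  "rho 0 =
    (let c = Var (Kappa 1) 0 in
      TLam (Kappa 1) (Lam (par_zero c) (Lam (par_succ c) (V (par_zero c)))))"
| "rho (Suc n) =
    (let c = Var (Kappa 1) 0 in
      TLam (Kappa 1) (Lam (par_zero c) (Lam (par_succ c)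
        (App (App (TApp (V (par_succ c)) (num n)) (rho n))
          (App (App (TApp (rho n) c) (V (par_zero c))) (V (par_succ c)))))))"

subsection \<open>Witness extraction\<close>

text \<open>
  \<open>extracted_witness \<sigma> B k s w\<close>: \<open>w\<close> is the witness extracted from the scheme \<open>s\<close> of closed
  type \<open>Exists \<sigma> B\<close>, using \<open>Var (Kappa 0) k\<close> as the variable \<open>c\<close>. The symbol of \<open>e\<close> is
  a symbol of the language only if \<open>B\<close> is \<open>comp_free\<close>; the definition is purely syntactic and does
  not impose this.
\<close>

definition extracted_witness :: "srt \<Rightarrow> ty \<Rightarrow> nat \<Rightarrow> sch \<Rightarrow> tm \<Rightarrow> bool" where
  "extracted_witness \<sigma> B k s w \<longleftrightarrow>
    wf_ty (Exists \<sigma> B) \<and> fv_ty (Exists \<sigma> B) = {} \<and> typed {||} s (Exists \<sigma> B) \<and>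
    (let c = Var (Kappa 0) k; G = to_eps \<sigma> B c; e = Comp [] [] (Exists \<sigma> B) [] in
      \<exists>a u. normal_form_of (wred {|G|}) (App (TApp s c) (V G)) (App (TApp (V G) a) u) \<and>
        w = subst_tm (subst_of [((Kappa 0, k), e)]) a)"

subsection \<open>Provably total functions\<close>

text \<open>
  An \<open>n\<close>-ary function is given by its values on lists of length \<open>n\<close>. In \<open>total_type\<close>, \<open>xs\<close>
  and \<open>y\<close> name the free variables of \<open>A\<close>.
\<close>

definition inst_nums :: "nat list \<Rightarrow> nat list \<Rightarrow> ty \<Rightarrow> ty" where
  "inst_nums xs ps A = subst_ty (subst_of (zip (map (Pair Iota) xs) (map num ps))) A"

definition total_body :: "nat \<Rightarrow> ty \<Rightarrow> ty" where
  "total_body y A = abs_var Iota y (Conj (N (Var Iota y)) A)"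

definition total_type :: "nat list \<Rightarrow> nat \<Rightarrow> ty \<Rightarrow> ty" where
  "total_type xs y A =
    foldr (\<lambda>x C. Forall Iota (abs_var Iota x (Imp (N (Var Iota x)) C))) xs (Exists Iota (total_body y A))"

definition provably_total_via ::
  "nat \<Rightarrow> (nat list \<Rightarrow> nat) \<Rightarrow> nat list \<Rightarrow> nat \<Rightarrow> ty \<Rightarrow> bool" where
  "provably_total_via n f xs y A \<longleftrightarrow>
    length xs = n \<and> distinct (xs @ [y]) \<and> wf_ty A \<and> fv_ty A \<subseteq> Pair Iota ` set (xs @ [y]) \<and>
    (\<forall>ps q. length ps = n \<longrightarrow> (provable (inst_nums (xs @ [y]) (ps @ [q]) A) \<longleftrightarrow> q = f ps)) \<and>
    provable (total_type xs y A)"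

definition app_nums :: "sch \<Rightarrow> nat list \<Rightarrow> sch" where
  "app_nums t ps = foldl (\<lambda>s p. App (TApp s (num p)) (rho p)) t ps"

subsection \<open>Computable functions\<close>

text \<open>Partial recursive functions, with primitive recursion and minimisation on the first argument.\<close>

datatype recf =
    RZero
  | RSucc
  | RProj nat
  | RComp recf "recf list"
  | RPrim recf recf
  | RMin recf

inductive rec_eval :: "recf \<Rightarrow> nat list \<Rightarrow> nat \<Rightarrow> bool" where
  "rec_eval RZero ps 0"
| "rec_eval RSucc [p] (Suc p)"
| "i < length ps \<Longrightarrow> rec_eval (RProj i) ps (ps ! i)"
| "list_all2 (\<lambda>g q. rec_eval g ps q) gs qs \<Longrightarrow> rec_eval h qs r \<Longrightarrow> rec_eval (RComp h gs) ps r"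
| "rec_eval g ps r \<Longrightarrow> rec_eval (RPrim g h) (0 # ps) r"
| "rec_eval (RPrim g h) (m # ps) q \<Longrightarrow> rec_eval h (m # q # ps) r \<Longrightarrow>
    rec_eval (RPrim g h) (Suc m # ps) r"
| "rec_eval g (m # ps) 0 \<Longrightarrow> \<forall>j<m. \<exists>q>0. rec_eval g (j # ps) q \<Longrightarrow> rec_eval (RMin g) ps m"

definition computable :: "nat \<Rightarrow> (nat list \<Rightarrow> nat) \<Rightarrow> bool" where
  "computable n f \<longleftrightarrow> (\<exists>h. \<forall>ps. length ps = n \<longrightarrow> (\<forall>r. rec_eval h ps r \<longleftrightarrow> r = f ps))"

end

theory Submission
  imports Defs
begin

text \<open>
  Weak minimal reduction does not normalise all typed schemes: instantiating a term variable may
  identify two types, hence two scheme variables, and the resulting test for equality of types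
  behaves like Girard's J operator. With \<open>E = \<epsilon>\<^sub>0(e)\<close> congruent to \<open>\<forall>c (\<epsilon>\<^sub>0(c) \<Rightarrow> \<epsilon>\<^sub>0(c))\<close>,
  \<open>\<omega> = \<lambda>\<^sub>E (v\<^sub>E e v\<^sub>E)\<close> and \<open>D = \<Lambda>c ((\<lambda>\<^bsub>\<epsilon>(c)\<Rightarrow>\<epsilon>(c)\<^esub> \<lambda>\<^bsub>E\<Rightarrow>E\<^esub> v\<^bsub>\<epsilon>(c)\<Rightarrow>\<epsilon>(c)\<^esub>) id \<omega>)\<close>, the scheme \<open>D e D\<close>
  reduces to \<open>\<omega> D\<close> and then to itself. So the scheme \<open>t\<close> cannot be an arbitrary proof of
  totality. Instead, every type is congruent to atoms that carry a tag chosen at will and invariant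
  under substitution; a proof is rewritten such that nested abstractions have different tags, and no
  two variables in scope are ever identified.

  For tagged schemes, reducibility with impredicative candidates works. Candidates are sets of typed
  schemes, so that confluence and subject reduction are not needed. The variable \<open>c\<close> of the witness
  extraction is interpreted by the schemes that reduce to some \<open>g a u\<close> with \<open>u\<close> of type \<open>[a/y]B\<close>.
  In this typing of \<open>u\<close>, replace \<open>c\<close> by a code of a provable type and all number variables by the
  numeral of \<open>m\<close>: then \<open>A\<close> is provable at the value of \<open>a\<close> at \<open>m\<close>, which is hence \<open>f(ps)\<close> for every
  \<open>m\<close>, and a term with constant value normalises to a numeral.
\<close>

text \<open>The induction rules of the datatype package are mutual; these ones treat the index of \<open>Comp\<close> as
  atomic.\<close>

lemma tm_only_induct [case_names Var Zero Succ Pred Comp, induct type: tm]: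
  assumes "\<And>\<sigma> i. P (Var \<sigma> i)" "P Zero" "\<And>a. P a \<Longrightarrow> P (Succ a)" "\<And>a. P a \<Longrightarrow> P (Pred a)"
    "\<And>xs ys A bs. (\<And>b. b \<in> set bs \<Longrightarrow> P b) \<Longrightarrow> P (Comp xs ys A bs)"
  shows "P a"
  by (rule fv_tm.induct[of P]) (use assms in auto)

lemma ty_only_induct [case_names Eq N Null Eps Imp Forall, induct type: ty]:
  assumes "\<And>a b. P (Eq a b)" "\<And>a. P (N a)" "\<And>a. P (Null a)" "\<And>cs c. P (Eps cs c)"
    "\<And>A B. P A \<Longrightarrow> P B \<Longrightarrow> P (Imp A B)" "\<And>\<sigma> A. P A \<Longrightarrow> P (Forall \<sigma> A)"
  shows "P A"
  by (rule ty.induct[of "\<lambda>_. True" P]) (use assms in auto)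

section \<open>Calculus of sort-indexed de Bruijn substitutions\<close>

definition csub :: "sub \<Rightarrow> sub \<Rightarrow> sub" where
  "csub \<theta> \<eta> \<sigma> i = subst_tm \<theta> (\<eta> \<sigma> i)"

text \<open>Polymorphic in the values, so that the same operation extends substitutions by a term
  and, later, environments by a denotation.\<close>

definition scons :: "srt \<Rightarrow> 'd \<Rightarrow> (srt \<Rightarrow> nat \<Rightarrow> 'd) \<Rightarrow> srt \<Rightarrow> nat \<Rightarrow> 'd" where
  "scons \<sigma> a \<theta> \<tau> i = (if \<tau> = \<sigma> then (case i of 0 \<Rightarrow> a | Suc j \<Rightarrow> \<theta> \<sigma> j) else \<theta> \<tau> i)"

text \<open>With \<open>inst_eq\<close>, this expresses both binder operations by
  \<open>scons\<close>, \<open>csub\<close> and \<open>shift\<close>. The simplification rules below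
  normalise such expressions as in the sigma-calculus, so that most equations between substitutions
  are solved by rewriting.\<close>

lemma up_eq: "up \<sigma> \<theta> = scons \<sigma> (Var \<sigma> 0) (csub (shift \<sigma>) \<theta>)"
  by (auto simp: fun_eq_iff up_def scons_def csub_def split: nat.split)

lemma inst_eq: "inst \<sigma> a = scons \<sigma> a Var"
  by (auto simp: fun_eq_iff inst_def scons_def split: nat.split)

lemma scons_0 [simp]: "scons \<sigma> a \<theta> \<sigma> 0 = a"
  by (simp add: scons_def)

lemma scons_Suc [simp]: "scons \<sigma> a \<theta> \<sigma> (Suc i) = \<theta> \<sigma> i"
  by (simp add: scons_def)

lemma scons_other [simp]: "\<tau> \<noteq> \<sigma> \<Longrightarrow> scons \<sigma> a \<theta> \<tau> i = \<theta> \<tau> i"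
  by (simp add: scons_def)

lemma subst_tm_cong_fv:
  "(\<And>\<sigma> i. (\<sigma>, i) \<in> fv_tm a \<Longrightarrow> \<theta> \<sigma> i = \<eta> \<sigma> i) \<Longrightarrow> subst_tm \<theta> a = subst_tm \<eta> a"
proof (induction a)
  case (Comp xs ys A bs)
  show ?case by (auto intro!: Comp)
qed auto

lemma subst_ty_cong_fv:
  "(\<And>\<sigma> i. (\<sigma>, i) \<in> fv_ty A \<Longrightarrow> \<theta> \<sigma> i = \<eta> \<sigma> i) \<Longrightarrow> subst_ty \<theta> A = subst_ty \<eta> A"
proof (induction A arbitrary: \<theta> \<eta>)
  case (Forall \<sigma> A)
  have "up \<sigma> \<theta> \<tau> i = up \<sigma> \<eta> \<tau> i" if "(\<tau>, i) \<in> fv_ty A" for \<tau> i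
    using that Forall.prems[of \<tau> "if \<tau> = \<sigma> then i - 1 else i"]
    by (auto simp: up_def split: nat.splits)
  then show ?case using Forall.IH[of "up \<sigma> \<theta>" "up \<sigma> \<eta>"] by simp
next
  case (Imp A B)
  show ?case using Imp.IH[of \<theta> \<eta>] Imp.prems by simp
qed (auto intro!: subst_tm_cong_fv)

lemma subst_tm_Var [simp]: "subst_tm Var a = a"
proof -
  have "\<theta> = Var \<Longrightarrow> subst_tm \<theta> a = a" for \<theta>
    by (induction a) (auto simp: map_idI)
  then show ?thesis by blast
qed

lemma subst_subst_tm [simp]: "subst_tm \<theta> (subst_tm \<eta> a) = subst_tm (csub \<theta> \<eta>) a"
  by (induction a) (auto simp: csub_def)

lemma csub_Var [simp]: "csub Var \<theta> = \<theta>" "csub \<theta> Var = \<theta>"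
  by (auto simp: csub_def fun_eq_iff)

lemma csub_assoc [simp]: "csub (csub \<theta> \<eta>) \<zeta> = csub \<theta> (csub \<eta> \<zeta>)"
  by (simp add: csub_def fun_eq_iff)

lemma csub_scons [simp]: "csub \<theta> (scons \<sigma> a \<eta>) = scons \<sigma> (subst_tm \<theta> a) (csub \<theta> \<eta>)"
  by (auto simp: csub_def scons_def fun_eq_iff split: nat.split)

lemma csub_scons_shift [simp]: "csub (scons \<sigma> a \<theta>) (shift \<sigma>) = \<theta>"
  by (auto simp: csub_def scons_def shift_def fun_eq_iff)

lemma csub_scons_csub_shift [simp]: "csub (scons \<sigma> a \<theta>) (csub (shift \<sigma>) \<eta>) = csub \<theta> \<eta>"
  using csub_assoc[of "scons \<sigma> a \<theta>" "shift \<sigma>" \<eta>] by simp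

lemma scons_Var_shift [simp]: "scons \<sigma> (Var \<sigma> 0) (shift \<sigma>) = Var"
  by (auto simp: scons_def shift_def fun_eq_iff split: nat.split)

lemma up_Var [simp]: "up \<sigma> Var = Var"
  by (simp add: up_eq)

lemma shift_app [simp]: "shift \<sigma> \<sigma> i = Var \<sigma> (Suc i)" "\<tau> \<noteq> \<sigma> \<Longrightarrow> shift \<sigma> \<tau> i = Var \<tau> i"
  by (auto simp: shift_def)

lemma csub_up [simp]: "csub (up \<sigma> \<theta>) (up \<sigma> \<eta>) = up \<sigma> (csub \<theta> \<eta>)"
  by (simp add: up_eq)

lemma csub_inst_up [simp]: "csub (inst \<sigma> a) (up \<sigma> \<theta>) = scons \<sigma> a \<theta>"
  by (simp add: up_eq inst_eq)

lemma subst_ty_Var [simp]: "subst_ty Var A = A"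
  by (induction A) (auto simp: map_idI)

lemma subst_subst_ty [simp]: "subst_ty \<theta> (subst_ty \<eta> A) = subst_ty (csub \<theta> \<eta>) A"
  by (induction A arbitrary: \<theta> \<eta>) auto

lemma subst_sch_Var [simp]: "subst_sch Var t = t"
  by (induction t) auto

lemma subst_subst_sch [simp]: "subst_sch \<theta> (subst_sch \<eta> t) = subst_sch (csub \<theta> \<eta>) t"
  by (induction t arbitrary: \<theta> \<eta>) auto

lemma lift_ty_inj [simp]: "lift_ty \<sigma> A = lift_ty \<sigma> B \<longleftrightarrow> A = B"
proof
  assume "lift_ty \<sigma> A = lift_ty \<sigma> B"
  \<comment> \<open>Instantiation is a left inverse of lifting. \<open>Zero\<close> may have the
    wrong sort here, which is harmless in a purely syntactic cancellation.\<close>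
  then have "subst_ty (inst \<sigma> Zero) (lift_ty \<sigma> A) = subst_ty (inst \<sigma> Zero) (lift_ty \<sigma> B)" by simp
  then show "A = B" by (simp add: inst_eq)
qed simp

lemma csub_up_shift [simp]: "csub (up \<sigma> \<theta>) (shift \<sigma>) = csub (shift \<sigma>) \<theta>"
  by (simp add: up_eq)

lemma csub_inst_shift [simp]: "csub (inst \<sigma> a) (shift \<sigma>) = Var"
  by (simp add: inst_eq)

lemma csub_inst [simp]: "csub \<theta> (inst \<sigma> a) = scons \<sigma> (subst_tm \<theta> a) \<theta>"
  by (simp add: inst_eq up_eq)

lemma fv_tm_subst: "fv_tm (subst_tm \<theta> a) = (\<Union>(\<sigma>, i) \<in> fv_tm a. fv_tm (\<theta> \<sigma> i))"
  by (induction a) auto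

lemma fv_tm_lift: "fv_tm (lift_tm \<sigma> a) = (\<lambda>(\<tau>, i). (\<tau>, if \<tau> = \<sigma> then Suc i else i)) ` fv_tm a"
  by (auto simp: fv_tm_subst shift_def split: if_splits)

lemma fv_ty_subst: "fv_ty (subst_ty \<theta> A) \<subseteq> (\<Union>(\<sigma>, i) \<in> fv_ty A. fv_tm (\<theta> \<sigma> i))"
proof (induction A arbitrary: \<theta>)
  case (Forall \<sigma> A)
  show ?case
  proof
    fix x assume "x \<in> fv_ty (subst_ty \<theta> (Forall \<sigma> A))"
    then obtain \<tau> i where x: "x = (\<tau>, i)"
      and "(\<tau>, if \<tau> = \<sigma> then Suc i else i) \<in> fv_ty (subst_ty (up \<sigma> \<theta>) A)"
      by auto
    then obtain \<mu> j where j: "(\<mu>, j) \<in> fv_ty A"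
      and i: "(\<tau>, if \<tau> = \<sigma> then Suc i else i) \<in> fv_tm (up \<sigma> \<theta> \<mu> j)"
      using subsetD[OF Forall.IH[of "up \<sigma> \<theta>"]] by blast
    have "\<exists>j'. (\<mu>, j') \<in> fv_ty (Forall \<sigma> A) \<and> (\<tau>, i) \<in> fv_tm (\<theta> \<mu> j')"
    proof (cases "\<mu> = \<sigma>")
      case True
      then obtain j' where j': "j = Suc j'" using i by (cases j) (auto simp: up_def split: if_splits)
      then have "(\<tau>, if \<tau> = \<sigma> then Suc i else i) \<in> fv_tm (lift_tm \<sigma> (\<theta> \<sigma> j'))"
        using i True by (simp add: up_def)
      then have "(\<tau>, i) \<in> fv_tm (\<theta> \<mu> j')"
        using True by (auto simp: fv_tm_lift split: if_splits)
      moreover have "(\<mu>, j') \<in> fv_ty (Forall \<sigma> A)" using j True j' by simp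
      ultimately show ?thesis by blast
    next
      case False
      then have "(\<tau>, if \<tau> = \<sigma> then Suc i else i) \<in> fv_tm (lift_tm \<sigma> (\<theta> \<mu> j))"
        using i by (simp add: up_def)
      then have "(\<tau>, i) \<in> fv_tm (\<theta> \<mu> j)"
        by (auto simp: fv_tm_lift split: if_splits)
      moreover have "(\<mu>, j) \<in> fv_ty (Forall \<sigma> A)" using j False by simp
      ultimately show ?thesis by blast
    qed
    then obtain j' where "(\<mu>, j') \<in> fv_ty (Forall \<sigma> A)" "(\<tau>, i) \<in> fv_tm (\<theta> \<mu> j')" by blast
    then show "x \<in> (\<Union>(\<sigma>, i) \<in> fv_ty (Forall \<sigma> A). fv_tm (\<theta> \<sigma> i))"
      unfolding x by (intro UN_I[of "(\<mu>, j')"]) simp_all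
  qed
next
  case (Imp A B)
  then show ?case by (simp add: UN_Un le_supI1 le_supI2)
next
  case (Eps cs c)
  show ?case by (simp add: fv_tm_subst UN_Un)
next
  case (Eq a b)
  show ?case by (simp add: fv_tm_subst UN_Un)
next
  case (N a)
  show ?case by (simp add: fv_tm_subst)
next
  case (Null a)
  show ?case by (simp add: fv_tm_subst)
qed

lemma finite_fv_tm: "finite (fv_tm a)"
  by (induction a) auto

lemma finite_fv_ty: "finite (fv_ty A)"
proof (induction A)
  case (Forall \<sigma> A)
  have "fv_ty (Forall \<sigma> A) = (\<lambda>(\<tau>, i). (\<tau>, if \<tau> = \<sigma> then Suc i else i)) -` fv_ty A"
    by auto
  moreover have "inj (\<lambda>(\<tau>, i). (\<tau>, if \<tau> = \<sigma> then Suc i else i))"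
    by (auto simp: inj_def split: if_splits)
  ultimately show ?case using Forall.IH by (simp add: finite_vimageI)
qed (auto simp: finite_fv_tm)

section \<open>Well-sorted substitutions\<close>

definition wsub :: "sub \<Rightarrow> bool" where
  "wsub \<theta> \<longleftrightarrow> (\<forall>\<sigma> i. has_sort (\<theta> \<sigma> i) \<sigma>)"

lemma wsubD: "wsub \<theta> \<Longrightarrow> has_sort (\<theta> \<sigma> i) \<sigma>"
  by (simp add: wsub_def)

inductive_cases has_sort_VarE: "has_sort (Var \<sigma> i) \<tau>"
inductive_cases has_sort_ZeroE: "has_sort Zero \<tau>"
inductive_cases has_sort_SuccE: "has_sort (Succ a) \<tau>"
inductive_cases has_sort_PredE: "has_sort (Pred a) \<tau>"
inductive_cases has_sort_CompE: "has_sort (Comp xs ys A bs) \<tau>"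
inductive_cases wf_EqE: "wf_ty (Eq a b)"
inductive_cases wf_NE: "wf_ty (N a)"
inductive_cases wf_NullE: "wf_ty (Null a)"
inductive_cases wf_EpsE: "wf_ty (Eps cs c)"
inductive_cases wf_ImpE: "wf_ty (Imp A B)"
inductive_cases wf_ForallE: "wf_ty (Forall \<sigma> A)"

lemma has_sort_simps [simp]:
  "has_sort (Var \<sigma> i) \<tau> \<longleftrightarrow> \<tau> = \<sigma>"
  "has_sort Zero \<tau> \<longleftrightarrow> \<tau> = Iota"
  "has_sort (Succ a) \<tau> \<longleftrightarrow> \<tau> = Iota \<and> has_sort a Iota"
  "has_sort (Pred a) \<tau> \<longleftrightarrow> \<tau> = Iota \<and> has_sort a Iota"
  by (auto elim: has_sort_VarE has_sort_ZeroE has_sort_SuccE has_sort_PredE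
      intro: has_sort_wf_ty.intros)

lemma has_sort_Comp:
  "has_sort (Comp xs ys A bs) \<tau> \<longleftrightarrow> \<tau> = Kappa (length xs) \<and> distinct (map (Pair Iota) xs @ ys) \<and>
    wf_ty A \<and> comp_free A \<and> fv_ty A \<subseteq> set (map (Pair Iota) xs @ ys) \<and>
    list_all2 has_sort bs (map fst ys)"
  by (rule iffI; (elim has_sort_CompE)?) (auto intro!: sort_Comp)

lemma wf_ty_simps [simp]:
  "wf_ty (Eq a b) \<longleftrightarrow> has_sort a Iota \<and> has_sort b Iota"
  "wf_ty (N a) \<longleftrightarrow> has_sort a Iota"
  "wf_ty (Null a) \<longleftrightarrow> has_sort a Iota"
  "wf_ty (Eps cs c) \<longleftrightarrow> (\<forall>a \<in> set cs. has_sort a Iota) \<and> has_sort c (Kappa (length cs))"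
  "wf_ty (Imp A B) \<longleftrightarrow> wf_ty A \<and> wf_ty B"
  "wf_ty (Forall \<sigma> A) \<longleftrightarrow> wf_ty A"
  by (auto elim: wf_EqE wf_NE wf_NullE wf_EpsE wf_ImpE wf_ForallE intro: has_sort_wf_ty.intros)

lemma has_sort_unique: "has_sort a \<sigma> \<Longrightarrow> has_sort a \<tau> \<Longrightarrow> \<sigma> = \<tau>"
  by (cases a) (auto simp: has_sort_Comp)

lemma has_sort_subst: "wsub \<theta> \<Longrightarrow> has_sort a \<sigma> \<Longrightarrow> has_sort (subst_tm \<theta> a) \<sigma>"
proof (induction a arbitrary: \<sigma>)
  case (Comp xs ys A bs)
  then show ?case
    by (auto simp: has_sort_Comp list_all2_conv_all_nth)
qed (auto simp: wsub_def)

lemma wsub_Var [simp]: "wsub Var"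
  by (simp add: wsub_def)

lemma wsub_shift [simp]: "wsub (shift \<sigma>)"
  by (simp add: wsub_def shift_def)

lemma wsub_csub [simp]: "wsub \<theta> \<Longrightarrow> wsub \<eta> \<Longrightarrow> wsub (csub \<theta> \<eta>)"
  by (simp add: wsub_def csub_def) (metis has_sort_subst wsub_def)

lemma wsub_scons [simp]: "wsub \<theta> \<Longrightarrow> has_sort a \<sigma> \<Longrightarrow> wsub (scons \<sigma> a \<theta>)"
  by (auto simp: wsub_def scons_def split: nat.split)

lemma wsub_up [simp]: "wsub \<theta> \<Longrightarrow> wsub (up \<sigma> \<theta>)"
  by (simp add: up_eq)

lemma wsub_inst [simp]: "has_sort a \<sigma> \<Longrightarrow> wsub (inst \<sigma> a)"
  by (simp add: inst_eq)

lemma wf_ty_subst: "wsub \<theta> \<Longrightarrow> wf_ty A \<Longrightarrow> wf_ty (subst_ty \<theta> A)"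
  by (induction A arbitrary: \<theta>) (auto simp: has_sort_subst)

section \<open>The substitution that unfolds a comprehension symbol\<close>

abbreviation keys :: "nat list \<Rightarrow> (srt \<times> nat) list \<Rightarrow> (srt \<times> nat) list" where
  "keys xs ys \<equiv> map (Pair Iota) xs @ ys"

lemma map_of_zip_Some:
  "length ks = length vs \<Longrightarrow> k \<in> set ks \<Longrightarrow>
    \<exists>j<length ks. ks ! j = k \<and> map_of (zip ks vs) k = Some (vs ! j)"
  by (induction ks vs rule: list_induct2) (auto 0 3 intro: exI[of _ 0] exI[of _ "Suc _"])

lemma map_of_zip_None: "k \<notin> set ks \<Longrightarrow> map_of (zip ks vs) k = None"
  by (auto simp: map_of_eq_None_iff dest: set_zip_leftD)

lemma map_of_zip_map_option: "map_of (zip ks (map f vs)) k = map_option f (map_of (zip ks vs) k)"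
proof (induction ks arbitrary: vs)
  case (Cons a ks)
  then show ?case by (cases vs) auto
qed simp

text \<open>Only on the keys: at any other variable the left side is that variable, while the right
  side is its image under \<theta>.\<close>

lemma subst_of_zip_csub:
  assumes "length ks = length vs" "(\<sigma>, i) \<in> set ks"
  shows "subst_of (zip ks (map (subst_tm \<theta>) vs)) \<sigma> i = csub \<theta> (subst_of (zip ks vs)) \<sigma> i"
  using map_of_zip_Some[OF assms] by (auto simp: subst_of_def csub_def map_of_zip_map_option)

lemma comp_args_sorted:
  assumes "has_sort (Comp xs ys A bs) (Kappa (length cs))" "\<forall>a \<in> set cs. has_sort a Iota"
  shows "length (keys xs ys) = length (cs @ bs)"
    and "\<And>j. j < length (keys xs ys) \<Longrightarrow> has_sort ((cs @ bs) ! j) (fst (keys xs ys ! j))"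
proof -
  have l: "length xs = length cs" and b: "list_all2 has_sort bs (map fst ys)"
    using assms by (auto simp: has_sort_Comp)
  then show "length (keys xs ys) = length (cs @ bs)" by (auto dest: list_all2_lengthD)
  show "has_sort ((cs @ bs) ! j) (fst (keys xs ys ! j))" if "j < length (keys xs ys)" for j
  proof (cases "j < length cs")
    case True
    then show ?thesis using l assms(2) by (simp add: nth_append)
  next
    case False
    then show ?thesis using l b that
      by (auto simp: nth_append list_all2_conv_all_nth)
  qed
qed

lemma wsub_subst_of_comp:
  assumes "has_sort (Comp xs ys A bs) (Kappa (length cs))" "\<forall>a \<in> set cs. has_sort a Iota"
  shows "wsub (subst_of (zip (keys xs ys) (cs @ bs)))"
  unfolding wsub_def
proof (intro allI)
  fix \<sigma> i
  show "has_sort (subst_of (zip (keys xs ys) (cs @ bs)) \<sigma> i) \<sigma>"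
  proof (cases "(\<sigma>, i) \<in> set (keys xs ys)")
    case True
    then obtain j where j: "j < length (keys xs ys)" "keys xs ys ! j = (\<sigma>, i)"
      and m: "map_of (zip (keys xs ys) (cs @ bs)) (\<sigma>, i) = Some ((cs @ bs) ! j)"
      using map_of_zip_Some[OF comp_args_sorted(1)[OF assms]] by blast
    then show ?thesis using comp_args_sorted(2)[OF assms j(1)] by (simp add: subst_of_def)
  next
    case False
    then show ?thesis unfolding subst_of_def map_of_zip_None[OF False] by simp
  qed
qed

section \<open>The congruence\<close>

abbreviation tm_eq :: "tm \<Rightarrow> tm \<Rightarrow> bool" where
  "tm_eq \<equiv> equivclp tm_red"

lemma equivclp_map:
  assumes "\<And>x y. r x y \<Longrightarrow> equivclp s (f x) (f y)"
  shows "equivclp r a b \<Longrightarrow> equivclp s (f a) (f b)"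
proof (induction rule: equivclp_induct)
  case (step y z)
  then show ?case using assms equivclp_trans equivclp_sym by metis
qed simp

lemma equivclp_invariant:
  assumes "\<And>x y. r x y \<Longrightarrow> f x = f y"
  shows "equivclp r a b \<Longrightarrow> f a = f b"
  by (induction rule: equivclp_induct) (auto dest: assms)

lemma tm_red_subst: "tm_red a b \<Longrightarrow> wsub \<theta> \<Longrightarrow> tm_red (subst_tm \<theta> a) (subst_tm \<theta> b)"
  by (induction rule: tm_red.induct) (auto intro: tm_red.intros has_sort_subst)

lemma tm_eq_subst: "tm_eq a b \<Longrightarrow> wsub \<theta> \<Longrightarrow> tm_eq (subst_tm \<theta> a) (subst_tm \<theta> b)"
  by (rule equivclp_map[of tm_red]) (auto intro: tm_red_subst)

lemma ty_red_subst: "ty_red A B \<Longrightarrow> wsub \<theta> \<Longrightarrow> ty_red (subst_ty \<theta> A) (subst_ty \<theta> B)"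
proof (induction arbitrary: \<theta> rule: ty_red.induct)
  case (red_Comp xs ys A bs cs)
  note hs = red_Comp(1,2)
  \<comment> \<open>All free variables of the index \<open>A\<close> are keys, so substituting after
    the unfolding amounts to substituting in the arguments.\<close>
  have "subst_ty \<theta> (subst_ty (subst_of (zip (keys xs ys) (cs @ bs))) A) =
      subst_ty (subst_of (zip (keys xs ys) (map (subst_tm \<theta>) (cs @ bs)))) A"
    unfolding subst_subst_ty
  proof (rule subst_ty_cong_fv)
    fix \<sigma> i assume "(\<sigma>, i) \<in> fv_ty A"
    then have "(\<sigma>, i) \<in> set (keys xs ys)" using hs(1) by (auto simp: has_sort_Comp)
    then show "csub \<theta> (subst_of (zip (keys xs ys) (cs @ bs))) \<sigma> i =
        subst_of (zip (keys xs ys) (map (subst_tm \<theta>) (cs @ bs))) \<sigma> i"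
      using subst_of_zip_csub comp_args_sorted(1)[OF hs] by metis
  qed
  moreover have "has_sort (Comp xs ys A (map (subst_tm \<theta>) bs)) (Kappa (length (map (subst_tm \<theta>) cs)))"
    using has_sort_subst[OF red_Comp.prems hs(1)] by simp
  ultimately show ?case
    using ty_red.red_Comp[of xs ys A "map (subst_tm \<theta>) bs" "map (subst_tm \<theta>) cs"] hs(2)
      has_sort_subst[OF red_Comp.prems] by simp
next
  case (red_Eq a b)
  then show ?case
    using ty_red.red_Eq[of "subst_tm \<theta> a" "subst_tm \<theta> b"] by (simp add: has_sort_subst up_eq)
next
  case (red_N a)
  then show ?case
    using ty_red.red_N[of "subst_tm \<theta> a"] by (simp add: has_sort_subst up_eq par_zero_def par_succ_def)
next
  case (in_Eps1 a a' cs bs c)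
  then show ?case using ty_red.in_Eps1[OF tm_red_subst] by simp
qed (auto intro: ty_red.intros has_sort_subst tm_red_subst simp: up_eq wsub_up[unfolded up_eq])

lemma ty_cong_refl [simp]: "ty_cong A A"
  by (simp add: ty_cong_def)

lemma ty_cong_sym: "ty_cong A B \<Longrightarrow> ty_cong B A"
  unfolding ty_cong_def by (rule equivclp_sym)

lemma ty_cong_trans [trans]: "ty_cong A B \<Longrightarrow> ty_cong B C \<Longrightarrow> ty_cong A C"
  unfolding ty_cong_def by (rule equivclp_trans)

lemma ty_red_cong: "ty_red A B \<Longrightarrow> ty_cong A B"
  unfolding ty_cong_def by blast

lemma ty_cong_subst: "ty_cong A B \<Longrightarrow> wsub \<theta> \<Longrightarrow> ty_cong (subst_ty \<theta> A) (subst_ty \<theta> B)"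
  unfolding ty_cong_def by (rule equivclp_map[of ty_red]) (auto intro: ty_red_subst)

lemma ty_cong_Imp: "ty_cong A A' \<Longrightarrow> ty_cong B B' \<Longrightarrow> ty_cong (Imp A B) (Imp A' B')"
proof -
  assume a: "ty_cong A A'" and b: "ty_cong B B'"
  have "ty_cong (Imp A B) (Imp A' B)"
    using a unfolding ty_cong_def
    by (rule equivclp_map[of ty_red _ "\<lambda>A. Imp A B", rotated]) (auto intro: ty_red.intros)
  also have "ty_cong (Imp A' B) (Imp A' B')"
    using b unfolding ty_cong_def
    by (rule equivclp_map[of ty_red _ "\<lambda>B. Imp A' B", rotated]) (auto intro: ty_red.intros)
  finally show ?thesis .
qed

lemma ty_cong_Forall: "ty_cong A A' \<Longrightarrow> ty_cong (Forall \<sigma> A) (Forall \<sigma> A')"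
  unfolding ty_cong_def by (rule equivclp_map[of ty_red]) (auto intro: ty_red.intros)

lemma tm_eq_Succ: "tm_eq a b \<Longrightarrow> tm_eq (Succ a) (Succ b)"
  by (rule equivclp_map[of tm_red]) (auto intro: tm_red.intros)

lemma tm_eq_Pred: "tm_eq a b \<Longrightarrow> tm_eq (Pred a) (Pred b)"
  by (rule equivclp_map[of tm_red]) (auto intro: tm_red.intros)

lemma ty_cong_N: "tm_eq a b \<Longrightarrow> ty_cong (N a) (N b)"
  unfolding ty_cong_def by (rule equivclp_map[of tm_red]) (auto intro: ty_red.intros)

lemma ty_cong_Null: "tm_eq a b \<Longrightarrow> ty_cong (Null a) (Null b)"
  unfolding ty_cong_def by (rule equivclp_map[of tm_red]) (auto intro: ty_red.intros)

lemma ty_cong_Eq: "tm_eq a a' \<Longrightarrow> tm_eq b b' \<Longrightarrow> ty_cong (Eq a b) (Eq a' b')"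
proof -
  assume a: "tm_eq a a'" and b: "tm_eq b b'"
  have "ty_cong (Eq a b) (Eq a' b)"
    using a unfolding ty_cong_def
    by (rule equivclp_map[of tm_red _ "\<lambda>a. Eq a b", rotated]) (auto intro: ty_red.intros)
  also have "ty_cong (Eq a' b) (Eq a' b')"
    using b unfolding ty_cong_def
    by (rule equivclp_map[of tm_red _ "\<lambda>b. Eq a' b", rotated]) (auto intro: ty_red.intros)
  finally show ?thesis .
qed

lemma equivclp_list:
  assumes "\<And>bs b b' cs. r b b' \<Longrightarrow> s (f (bs @ b # cs)) (f (bs @ b' # cs))"
    and "list_all2 (equivclp r) bs bs'"
  shows "equivclp s (f bs) (f bs')"
proof -
  \<comment> \<open>The entries are exchanged one at a time; \<open>ds\<close> collects those
    already exchanged.\<close>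
  have "equivclp s (f (ds @ bs)) (f (ds @ bs'))" for ds
    using assms(2)
  proof (induction arbitrary: ds rule: list_all2_induct)
    case (Cons b bs b' bs')
    have "equivclp s (f (ds @ b # bs)) (f (ds @ b' # bs))"
      by (rule equivclp_map[of r, OF _ Cons.hyps(1)]) (auto intro: assms(1))
    also have "equivclp s \<dots> (f (ds @ b' # bs'))"
      using Cons.IH[of "ds @ [b']"] by simp
    finally show ?case .
  qed simp
  from this[of "[]"] show ?thesis by simp
qed

lemma tm_eq_Comp: "list_all2 tm_eq bs bs' \<Longrightarrow> tm_eq (Comp xs ys A bs) (Comp xs ys A bs')"
  by (rule equivclp_list) (auto intro: tm_red.intros)

lemma ty_cong_Eps: "list_all2 tm_eq cs cs' \<Longrightarrow> tm_eq c c' \<Longrightarrow> ty_cong (Eps cs c) (Eps cs' c')"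
proof -
  assume a: "list_all2 tm_eq cs cs'" and b: "tm_eq c c'"
  have "ty_cong (Eps cs c) (Eps cs' c)"
    unfolding ty_cong_def
    by (rule equivclp_list[of tm_red _ "\<lambda>cs. Eps cs c", OF _ a]) (auto intro: ty_red.intros)
  also have "ty_cong (Eps cs' c) (Eps cs' c')"
    using b unfolding ty_cong_def
    by (rule equivclp_map[of tm_red _ "\<lambda>c. Eps cs' c", rotated]) (auto intro: ty_red.intros)
  finally show ?thesis .
qed

lemma tm_eq_subst_cong:
  "(\<And>\<sigma> i. (\<sigma>, i) \<in> fv_tm a \<Longrightarrow> tm_eq (\<theta> \<sigma> i) (\<eta> \<sigma> i)) \<Longrightarrow> tm_eq (subst_tm \<theta> a) (subst_tm \<eta> a)"
proof (induction a)
  case (Comp xs ys A bs)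
  have "tm_eq (subst_tm \<theta> b) (subst_tm \<eta> b)" if "b \<in> set bs" for b
    using that by (auto intro!: Comp)
  then show ?case
    by (auto intro!: tm_eq_Comp simp: list_all2_conv_all_nth)
qed (auto intro: tm_eq_Succ tm_eq_Pred)

lemma ty_cong_subst_cong:
  "(\<And>\<sigma> i. (\<sigma>, i) \<in> fv_ty A \<Longrightarrow> tm_eq (\<theta> \<sigma> i) (\<eta> \<sigma> i)) \<Longrightarrow> ty_cong (subst_ty \<theta> A) (subst_ty \<eta> A)"
proof (induction A arbitrary: \<theta> \<eta>)
  case (Forall \<sigma> A)
  have "tm_eq (up \<sigma> \<theta> \<tau> i) (up \<sigma> \<eta> \<tau> i)" if "(\<tau>, i) \<in> fv_ty A" for \<tau> i
    using that Forall.prems[of \<tau> "if \<tau> = \<sigma> then i - 1 else i"]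
    by (auto simp: up_def intro!: tm_eq_subst split: nat.splits)
  then show ?case using Forall.IH by (auto intro: ty_cong_Forall)
next
  case (Eps cs c)
  have "tm_eq (subst_tm \<theta> a) (subst_tm \<eta> a)" if "a \<in> insert c (set cs)" for a
    using that by (auto intro!: tm_eq_subst_cong Eps)
  then show ?case
    by (auto intro!: ty_cong_Eps simp: list_all2_conv_all_nth)
qed (auto intro!: ty_cong_Imp ty_cong_N ty_cong_Null ty_cong_Eq tm_eq_subst_cong)

text \<open>An equivalence rather than preservation, because the congruence also uses the rules
  backwards. For \<open>Pred_Succ\<close> the sort condition of the rule provides it: it excludes a
  term \<open>a\<close> of another sort, for which \<open>Pred (Succ a)\<close> has no sort.\<close>

lemma tm_red_sort: "tm_red a b \<Longrightarrow> has_sort a \<sigma> \<longleftrightarrow> has_sort b \<sigma>"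
proof (induction arbitrary: \<sigma> rule: tm_red.induct)
  case (Pred_Succ a)
  then show ?case by (auto dest: has_sort_unique)
next
  case (in_Comp b b' xs ys A bs cs)
  have "list_all2 has_sort (bs @ b # cs) zs \<longleftrightarrow> list_all2 has_sort (bs @ b' # cs) zs" for zs
    by (simp add: list_all2_append1 list_all2_Cons1 in_Comp.IH)
  then show ?case by (simp add: has_sort_Comp)
qed auto

lemma ty_red_wf: "ty_red A B \<Longrightarrow> wf_ty A \<longleftrightarrow> wf_ty B"
proof (induction rule: ty_red.induct)
  case (red_Comp xs ys A bs cs)
  moreover have "wf_ty (subst_ty (subst_of (zip (keys xs ys) (cs @ bs))) A)"
    using red_Comp wf_ty_subst[OF wsub_subst_of_comp[OF red_Comp]] by (auto simp: has_sort_Comp)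
  ultimately show ?case by simp
qed (auto simp: par_zero_def par_succ_def has_sort_subst tm_red_sort)

lemma ty_cong_wf: "ty_cong A B \<Longrightarrow> wf_ty A \<longleftrightarrow> wf_ty B"
  unfolding ty_cong_def by (rule equivclp_invariant[of ty_red]) (auto simp: ty_red_wf)

section \<open>Typing\<close>

lemma typed_wf: "typed \<Gamma> t A \<Longrightarrow> wf_ty A"
  by (induction rule: typed.induct) (auto simp: ty_cong_wf wf_ty_subst)

lemma typed_weaken: "typed \<Gamma> t A \<Longrightarrow> \<Gamma> |\<subseteq>| \<Delta> \<Longrightarrow> typed \<Delta> t A"
proof (induction arbitrary: \<Delta> rule: typed.induct)
  case (ty_Lam A \<Gamma> t B)
  then show ?case by (auto intro!: typed.ty_Lam ty_Lam.IH)
next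
  case (ty_TLam \<sigma> \<Gamma> t A)
  then show ?case by (auto intro!: typed.ty_TLam ty_TLam.IH)
qed (auto intro: typed.intros)

lemma typed_subst:
  "typed \<Gamma> t A \<Longrightarrow> wsub \<theta> \<Longrightarrow> typed (subst_ty \<theta> |`| \<Gamma>) (subst_sch \<theta> t) (subst_ty \<theta> A)"
proof (induction arbitrary: \<theta> rule: typed.induct)
  case (ty_TLam \<sigma> \<Gamma> t A)
  from ty_TLam.IH[of "up \<sigma> \<theta>"] ty_TLam.prems show ?case
    by (auto intro!: typed.ty_TLam simp: fset.map_comp comp_def)
next
  case (ty_TApp \<Gamma> t \<sigma> A a)
  from typed.ty_TApp[OF ty_TApp.IH[OF ty_TApp.prems, simplified] has_sort_subst[OF ty_TApp.prems ty_TApp.hyps(2)]]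
  show ?case by simp
next
  case (ty_conv \<Gamma> t A B)
  then show ?case by (auto intro: typed.ty_conv ty_cong_subst)
next
  case (ty_V A \<Gamma>)
  then show ?case by (auto intro!: typed.ty_V wf_ty_subst)
next
  case (ty_Lam A \<Gamma> t B)
  then show ?case by (auto intro!: typed.ty_Lam wf_ty_subst)
next
  case (ty_App \<Gamma> t A B u)
  then show ?case by (auto intro: typed.ty_App)
qed

section \<open>Unfolding comprehension symbols\<close>

definition renaming :: "sub \<Rightarrow> bool" where
  "renaming \<eta> \<longleftrightarrow> (\<forall>\<sigma> i. \<exists>j. \<eta> \<sigma> i = Var \<sigma> j)"

definition has_comp_free :: "ty \<Rightarrow> bool" where
  "has_comp_free A \<longleftrightarrow> (\<exists>D. comp_free D \<and> ty_cong A D)"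

text \<open>The quantification over renamings makes the property stable under lifting.\<close>

definition unfoldable :: "tm \<Rightarrow> bool" where
  "unfoldable b \<longleftrightarrow> (\<forall>\<eta> cs. renaming \<eta> \<longrightarrow> has_sort b (Kappa (length cs)) \<longrightarrow>
    (\<forall>a \<in> set cs. has_sort a Iota) \<longrightarrow> has_comp_free (Eps cs (subst_tm \<eta> b)))"

lemma renaming_Var: "renaming Var"
  by (simp add: renaming_def)

lemma renaming_wsub: "renaming \<eta> \<Longrightarrow> wsub \<eta>"
  by (simp add: renaming_def wsub_def) (metis has_sort_simps(1))

lemma renaming_shift: "renaming (shift \<sigma>)"
  by (simp add: renaming_def shift_def)

lemma renaming_csub: "renaming \<eta> \<Longrightarrow> renaming \<zeta> \<Longrightarrow> renaming (csub \<eta> \<zeta>)"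
  by (simp add: renaming_def csub_def) (metis subst_tm.simps(1))

text \<open>Comprehension symbols have values in the sorts \<open>Kappa n\<close>, and the other
  function symbols take only arguments of sort \<open>Iota\<close>; so no comprehension symbol
  occurs in a number term.\<close>

lemma Iota_comp_free: "has_sort a Iota \<Longrightarrow> comp_free_tm a"
  by (induction a) (auto simp: has_sort_Comp)

text \<open>Vacuous: by uniqueness of sorts, a number term is never the code of a well-formed
  atom.\<close>

lemma unfoldable_Iota: "has_sort a Iota \<Longrightarrow> unfoldable a"
  by (auto simp: unfoldable_def dest: has_sort_unique)

lemma unfoldable_Var: "unfoldable (Var \<sigma> i)"
  unfolding unfoldable_def
proof (intro allI impI)
  fix \<eta> cs
  assume \<eta>: "renaming \<eta>" and cs: "\<forall>a \<in> set cs. has_sort a Iota"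
  then obtain j where "\<eta> \<sigma> i = Var \<sigma> j" unfolding renaming_def by blast
  then have "comp_free (Eps cs (subst_tm \<eta> (Var \<sigma> i)))"
    using cs by (auto simp: Iota_comp_free)
  then show "has_comp_free (Eps cs (subst_tm \<eta> (Var \<sigma> i)))"
    unfolding has_comp_free_def using ty_cong_refl by blast
qed

lemma has_sort_renaming_iff: "renaming \<eta> \<Longrightarrow> has_sort (subst_tm \<eta> a) \<sigma> \<longleftrightarrow> has_sort a \<sigma>"
proof (induction a arbitrary: \<sigma>)
  case (Var \<tau> i)
  then obtain j where "\<eta> \<tau> i = Var \<tau> j" unfolding renaming_def by blast
  then show ?case by simp
next
  case (Comp xs ys A bs)
  then show ?case by (auto simp: has_sort_Comp list_all2_conv_all_nth)
qed auto

lemma unfoldable_renaming: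
  assumes "unfoldable b" "renaming \<eta>"
  shows "unfoldable (subst_tm \<eta> b)"
  using assms renaming_csub unfolding unfoldable_def
  by (simp add: has_sort_renaming_iff)

lemma has_comp_freeI: "comp_free A \<Longrightarrow> has_comp_free A"
  unfolding has_comp_free_def by (blast intro: ty_cong_refl)

lemma has_comp_free_Forall: "has_comp_free A \<Longrightarrow> has_comp_free (Forall \<sigma> A)"
  unfolding has_comp_free_def by (metis comp_free.simps(6) ty_cong_Forall)

lemma has_comp_free_Imp: "has_comp_free A \<Longrightarrow> has_comp_free B \<Longrightarrow> has_comp_free (Imp A B)"
  unfolding has_comp_free_def by (metis comp_free.simps(5) ty_cong_Imp)

text \<open>In a well-sorted type without comprehension symbols, the code in an atom
  \<open>Eps cs c\<close> can only be a variable. So the substitution introduces comprehension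
  symbols only at codes that can be unfolded by assumption.\<close>

lemma has_comp_free_subst:
  "comp_free A \<Longrightarrow> wf_ty A \<Longrightarrow> wsub \<theta> \<Longrightarrow> (\<And>\<sigma> i. unfoldable (\<theta> \<sigma> i)) \<Longrightarrow>
    has_comp_free (subst_ty \<theta> A)"
proof (induction A arbitrary: \<theta>)
  case (Eps cs c)
  then have "has_sort c (Kappa (length cs))" "comp_free_tm c" by auto
  then obtain i where c: "c = Var (Kappa (length cs)) i" by (cases c) auto
  have "has_comp_free (Eps (map (subst_tm \<theta>) cs) (subst_tm Var (\<theta> (Kappa (length cs)) i)))"
    using Eps.prems(2,3) by (intro Eps.prems(4)[unfolded unfoldable_def, rule_format] renaming_Var)
      (auto simp: has_sort_subst wsubD)
  then show ?case by (simp add: c)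
next
  case (Forall \<sigma> A)
  have "unfoldable (up \<sigma> \<theta> \<tau> i)" for \<tau> i
    using Forall.prems(4) unfoldable_renaming[OF _ renaming_shift]
    by (auto simp: up_def unfoldable_Var split: nat.split)
  then have "has_comp_free (subst_ty (up \<sigma> \<theta>) A)"
    using Forall by (intro Forall.IH) auto
  then show ?case by (simp add: has_comp_free_Forall)
next
  case (Imp A B)
  then have "has_comp_free (subst_ty \<theta> A)" "has_comp_free (subst_ty \<theta> B)" by auto
  then show ?case by (simp add: has_comp_free_Imp)
qed (auto simp: has_sort_subst Iota_comp_free intro!: has_comp_freeI)

text \<open>Unfolding \<open>Eps cs (Comp xs ys A bs)\<close> gives an instance of \<open>A\<close>,
  which has no comprehension symbol. Those of the instance come from the arguments
  \<open>bs\<close>, smaller terms that can be unfolded by induction; hence repeated unfolding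
  ends.\<close>

lemma unfoldable_sorted: "has_sort b \<sigma> \<Longrightarrow> unfoldable b"
proof (induction b arbitrary: \<sigma>)
  case (Comp xs ys A bs)
  show ?case unfolding unfoldable_def
  proof (intro allI impI)
    fix \<eta> cs
    assume \<eta>: "renaming \<eta>" and s: "has_sort (Comp xs ys A bs) (Kappa (length cs))"
      and cs: "\<forall>a \<in> set cs. has_sort a Iota"
    let ?bs = "map (subst_tm \<eta>) bs"
    let ?\<theta> = "subst_of (zip (keys xs ys) (cs @ ?bs))"
    have s': "has_sort (Comp xs ys A ?bs) (Kappa (length cs))"
      using has_sort_subst[OF renaming_wsub[OF \<eta>] s] by simp
    have "unfoldable b" if "b \<in> set bs" for b
      using that s Comp.IH by (fastforce simp: has_sort_Comp list_all2_conv_all_nth in_set_conv_nth)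
    then have u: "\<forall>b \<in> set (cs @ ?bs). unfoldable b"
      using \<eta> cs by (auto intro: unfoldable_renaming unfoldable_Iota)
    have "unfoldable (?\<theta> \<tau> i)" for \<tau> i
      using u by (auto simp: subst_of_def unfoldable_Var split: option.split
          dest!: map_of_SomeD set_zip_rightD)
    then have "has_comp_free (subst_ty ?\<theta> A)"
      using s by (intro has_comp_free_subst wsub_subst_of_comp[OF s' cs]) (auto simp: has_sort_Comp)
    moreover have "ty_cong (Eps cs (Comp xs ys A ?bs)) (subst_ty ?\<theta> A)"
      by (rule ty_red_cong[OF red_Comp[OF s' cs]])
    ultimately show "has_comp_free (Eps cs (subst_tm \<eta> (Comp xs ys A bs)))"
      unfolding has_comp_free_def by (auto intro: ty_cong_trans)
  qed
qed (auto intro: unfoldable_Var unfoldable_Iota)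

lemma wf_has_comp_free: "wf_ty A \<Longrightarrow> has_comp_free A"
  using has_comp_free_subst
proof (induction A)
  case (Eps cs c)
  then have "has_comp_free (Eps cs (subst_tm Var c))"
    by (intro unfoldable_sorted[unfolded unfoldable_def, rule_format] renaming_Var) auto
  then show ?case by simp
next
  case (Forall \<sigma> A)
  then have "has_comp_free A" by auto
  then show ?case by (simp add: has_comp_free_Forall)
next
  case (Imp A B)
  then have "has_comp_free A" "has_comp_free B" by auto
  then show ?case by (simp add: has_comp_free_Imp)
qed (auto simp: Iota_comp_free intro!: has_comp_freeI)

lemma subst_of_zip_Var: "subst_of (zip ys (map (case_prod Var) ys)) = Var"
proof (intro ext)
  fix \<sigma> i
  have "map_of (zip ys (map (case_prod Var) ys)) (\<sigma>, i) \<in> {None, Some (Var \<sigma> i)}"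
    by (induction ys) auto
  then show "subst_of (zip ys (map (case_prod Var) ys)) \<sigma> i = Var \<sigma> i"
    by (auto simp only: subst_of_def insert_iff empty_iff option.case)
qed

text \<open>Every type has a code. Only a type without comprehension symbols can be the index of a
  symbol, so the unfolded form \<open>D\<close> is taken, with its free variables both as parameters
  and as arguments.\<close>

lemma ex_eps_cong:
  assumes "wf_ty A"
  shows "\<exists>b. has_sort b (Kappa 0) \<and> ty_cong (Eps [] b) A"
proof -
  obtain D where D: "comp_free D" "ty_cong A D"
    using wf_has_comp_free[OF assms] unfolding has_comp_free_def by blast
  obtain ys where ys: "set ys = fv_ty D" "distinct ys"
    using finite_distinct_list[OF finite_fv_ty] by blast
  let ?b = "Comp [] ys D (map (case_prod Var) ys)"
  have s: "has_sort ?b (Kappa 0)"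
    using D ys assms ty_cong_wf[OF D(2)]
    by (auto simp: has_sort_Comp list_all2_conv_all_nth split: prod.split)
  have "ty_red (Eps [] ?b) D"
    using red_Comp[of "[]" ys D "map (case_prod Var) ys" "[]"] s by (simp add: subst_of_zip_Var)
  then show ?thesis using s ty_red_cong ty_cong_sym ty_cong_trans D(2) by blast
qed

section \<open>Tagged types\<close>

text \<open>The name of the first parameter of the comprehension symbol. It belongs to the index of
  the symbol, where substitution does not reach, and it can be any number.\<close>

fun tag :: "ty \<Rightarrow> nat option" where
  "tag (Eps cs (Comp xs (k # ys) A bs)) = Some (snd k)"
| "tag _ = None"

text \<open>The converse fails: an atom \<open>Eps cs (Var \<sigma> i)\<close> has no tag but may
  acquire one by substitution. Lifting maps variables to variables and therefore also preserves the
  absence of a tag.\<close>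

lemma tag_subst: "tag T = Some i \<Longrightarrow> tag (subst_ty \<theta> T) = Some i"
  by (induction T rule: tag.induct) auto

lemma tag_lift [simp]: "tag (lift_ty \<sigma> T) = tag T"
  by (induction T rule: tag.induct) (auto simp: shift_def)

lemma ex_tagged:
  assumes "wf_ty A"
  shows "\<exists>T. tag T = Some i \<and> ty_cong T A"
proof -
  obtain b where b: "has_sort b (Kappa 0)" "ty_cong (Eps [] b) A"
    using ex_eps_cong[OF assms] by blast
  \<comment> \<open>An identity symbol, unfolding to the atom of its argument \<open>b\<close>; its
    parameter is named \<open>i\<close> in order to carry the tag.\<close>
  let ?T = "Eps [] (Comp [] [(Kappa 0, i)] (Eps [] (Var (Kappa 0) i)) [b])"
  have "ty_red ?T (subst_ty (subst_of (zip (keys [] [(Kappa 0, i)]) ([] @ [b]))) (Eps [] (Var (Kappa 0) i)))"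
    using b by (intro red_Comp) (auto simp: has_sort_Comp)
  then have "ty_red ?T (Eps [] b)" by (simp add: subst_of_def)
  then have "ty_cong ?T A" using b(2) ty_red_cong ty_cong_trans by blast
  then show ?thesis by (intro exI[of _ ?T]) simp
qed

text \<open>\<Delta> holds the types of all scheme variables in scope; in particular a scheme
  well-tagged in the empty context has no free scheme variables.\<close>

primrec well_tagged :: "ty fset \<Rightarrow> sch \<Rightarrow> bool" where
  "well_tagged \<Delta> (V S) \<longleftrightarrow> S |\<in>| \<Delta>"
| "well_tagged \<Delta> (Lam T t) \<longleftrightarrow>
    tag T \<noteq> None \<and> (\<forall>S. S |\<in>| \<Delta> \<longrightarrow> tag S \<noteq> tag T) \<and> well_tagged (finsert T \<Delta>) t"
| "well_tagged \<Delta> (App t u) \<longleftrightarrow> well_tagged \<Delta> t \<and> well_tagged \<Delta> u"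
| "well_tagged \<Delta> (TLam \<sigma> t) \<longleftrightarrow> well_tagged (lift_ty \<sigma> |`| \<Delta>) t"
| "well_tagged \<Delta> (TApp t a) \<longleftrightarrow> well_tagged \<Delta> t"

text \<open>Each abstraction is moved to a congruent type with a new tag. The conversion rule
  restores the original type after each abstraction, so that the type of the whole remains
  \<open>A\<close> itself.\<close>

lemma typed_well_tagged:
  "typed \<Gamma> t A \<Longrightarrow> (\<And>B. B |\<in>| \<Gamma> \<Longrightarrow> \<exists>T. T |\<in>| \<Delta> \<and> ty_cong T B) \<Longrightarrow>
    \<exists>t'. typed \<Delta> t' A \<and> well_tagged \<Delta> t'"
proof (induction arbitrary: \<Delta> rule: typed.induct)
  case (ty_V A \<Gamma>)
  then obtain T where "T |\<in>| \<Delta>" "ty_cong T A" by blast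
  moreover from this ty_V have "wf_ty T" by (simp add: ty_cong_wf)
  ultimately show ?case by (intro exI[of _ "V T"]) (auto intro: typed.intros)
next
  case (ty_Lam A \<Gamma> t B)
  \<comment> \<open>Finitely many types are in scope, so some tag is still free.\<close>
  have "finite {i. \<exists>S. S |\<in>| \<Delta> \<and> tag S = Some i}"
    by (rule finite_subset[of _ "(the \<circ> tag) ` fset \<Delta>"]) force+
  then obtain i where i: "\<And>S. S |\<in>| \<Delta> \<Longrightarrow> tag S \<noteq> Some i"
    using ex_new_if_finite[OF infinite_UNIV_nat] by blast
  obtain T where T: "tag T = Some i" "ty_cong T A" using ex_tagged[OF ty_Lam.hyps(1)] by blast
  have "\<exists>T'. T' |\<in>| finsert T \<Delta> \<and> ty_cong T' C" if "C |\<in>| finsert A \<Gamma>" for C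
    using that T(2) ty_Lam.prems by auto
  then obtain t' where t': "typed (finsert T \<Delta>) t' B" "well_tagged (finsert T \<Delta>) t'"
    using ty_Lam.IH by blast
  have "wf_ty T" using T(2) ty_Lam.hyps(1) by (simp add: ty_cong_wf)
  then have "typed \<Delta> (Lam T t') (Imp A B)"
    using t'(1) T(2) by (meson ty_conv typed.ty_Lam ty_cong_Imp ty_cong_refl)
  then show ?case using t'(2) T(1) i by (intro exI[of _ "Lam T t'"]) auto
next
  case (ty_App \<Gamma> t A B u)
  then obtain t' u' where "typed \<Delta> t' (Imp A B)" "well_tagged \<Delta> t'" "typed \<Delta> u' A" "well_tagged \<Delta> u'"
    by meson
  then show ?case by (intro exI[of _ "App t' u'"]) (auto intro: typed.intros)
next
  case (ty_TLam \<sigma> \<Gamma> t A)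
  have "\<exists>T. T |\<in>| lift_ty \<sigma> |`| \<Delta> \<and> ty_cong T C" if "C |\<in>| lift_ty \<sigma> |`| \<Gamma>" for C
  proof -
    obtain B where B: "B |\<in>| \<Gamma>" "C = lift_ty \<sigma> B" using \<open>C |\<in>| lift_ty \<sigma> |`| \<Gamma>\<close> by auto
    then obtain T where "T |\<in>| \<Delta>" "ty_cong T B" using ty_TLam.prems by blast
    then show ?thesis using B by (intro exI[of _ "lift_ty \<sigma> T"]) (auto intro: ty_cong_subst)
  qed
  then obtain t' where "typed (lift_ty \<sigma> |`| \<Delta>) t' A" "well_tagged (lift_ty \<sigma> |`| \<Delta>) t'"
    using ty_TLam.IH by blast
  then show ?case by (intro exI[of _ "TLam \<sigma> t'"]) (auto intro: typed.intros)
next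
  case (ty_TApp \<Gamma> t \<sigma> A a)
  then obtain t' where "typed \<Delta> t' (Forall \<sigma> A)" "well_tagged \<Delta> t'" by meson
  then show ?case using ty_TApp.hyps by (intro exI[of _ "TApp t' a"]) (auto intro: typed.intros)
next
  case (ty_conv \<Gamma> t A B)
  then show ?case by (meson typed.ty_conv)
qed

lemma well_tagged_subst:
  "well_tagged \<Delta> t \<Longrightarrow> (\<And>S. S |\<in>| \<Delta> \<Longrightarrow> tag S \<noteq> None) \<Longrightarrow>
    well_tagged (subst_ty \<theta> |`| \<Delta>) (subst_sch \<theta> t)"
proof (induction t arbitrary: \<Delta> \<theta>)
  case (Lam T t)
  then obtain i where i: "tag T = Some i" by auto
  have "tag (subst_ty \<theta> S) \<noteq> tag (subst_ty \<theta> T)" if S: "S |\<in>| \<Delta>" for S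
  proof -
    obtain j where "tag S = Some j" using Lam.prems(2)[OF S] by auto
    moreover from this have "i \<noteq> j" using Lam.prems(1) S i by auto
    ultimately show ?thesis using i by (simp add: tag_subst)
  qed
  moreover have "well_tagged (subst_ty \<theta> |`| finsert T \<Delta>) (subst_sch \<theta> t)"
    using Lam.prems by (intro Lam.IH) auto
  ultimately show ?case using i by (auto simp: tag_subst)
next
  case (TLam \<sigma> t)
  have "well_tagged (subst_ty (up \<sigma> \<theta>) |`| lift_ty \<sigma> |`| \<Delta>) (subst_sch (up \<sigma> \<theta>) t)"
    using TLam.prems by (intro TLam.IH) (auto simp: tag_subst)
  then show ?case by (simp add: fset.map_comp comp_def)
qed auto

section \<open>Simultaneous minimal substitution\<close>

abbreviation lift_env :: "srt \<Rightarrow> (ty \<times> sch) list \<Rightarrow> (ty \<times> sch) list" where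
  "lift_env \<sigma> \<equiv> map (map_prod (lift_ty \<sigma>) (lift_sch \<sigma>))"

text \<open>Accumulates the minimal substitutions of successive head reductions, the most recent
  first; \<Gamma> blocks replacement as in \<open>msubst\<close>.\<close>

primrec ssubst :: "ty fset \<Rightarrow> (ty \<times> sch) list \<Rightarrow> sch \<Rightarrow> sch" where
  "ssubst \<Gamma> l (V B) =
    (if B |\<in>| \<Gamma> then V B else case map_of l B of None \<Rightarrow> V B | Some u \<Rightarrow> u)"
| "ssubst \<Gamma> l (Lam B t) = Lam B (ssubst (finsert B \<Gamma>) l t)"
| "ssubst \<Gamma> l (App t u) = App (ssubst \<Gamma> l t) (ssubst \<Gamma> l u)"
| "ssubst \<Gamma> l (TLam \<sigma> t) = TLam \<sigma> (ssubst (lift_ty \<sigma> |`| \<Gamma>) (lift_env \<sigma> l) t)"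
| "ssubst \<Gamma> l (TApp t a) = TApp (ssubst \<Gamma> l t) a"

definition typed_env :: "ty fset \<Rightarrow> (ty \<times> sch) list \<Rightarrow> bool" where
  "typed_env \<Gamma> l \<longleftrightarrow> (\<forall>(T, u) \<in> set l. typed \<Gamma> u T)"

lemma typed_env_finsert: "typed_env \<Gamma> l \<Longrightarrow> typed_env (finsert B \<Gamma>) l"
  by (auto simp: typed_env_def intro: typed_weaken)

lemma typed_env_lift: "typed_env \<Gamma> l \<Longrightarrow> typed_env (lift_ty \<sigma> |`| \<Gamma>) (lift_env \<sigma> l)"
  by (auto simp: typed_env_def intro!: typed_subst)

lemma typed_env_Cons: "typed_env \<Gamma> ((T, u) # l) \<longleftrightarrow> typed \<Gamma> u T \<and> typed_env \<Gamma> l"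
  by (auto simp: typed_env_def)

text \<open>The scheme variables free in \<open>t\<close> lie in \<Gamma>, and minimal substitution
  never replaces a variable of the current context.\<close>

lemma msubst_closed: "typed \<Gamma> t A \<Longrightarrow> \<Gamma> |\<subseteq>| \<Delta> \<Longrightarrow> msubst \<Delta> B u t = t"
proof (induction arbitrary: \<Delta> B u rule: typed.induct)
  case (ty_Lam A \<Gamma> t C)
  then show ?case by (auto intro!: ty_Lam.IH)
next
  case (ty_TLam \<sigma> \<Gamma> t A)
  then show ?case by (auto intro!: ty_TLam.IH)
qed auto

text \<open>Contracting an abstraction adds one entry to the accumulated substitution: under the
  binder the variable of type \<open>T\<close> is protected by the context, \<open>msubst\<close>
  then replaces it, and the values from \<open>l\<close>, typed in \<Gamma>, stay fixed by
  \<open>msubst_closed\<close>.\<close>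

lemma msubst_ssubst:
  "typed_env \<Gamma> l \<Longrightarrow> msubst \<Gamma> T u (ssubst (finsert T \<Gamma>) l t) = ssubst \<Gamma> ((T, u) # l) t"
proof (induction t arbitrary: \<Gamma> l T u)
  case (V S)
  show ?case
  proof (cases "map_of l S")
    case (Some w)
    then have "typed \<Gamma> w S" using V by (auto simp: typed_env_def dest: map_of_SomeD)
    then have "msubst \<Gamma> T u w = w" by (auto intro: msubst_closed)
    then show ?thesis using Some by auto
  qed auto
next
  case (Lam B t)
  then show ?case by (simp add: typed_env_finsert finsert_commute[of B T])
next
  case (TLam \<sigma> t)
  then show ?case by (simp add: typed_env_lift)
qed auto

text \<open>Capture of scheme variables by an abstraction does not disturb typing: contexts are sets
  of types, so a captured variable keeps its type, and values typed in \<Gamma> are typed in every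
  extension.\<close>

lemma typed_ssubst:
  "typed \<Delta> t A \<Longrightarrow> typed_env \<Gamma> l \<Longrightarrow> (\<And>S. S |\<in>| \<Delta> \<Longrightarrow> S |\<in>| \<Gamma> \<or> S \<in> fst ` set l) \<Longrightarrow>
    typed \<Gamma> (ssubst \<Gamma> l t) A"
proof (induction arbitrary: \<Gamma> l rule: typed.induct)
  case (ty_V A \<Delta>)
  show ?case
  proof (cases "A |\<in>| \<Gamma>")
    case False
    then have "A \<in> fst ` set l" using ty_V by blast
    then obtain u where "map_of l A = Some u" by (metis map_of_eq_None_iff not_None_eq)
    moreover from this have "typed \<Gamma> u A" using ty_V.prems(1) by (auto simp: typed_env_def dest: map_of_SomeD)
    ultimately show ?thesis using False by simp
  qed (use ty_V in \<open>auto intro: typed.ty_V\<close>)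
next
  case (ty_Lam A \<Delta> t B)
  have "typed (finsert A \<Gamma>) (ssubst (finsert A \<Gamma>) l t) B"
    using ty_Lam.prems by (intro ty_Lam.IH) (auto simp: typed_env_finsert)
  then show ?case using ty_Lam.hyps by (auto intro: typed.ty_Lam)
next
  case (ty_TLam \<sigma> \<Delta> t A)
  have "typed (lift_ty \<sigma> |`| \<Gamma>) (ssubst (lift_ty \<sigma> |`| \<Gamma>) (lift_env \<sigma> l) t) A"
  proof (rule ty_TLam.IH)
    show "typed_env (lift_ty \<sigma> |`| \<Gamma>) (lift_env \<sigma> l)" by (rule typed_env_lift[OF ty_TLam.prems(1)])
    fix S assume "S |\<in>| lift_ty \<sigma> |`| \<Delta>"
    then obtain S' where "S' |\<in>| \<Delta>" "S = lift_ty \<sigma> S'" by auto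
    then show "S |\<in>| lift_ty \<sigma> |`| \<Gamma> \<or> S \<in> fst ` set (lift_env \<sigma> l)"
      using ty_TLam.prems(2)[of S'] by (auto simp: image_image)
  qed
  then show ?case by (auto intro: typed.ty_TLam)
next
  case (ty_App \<Delta> t A B u)
  show ?case
    using ty_App.IH(1)[OF ty_App.prems] ty_App.IH(2)[OF ty_App.prems] by (auto intro: typed.ty_App)
next
  case (ty_TApp \<Delta> t \<sigma> A a)
  then show ?case by (auto intro: typed.ty_TApp)
next
  case (ty_conv \<Delta> t A B)
  then show ?case by (auto intro: typed.ty_conv)
qed

text \<open>
  Instantiating a term variable may identify two types and thus change the occurrences that a later
  substitution replaces. Tags survive instantiation, so that this does not happen here.
\<close>

lemma subst_ssubst:
  assumes "well_tagged \<Delta> t"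
    and "\<And>S. S |\<in>| \<Delta> \<Longrightarrow> tag S \<noteq> None"
    and "\<And>S T. S |\<in>| \<Delta> \<Longrightarrow> S |\<notin>| \<Gamma> \<Longrightarrow> T |\<in>| \<Gamma> \<Longrightarrow> tag (subst_ty \<theta> S) \<noteq> tag (subst_ty \<theta> T)"
    and "\<And>S T. S |\<in>| \<Delta> \<Longrightarrow> S |\<notin>| \<Gamma> \<Longrightarrow> T \<in> fst ` set l \<Longrightarrow> tag (subst_ty \<theta> S) = tag (subst_ty \<theta> T) \<Longrightarrow> S = T"
  shows "subst_sch \<theta> (ssubst \<Gamma> l t) =
    ssubst (subst_ty \<theta> |`| \<Gamma>) (map (map_prod (subst_ty \<theta>) (subst_sch \<theta>)) l) (subst_sch \<theta> t)"
  using assms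
proof (induction t arbitrary: \<Delta> \<Gamma> l \<theta>)
  case (V S)
  show ?case
  proof (cases "S |\<in>| \<Gamma>")
    case False
    have S: "S |\<in>| \<Delta>" using V.prems(1) by simp
    have "subst_ty \<theta> S |\<notin>| subst_ty \<theta> |`| \<Gamma>"
      using V.prems(3)[OF S False] by (metis fimageE)
    moreover have "map_of (map (map_prod (subst_ty \<theta>) (subst_sch \<theta>)) l) (subst_ty \<theta> S) =
        map_option (subst_sch \<theta>) (map_of l S)"
    proof -
      have "\<And>T. T \<in> fst ` set l \<Longrightarrow> subst_ty \<theta> T = subst_ty \<theta> S \<Longrightarrow> T = S"
        using V.prems(4)[OF S False] by metis
      then show ?thesis
        by (induction l) (auto, metis)
    qed
    ultimately show ?thesis using False by (simp split: option.split)
  qed auto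
next
  case (Lam T t)
  have "subst_sch \<theta> (ssubst (finsert T \<Gamma>) l t) =
      ssubst (subst_ty \<theta> |`| finsert T \<Gamma>) (map (map_prod (subst_ty \<theta>) (subst_sch \<theta>)) l) (subst_sch \<theta> t)"
  proof (rule Lam.IH[of "finsert T \<Delta>"])
    show "well_tagged (finsert T \<Delta>) t" using Lam.prems(1) by simp
    show "tag S \<noteq> None" if "S |\<in>| finsert T \<Delta>" for S using Lam.prems(1,2) that by auto
    show "tag (subst_ty \<theta> S) \<noteq> tag (subst_ty \<theta> U)"
      if "S |\<in>| finsert T \<Delta>" "S |\<notin>| finsert T \<Gamma>" "U |\<in>| finsert T \<Gamma>" for S U
    proof (cases "U = T")
      \<comment> \<open>Here \<open>U\<close> is the type of the new binder and \<open>S\<close>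
        that of an enclosing one; nested binders have distinct tags, and these survive
        substitution.\<close>
      case True
      have "S |\<in>| \<Delta>" using that by auto
      then have "tag S \<noteq> tag T" "tag S \<noteq> None" "tag T \<noteq> None" using Lam.prems(1,2) by auto
      then show ?thesis using True by (auto simp: tag_subst)
    qed (use Lam.prems(3) that in auto)
    show "S = U" if "S |\<in>| finsert T \<Delta>" "S |\<notin>| finsert T \<Gamma>" "U \<in> fst ` set l"
      "tag (subst_ty \<theta> S) = tag (subst_ty \<theta> U)" for S U
      using Lam.prems(4) that by auto
  qed
  then show ?case by simp
next
  case (TLam \<sigma> t)
  have c: "subst_ty (up \<sigma> \<theta>) |`| lift_ty \<sigma> |`| \<Gamma> = lift_ty \<sigma> |`| subst_ty \<theta> |`| \<Gamma>"
    "map (map_prod (subst_ty (up \<sigma> \<theta>)) (subst_sch (up \<sigma> \<theta>))) (lift_env \<sigma> l) =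
      lift_env \<sigma> (map (map_prod (subst_ty \<theta>) (subst_sch \<theta>)) l)"
    by (simp_all add: fset.map_comp comp_def map_prod.comp[unfolded comp_def] case_prod_beta map_prod_def)
  have "subst_sch (up \<sigma> \<theta>) (ssubst (lift_ty \<sigma> |`| \<Gamma>) (lift_env \<sigma> l) t) =
      ssubst (subst_ty (up \<sigma> \<theta>) |`| lift_ty \<sigma> |`| \<Gamma>)
        (map (map_prod (subst_ty (up \<sigma> \<theta>)) (subst_sch (up \<sigma> \<theta>))) (lift_env \<sigma> l)) (subst_sch (up \<sigma> \<theta>) t)"
  proof (rule TLam.IH[of "lift_ty \<sigma> |`| \<Delta>"])
    show "well_tagged (lift_ty \<sigma> |`| \<Delta>) t" using TLam.prems(1) by simp
    show "tag S \<noteq> None" if "S |\<in>| lift_ty \<sigma> |`| \<Delta>" for S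
      using TLam.prems(2) that by (auto simp: tag_subst)
    have t: "tag (subst_ty (up \<sigma> \<theta>) (lift_ty \<sigma> S)) = tag (subst_ty \<theta> S)" for S
      using tag_lift[of \<sigma> "subst_ty \<theta> S"] by simp
    show "tag (subst_ty (up \<sigma> \<theta>) S) \<noteq> tag (subst_ty (up \<sigma> \<theta>) U)"
      if "S |\<in>| lift_ty \<sigma> |`| \<Delta>" "S |\<notin>| lift_ty \<sigma> |`| \<Gamma>" "U |\<in>| lift_ty \<sigma> |`| \<Gamma>" for S U
    proof -
      note p = that
      obtain S' U' where "S = lift_ty \<sigma> S'" "U = lift_ty \<sigma> U'" "S' |\<in>| \<Delta>" "U' |\<in>| \<Gamma>" "S' |\<notin>| \<Gamma>"
        using p by auto
      then show ?thesis using TLam.prems(3)[of S' U'] by (simp only: t not_False_eq_True)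
    qed
    show "S = U" if "S |\<in>| lift_ty \<sigma> |`| \<Delta>" "S |\<notin>| lift_ty \<sigma> |`| \<Gamma>" "U \<in> fst ` set (lift_env \<sigma> l)"
      "tag (subst_ty (up \<sigma> \<theta>) S) = tag (subst_ty (up \<sigma> \<theta>) U)" for S U
    proof -
      note p = that
      obtain S' U' where "S = lift_ty \<sigma> S'" "U = lift_ty \<sigma> U'" "S' |\<in>| \<Delta>" "U' \<in> fst ` set l" "S' |\<notin>| \<Gamma>"
        using p by (auto simp: image_image)
      moreover from this p(4) have "tag (subst_ty \<theta> S') = tag (subst_ty \<theta> U')" by (simp only: t)
      ultimately show ?thesis using TLam.prems(4)[of S' U'] by simp
    qed
  qed
  then show ?case by (simp only: ssubst.simps subst_sch.simps c)
qed auto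

section \<open>Normal forms of terms\<close>

fun pred_tm :: "tm \<Rightarrow> tm" where
  "pred_tm Zero = Zero"
| "pred_tm (Succ a) = a"
| "pred_tm a = Pred a"

fun nf :: "tm \<Rightarrow> tm" where
  "nf (Var \<sigma> i) = Var \<sigma> i"
| "nf Zero = Zero"
| "nf (Succ a) = Succ (nf a)"
| "nf (Pred a) = pred_tm (nf a)"
| "nf (Comp xs ys A bs) = Comp xs ys A (map nf bs)"

text \<open>Invariance of \<open>nf\<close> under single steps takes the place of a confluence
  proof: it follows that congruent terms have the same \<open>nf\<close>.\<close>

lemma nf_red: "tm_red a b \<Longrightarrow> nf a = nf b"
  by (induction rule: tm_red.induct) auto

lemma nf_eq: "tm_eq a b \<Longrightarrow> nf a = nf b"
  by (rule equivclp_invariant[of tm_red]) (auto intro: nf_red)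

lemma has_sort_nf: "has_sort a Iota \<Longrightarrow> has_sort (nf a) Iota"
proof (induction a)
  case (Pred a)
  then show ?case by (cases "nf a") auto
qed (auto simp: has_sort_Comp)

lemma rtranclp_map:
  assumes "\<And>x y. r x y \<Longrightarrow> s (f x) (f y)"
  shows "r\<^sup>*\<^sup>* a b \<Longrightarrow> s\<^sup>*\<^sup>* (f a) (f b)"
  by (induction rule: rtranclp_induct) (auto intro: rtranclp.rtrancl_into_rtrancl assms)

lemma red_nf: "has_sort a Iota \<Longrightarrow> tm_red\<^sup>*\<^sup>* a (nf a)"
proof (induction a)
  case (Succ a)
  then show ?case by (auto intro!: rtranclp_map[of tm_red tm_red Succ] tm_red.intros)
next
  case (Pred a)
  then have "tm_red\<^sup>*\<^sup>* (Pred a) (Pred (nf a))"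
    by (auto intro!: rtranclp_map[of tm_red tm_red Pred] tm_red.intros)
  moreover have "tm_red\<^sup>*\<^sup>* (Pred (nf a)) (pred_tm (nf a))"
    using has_sort_nf[of a] Pred.prems
    by (cases "nf a") (auto intro: tm_red.intros)
  ultimately show ?case by simp
qed (auto simp: has_sort_Comp)

lemma tm_eq_nf: "has_sort a Iota \<Longrightarrow> tm_eq a (nf a)"
  by (rule rtranclp_into_equivclp[OF red_nf])

section \<open>Reducibility\<close>

text \<open>
  A denotation of a term is the term itself, after substitution, together with an interpretation of
  the atoms \<open>Eps as c\<close> for the term \<open>c\<close>; the second component is used for the sorts \<open>Kappa n\<close> only.
\<close>

type_synonym den = "tm \<times> (tm list \<Rightarrow> sch set)"
type_synonym env = "srt \<Rightarrow> nat \<Rightarrow> den"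

definition tms :: "env \<Rightarrow> sub" where
  "tms \<xi> \<sigma> i = fst (\<xi> \<sigma> i)"

definition iota :: "tm \<Rightarrow> den" where
  "iota a = (a, \<lambda>_. {})"

definition env_of :: "env \<Rightarrow> ((srt \<times> nat) \<times> den) list \<Rightarrow> env" where
  "env_of \<xi> ps \<sigma> i = (case map_of ps (\<sigma>, i) of None \<Rightarrow> \<xi> \<sigma> i | Some d \<Rightarrow> d)"

context fixes \<Gamma> :: "ty fset" begin

text \<open>
  Candidates contain only typed schemes, hence closure under expansion is the only further condition:
  neither subject reduction nor confluence of the congruence is needed.
\<close>

definition cand :: "ty \<Rightarrow> sch set set" where
  "cand T = {X. (\<forall>t \<in> X. typed \<Gamma> t T) \<and> (\<forall>t t'. (wred \<Gamma>)\<^sup>*\<^sup>* t t' \<longrightarrow> t' \<in> X \<longrightarrow> typed \<Gamma> t T \<longrightarrow> t \<in> X)}"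

text \<open>For \<open>Iota\<close> the second component is fixed, so that a denotation of a number
  is just a term; for \<open>Kappa n\<close> it assigns a candidate to each well-sorted argument
  list.\<close>

definition dens :: "srt \<Rightarrow> den set" where
  "dens \<sigma> = {(b, R). has_sort b \<sigma> \<and> (case \<sigma> of Iota \<Rightarrow> R = (\<lambda>_. {}) | Kappa n \<Rightarrow>
     \<forall>cs. length cs = n \<longrightarrow> (\<forall>a \<in> set cs. has_sort a Iota) \<longrightarrow> R cs \<in> cand (Eps cs b))}"

text \<open>The identity on terms; a variable code denotes the largest candidate, all schemes of the
  type of the atom.\<close>

definition dflt :: env where
  "dflt \<sigma> i = (Var \<sigma> i, case \<sigma> of Iota \<Rightarrow> \<lambda>_. {} | Kappa n \<Rightarrow> \<lambda>cs. {t. typed \<Gamma> t (Eps cs (Var \<sigma> i))})"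

definition impS :: "ty \<Rightarrow> sch set \<Rightarrow> sch set \<Rightarrow> sch set" where
  "impS T X Y = {t. typed \<Gamma> t T \<and> (\<forall>u \<in> X. App t u \<in> Y)}"

definition allS :: "ty \<Rightarrow> srt \<Rightarrow> (den \<Rightarrow> sch set) \<Rightarrow> sch set" where
  "allS T \<sigma> F = {t. typed \<Gamma> t T \<and> (\<forall>d \<in> dens \<sigma>. TApp t (fst d) \<in> F d)}"

text \<open>The meaning of the right-hand side of the rule for equality. Here and below arguments
  are normalised before a candidate is selected, so that congruent terms select the same
  one.\<close>

definition eqS :: "tm \<Rightarrow> tm \<Rightarrow> sch set" where
  "eqS a b = {t. typed \<Gamma> t (Eq a b) \<and>
    (\<forall>d \<in> dens (Kappa 1). \<forall>u \<in> snd d [nf a]. App (TApp t (fst d)) u \<in> snd d [nf b])}"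

definition nullS :: "tm \<Rightarrow> sch set" where
  "nullS a = {t. typed \<Gamma> t (Null a) \<and>
    (nf a = Zero \<longrightarrow> (\<forall>d \<in> dens (Kappa 0). \<forall>u \<in> snd d []. App (TApp t (fst d)) u \<in> snd d [])) \<and>
    (\<forall>b. nf a = Succ b \<longrightarrow> (\<forall>d \<in> dens (Kappa 0). TApp t (fst d) \<in> snd d []))}"

text \<open>
  The rule for \<open>N\<close> is recursive, but its right-hand side contains \<open>N\<close> only positively, so that \<open>N\<close> can
  be interpreted by a least fixed point.
\<close>

definition natF :: "(tm \<Rightarrow> sch set) \<Rightarrow> tm \<Rightarrow> sch set" where
  "natF X a = {t. typed \<Gamma> t (N a) \<and>
    (\<forall>d \<in> dens (Kappa 1). \<forall>u \<in> snd d [Zero]. \<forall>v. typed \<Gamma> v (par_succ (fst d)) \<longrightarrow>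
      (\<forall>m w z. has_sort m Iota \<longrightarrow> w \<in> X (nf m) \<longrightarrow> z \<in> snd d [nf m] \<longrightarrow>
        App (App (TApp v m) w) z \<in> snd d [Succ (nf m)]) \<longrightarrow>
      App (App (TApp t (fst d)) u) v \<in> snd d [a])}"

definition natS :: "tm \<Rightarrow> sch set" where
  "natS = lfp natF"

text \<open>The recursion is structural in spite of impredicativity: \<open>Forall\<close> ranges
  over candidates, not over types, and the index \<open>A\<close> is a component of the term
  \<open>Comp xs ys A bs\<close>. Such a symbol denotes the meaning of its index as a function of
  the arguments.\<close>

fun ev :: "env \<Rightarrow> tm \<Rightarrow> den" and red :: "env \<Rightarrow> ty \<Rightarrow> sch set" where
  "ev \<xi> (Var \<sigma> i) = \<xi> \<sigma> i"
| "ev \<xi> Zero = iota Zero"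
| "ev \<xi> (Succ a) = iota (Succ (fst (ev \<xi> a)))"
| "ev \<xi> (Pred a) = iota (Pred (fst (ev \<xi> a)))"
| "ev \<xi> (Comp xs ys A bs) = (Comp xs ys A (map (\<lambda>b. fst (ev \<xi> b)) bs),
    \<lambda>cs. red (env_of dflt (zip (keys xs ys) (map iota cs @ map (\<lambda>b. ev \<xi> b) bs))) A)"
| "red \<xi> (Eq a b) = eqS (fst (ev \<xi> a)) (fst (ev \<xi> b))"
| "red \<xi> (N a) = natS (nf (fst (ev \<xi> a)))"
| "red \<xi> (Null a) = nullS (fst (ev \<xi> a))"
| "red \<xi> (Eps cs c) = snd (ev \<xi> c) (map (\<lambda>a. nf (fst (ev \<xi> a))) cs)"
| "red \<xi> (Imp A B) = impS (subst_ty (tms \<xi>) (Imp A B)) (red \<xi> A) (red \<xi> B)"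
| "red \<xi> (Forall \<sigma> A) = allS (subst_ty (tms \<xi>) (Forall \<sigma> A)) \<sigma> (\<lambda>d. red (scons \<sigma> d \<xi>) A)"

definition env_wf :: "env \<Rightarrow> bool" where
  "env_wf \<xi> \<longleftrightarrow> (\<forall>\<sigma> i. \<xi> \<sigma> i \<in> dens \<sigma>)"

section \<open>Substitution lemmas for the interpretation\<close>

definition esub :: "env \<Rightarrow> sub \<Rightarrow> env" where
  "esub \<xi> \<eta> \<sigma> i = ev \<xi> (\<eta> \<sigma> i)"

lemma fst_ev [simp]: "fst (ev \<xi> a) = subst_tm (tms \<xi>) a"
  by (induction a) (auto simp: tms_def iota_def)

lemma tms_scons [simp]: "tms (scons \<sigma> d \<xi>) = scons \<sigma> (fst d) (tms \<xi>)"
  by (auto simp: tms_def scons_def fun_eq_iff split: nat.split)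

lemma tms_esub [simp]: "tms (esub \<xi> \<eta>) = csub (tms \<xi>) \<eta>"
  by (auto simp: tms_def esub_def csub_def fun_eq_iff)

lemma ev_subst: "ev \<xi> (subst_tm \<eta> a) = ev (esub \<xi> \<eta>) a"
proof (induction a)
  case (Var \<sigma> i)
  show ?case by (simp add: esub_def)
next
  case (Comp xs ys A bs)
  then show ?case by (simp add: comp_def cong: map_cong)
qed simp_all

lemma esub_Var [simp]: "esub \<xi> Var = \<xi>"
  by (simp add: esub_def fun_eq_iff)

lemma esub_scons: "esub \<xi> (scons \<sigma> a \<eta>) = scons \<sigma> (ev \<xi> a) (esub \<xi> \<eta>)"
  by (auto simp: esub_def scons_def fun_eq_iff split: nat.split)

lemma esub_csub: "esub \<xi> (csub \<theta> \<eta>) = esub (esub \<xi> \<theta>) \<eta>"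
  unfolding esub_def csub_def fun_eq_iff ev_subst by (simp add: esub_def[abs_def])

lemma esub_scons_shift [simp]: "esub (scons \<sigma> d \<xi>) (shift \<sigma>) = \<xi>"
  by (auto simp: esub_def shift_def scons_def fun_eq_iff)

lemma esub_up: "esub (scons \<sigma> d \<xi>) (up \<sigma> \<eta>) = scons \<sigma> d (esub \<xi> \<eta>)"
  by (simp add: up_eq esub_scons esub_csub)

lemma red_subst: "red \<xi> (subst_ty \<eta> A) = red (esub \<xi> \<eta>) A"
proof (induction A arbitrary: \<xi> \<eta>)
  case (Eps cs c)
  show ?case by (simp add: ev_subst comp_def)
next
  case (Imp A B)
  then show ?case by simp
next
  case (Forall \<sigma> A)
  then show ?case by (simp add: esub_up)
qed simp_all

section \<open>Dependence on the environment up to congruence of terms\<close>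

definition agree :: "den \<Rightarrow> den \<Rightarrow> bool" where
  "agree d d' \<longleftrightarrow> tm_eq (fst d) (fst d') \<and> snd d = snd d'"

lemma agree_refl [simp]: "agree d d"
  by (simp add: agree_def)

lemma agree_env_of:
  "list_all2 agree ds ds' \<Longrightarrow> agree (env_of \<xi> (zip ks ds) \<sigma> i) (env_of \<xi> (zip ks ds') \<sigma> i)"
proof (induction arbitrary: ks rule: list_all2_induct)
  case (Cons d ds d' ds')
  then show ?case by (cases ks) (auto simp: env_of_def)
qed simp

lemma agree_subst_ty:
  "(\<And>\<sigma> i. (\<sigma>, i) \<in> fv_ty A \<Longrightarrow> agree (\<xi> \<sigma> i) (\<xi>' \<sigma> i)) \<Longrightarrow>
    ty_cong (subst_ty (tms \<xi>) A) (subst_ty (tms \<xi>') A)"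
  by (rule ty_cong_subst_cong) (simp add: agree_def tms_def)

lemma typed_cong: "ty_cong A B \<Longrightarrow> typed \<Gamma> t A \<longleftrightarrow> typed \<Gamma> t B"
  by (auto intro: ty_conv ty_cong_sym)

lemma agree_tm_eq:
  "(\<And>\<sigma> i. (\<sigma>, i) \<in> fv_tm a \<Longrightarrow> agree (\<xi> \<sigma> i) (\<xi>' \<sigma> i)) \<Longrightarrow>
    tm_eq (subst_tm (tms \<xi>) a) (subst_tm (tms \<xi>') a)"
  by (rule tm_eq_subst_cong) (simp add: agree_def tms_def)

lemma eqS_cong: "tm_eq a a' \<Longrightarrow> tm_eq b b' \<Longrightarrow> eqS a b = eqS a' b'"
  using nf_eq[of a a'] nf_eq[of b b'] typed_cong[OF ty_cong_Eq, of a a' b b'] by (simp add: eqS_def)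

lemma nullS_cong: "tm_eq a a' \<Longrightarrow> nullS a = nullS a'"
  using nf_eq[of a a'] typed_cong[OF ty_cong_Null, of a a'] by (simp add: nullS_def)

text \<open>The terms assigned by an environment enter the sets only through \<open>nf\<close> and
  through typing, both invariant under congruence; so first components that are merely congruent
  suffice.\<close>

lemma agree_ev_red:
  fixes a :: tm and A :: ty
  shows "(\<And>\<sigma> i. (\<sigma>, i) \<in> fv_tm a \<Longrightarrow> agree (\<xi> \<sigma> i) (\<xi>' \<sigma> i)) \<Longrightarrow> snd (ev \<xi> a) = snd (ev \<xi>' a)"
    and "(\<And>\<sigma> i. (\<sigma>, i) \<in> fv_ty A \<Longrightarrow> agree (\<xi> \<sigma> i) (\<xi>' \<sigma> i)) \<Longrightarrow> red \<xi> A = red \<xi>' A"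
proof (induction a and A arbitrary: \<xi> \<xi>' and \<xi> \<xi>')
  case (Var \<sigma> i)
  then show ?case by (auto simp: agree_def)
next
  case (Comp xs ys A bs)
  have "agree (ev \<xi> b) (ev \<xi>' b)" if "b \<in> set bs" for b
    using Comp.IH(2)[OF that, of \<xi> \<xi>'] Comp.prems that agree_tm_eq[of b \<xi> \<xi>']
    by (auto simp: agree_def)
  then have "list_all2 agree (map iota cs @ map (ev \<xi>) bs) (map iota cs @ map (ev \<xi>') bs)" for cs
    by (auto simp: list_all2_conv_all_nth nth_append)
  then show ?case
    by (auto simp: fun_eq_iff intro!: arg_cong2[of _ _ _ _ "(\<in>)"] Comp.IH(1) agree_env_of)
next
  case (Eq a b)
  then show ?case by (auto intro!: eqS_cong agree_tm_eq)
next
  case (N a)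
  then show ?case by (auto intro!: arg_cong[of _ _ natS] nf_eq agree_tm_eq)
next
  case (Null a)
  then show ?case by (auto intro!: nullS_cong agree_tm_eq)
next
  case (Eps cs c)
  have "map (\<lambda>a. nf (fst (ev \<xi> a))) cs = map (\<lambda>a. nf (fst (ev \<xi>' a))) cs"
    using Eps.prems by (auto intro!: nf_eq agree_tm_eq)
  moreover have "snd (ev \<xi> c) = snd (ev \<xi>' c)" using Eps by auto
  ultimately show ?case by (simp cong: map_cong)
next
  case (Imp A B)
  have "red \<xi> A = red \<xi>' A" "red \<xi> B = red \<xi>' B" using Imp by auto
  moreover note typed_cong[OF agree_subst_ty[of "Imp A B" \<xi> \<xi>', OF Imp.prems]]
  ultimately show ?case by (simp add: impS_def)
next
  case (Forall \<sigma> A)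
  have "red (scons \<sigma> d \<xi>) A = red (scons \<sigma> d \<xi>') A" for d
  proof (rule Forall.IH)
    fix \<tau> i assume "(\<tau>, i) \<in> fv_ty A"
    then show "agree (scons \<sigma> d \<xi> \<tau> i) (scons \<sigma> d \<xi>' \<tau> i)"
      using Forall.prems[of \<tau> "if \<tau> = \<sigma> then i - 1 else i"]
      by (auto simp: scons_def split: nat.split)
  qed
  moreover note typed_cong[OF agree_subst_ty[of "Forall \<sigma> A" \<xi> \<xi>', OF Forall.prems]]
  ultimately show ?case by (simp add: allS_def)
qed (simp_all add: iota_def)

section \<open>The interpretations are candidates\<close>

lemma cand_cong: "ty_cong A B \<Longrightarrow> cand A = cand B"
  by (simp add: cand_def typed_cong)

lemma candD: "X \<in> cand T \<Longrightarrow> t \<in> X \<Longrightarrow> typed \<Gamma> t T"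
  by (simp add: cand_def)

lemma cand_expand: "X \<in> cand T \<Longrightarrow> (wred \<Gamma>)\<^sup>*\<^sup>* t t' \<Longrightarrow> t' \<in> X \<Longrightarrow> typed \<Gamma> t T \<Longrightarrow> t \<in> X"
  by (auto simp: cand_def)

lemma dens_sort: "d \<in> dens \<sigma> \<Longrightarrow> has_sort (fst d) \<sigma>"
  by (auto simp: dens_def)

lemma dens_cand:
  "d \<in> dens (Kappa n) \<Longrightarrow> length cs = n \<Longrightarrow> \<forall>a \<in> set cs. has_sort a Iota \<Longrightarrow> snd d cs \<in> cand (Eps cs (fst d))"
  by (auto simp: dens_def)

lemma dens_Iota: "d \<in> dens Iota \<longleftrightarrow> (\<exists>a. d = iota a \<and> has_sort a Iota)"
  by (cases d) (auto simp: dens_def iota_def)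

lemma env_wf_tms: "env_wf \<xi> \<Longrightarrow> wsub (tms \<xi>)"
  by (simp add: env_wf_def wsub_def tms_def dens_sort)

lemma env_wf_scons: "env_wf \<xi> \<Longrightarrow> d \<in> dens \<sigma> \<Longrightarrow> env_wf (scons \<sigma> d \<xi>)"
  by (auto simp: env_wf_def scons_def split: nat.split)

lemma env_wf_dflt: "env_wf dflt"
  by (auto simp: env_wf_def dflt_def dens_def cand_def split: srt.split)

lemma tms_dflt: "tms dflt = Var"
  by (simp add: tms_def dflt_def fun_eq_iff)

lemma tms_env_of_dflt:
  "tms (env_of dflt (zip ks ds)) = subst_of (zip ks (map fst ds))"
proof (intro ext)
  fix \<sigma> i
  show "tms (env_of dflt (zip ks ds)) \<sigma> i = subst_of (zip ks (map fst ds)) \<sigma> i"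
    by (simp add: tms_def env_of_def subst_of_def map_of_zip_map_option dflt_def split: option.split)
qed

text \<open>Weak reduction acts in the head, so a reduction of the function is a reduction of the
  application, and closure under expansion is inherited from \<open>Y\<close>.\<close>

lemma cand_impS:
  assumes "\<And>u. u \<in> X \<Longrightarrow> typed \<Gamma> u A" "Y \<in> cand B"
  shows "impS (Imp A B) X Y \<in> cand (Imp A B)"
  unfolding cand_def[of "Imp A B"]
proof (intro CollectI conjI allI impI ballI)
  fix t t' assume r: "(wred \<Gamma>)\<^sup>*\<^sup>* t t'" "t' \<in> impS (Imp A B) X Y" and t: "typed \<Gamma> t (Imp A B)"
  have "App t u \<in> Y" if "u \<in> X" for u
    using assms(2) rtranclp_map[of "wred \<Gamma>" "wred \<Gamma>" "\<lambda>t. App t u", OF wred_App r(1)]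
  proof (rule cand_expand)
    show "App t' u \<in> Y" using r(2) that by (simp add: impS_def)
    show "typed \<Gamma> (App t u) B" using t assms(1)[OF that] by (rule ty_App)
  qed
  then show "t \<in> impS (Imp A B) X Y" using t by (simp add: impS_def)
qed (simp add: impS_def)

lemma cand_allS:
  assumes "\<And>d. d \<in> dens \<sigma> \<Longrightarrow> F d \<in> cand (subst_ty (inst \<sigma> (fst d)) A)"
  shows "allS (Forall \<sigma> A) \<sigma> F \<in> cand (Forall \<sigma> A)"
  unfolding cand_def[of "Forall \<sigma> A"]
proof (intro CollectI conjI allI impI ballI)
  fix t t' assume r: "(wred \<Gamma>)\<^sup>*\<^sup>* t t'" "t' \<in> allS (Forall \<sigma> A) \<sigma> F" and t: "typed \<Gamma> t (Forall \<sigma> A)"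
  have "TApp t (fst d) \<in> F d" if d: "d \<in> dens \<sigma>" for d
    using assms[OF d] rtranclp_map[of "wred \<Gamma>" "wred \<Gamma>" "\<lambda>t. TApp t (fst d)", OF wred_TApp r(1)]
  proof (rule cand_expand)
    show "TApp t' (fst d) \<in> F d" using r(2) d by (simp add: allS_def)
    show "typed \<Gamma> (TApp t (fst d)) (subst_ty (inst \<sigma> (fst d)) A)"
      using t dens_sort[OF d] by (rule ty_TApp)
  qed
  then show "t \<in> allS (Forall \<sigma> A) \<sigma> F" using t by (simp add: allS_def)
qed (simp add: allS_def)

definition eq_body :: "tm \<Rightarrow> tm \<Rightarrow> ty" where
  "eq_body a b = Imp (Eps [lift_tm (Kappa 1) a] (Var (Kappa 1) 0)) (Eps [lift_tm (Kappa 1) b] (Var (Kappa 1) 0))"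

definition N_body :: "tm \<Rightarrow> ty" where
  "N_body a = Imp (par_zero (Var (Kappa 1) 0)) (Imp (par_succ (Var (Kappa 1) 0))
    (Eps [lift_tm (Kappa 1) a] (Var (Kappa 1) 0)))"

lemma subst_par_succ [simp]: "subst_ty \<theta> (par_succ c) = par_succ (subst_tm \<theta> c)"
  by (simp add: par_succ_def up_eq)

lemma subst_par_zero [simp]: "subst_ty \<theta> (par_zero c) = par_zero (subst_tm \<theta> c)"
  by (simp add: par_zero_def)

lemma subst_eq_body: "subst_ty (scons (Kappa 1) c \<theta>) (eq_body a b) =
    Imp (Eps [subst_tm \<theta> a] c) (Eps [subst_tm \<theta> b] c)"
  by (simp add: eq_body_def)

lemma subst_N_body: "subst_ty (scons (Kappa 1) c \<theta>) (N_body a) =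
    Imp (par_zero c) (Imp (par_succ c) (Eps [subst_tm \<theta> a] c))"
  by (simp add: N_body_def)

lemma Eq_cong: "has_sort a Iota \<Longrightarrow> has_sort b Iota \<Longrightarrow> ty_cong (Eq a b) (Forall (Kappa 1) (eq_body a b))"
  unfolding eq_body_def by (rule ty_red_cong[OF red_Eq])

lemma N_cong: "has_sort a Iota \<Longrightarrow> ty_cong (N a) (Forall (Kappa 1) (N_body a))"
  unfolding N_body_def by (rule ty_red_cong[OF red_N])

lemma Eps_nf_cong: "has_sort a Iota \<Longrightarrow> ty_cong (Eps [nf a] c) (Eps [a] c)"
  by (rule ty_cong_Eps) (auto intro: tm_eq_nf equivclp_sym)

lemma dens_cand1: "d \<in> dens (Kappa 1) \<Longrightarrow> has_sort a Iota \<Longrightarrow> snd d [nf a] \<in> cand (Eps [a] (fst d))"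
  using dens_cand[of d 1 "[nf a]"] cand_cong[OF Eps_nf_cong] by (simp add: has_sort_nf)

lemma typed1: "d \<in> dens (Kappa 1) \<Longrightarrow> has_sort a Iota \<Longrightarrow> t \<in> snd d [nf a] \<Longrightarrow> typed \<Gamma> t (Eps [a] (fst d))"
  by (blast dest: dens_cand1 candD)

lemma iota_dens: "iota a \<in> dens Iota \<longleftrightarrow> has_sort a Iota"
  by (auto simp: dens_Iota iota_def)

lemma ball_dens_Iota: "(\<forall>d \<in> dens Iota. P d) \<longleftrightarrow> (\<forall>a. has_sort a Iota \<longrightarrow> P (iota a))"
  by (auto simp: dens_Iota)

text \<open>The intermediate typing condition of \<open>impS\<close> follows from the typing of the
  whole scheme. In this form \<open>eqS\<close> is the interpretation of the unfolded type, as
  invariance under the rule requires.\<close>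

lemma eqS_unfold:
  assumes "has_sort a Iota" "has_sort b Iota"
  shows "eqS a b = allS (Forall (Kappa 1) (eq_body a b)) (Kappa 1)
    (\<lambda>d. impS (Imp (Eps [a] (fst d)) (Eps [b] (fst d))) (snd d [nf a]) (snd d [nf b]))"
proof -
  have "typed \<Gamma> (TApp t (fst d)) (Imp (Eps [a] (fst d)) (Eps [b] (fst d)))"
    if "typed \<Gamma> t (Forall (Kappa 1) (eq_body a b))" "d \<in> dens (Kappa 1)" for t d
    using ty_TApp[OF that(1) dens_sort[OF that(2)]] subst_eq_body[of _ Var] by (simp add: inst_eq)
  then show ?thesis
    unfolding eqS_def allS_def impS_def mem_Collect_eq typed_cong[OF Eq_cong[OF assms]] by blast
qed

lemma cand_eqS:
  assumes "has_sort a Iota" "has_sort b Iota"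
  shows "eqS a b \<in> cand (Eq a b)"
  unfolding eqS_unfold[OF assms] cand_cong[OF Eq_cong[OF assms]]
proof (rule cand_allS)
  fix d assume d: "d \<in> dens (Kappa 1)"
  have "impS (Imp (Eps [a] (fst d)) (Eps [b] (fst d))) (snd d [nf a]) (snd d [nf b]) \<in>
      cand (Imp (Eps [a] (fst d)) (Eps [b] (fst d)))"
    by (intro cand_impS typed1 dens_cand1 d assms)
  then show "impS (Imp (Eps [a] (fst d)) (Eps [b] (fst d))) (snd d [nf a]) (snd d [nf b]) \<in>
      cand (subst_ty (inst (Kappa 1) (fst d)) (eq_body a b))"
    using subst_eq_body[of _ Var] by (simp add: inst_eq)
qed

text \<open>The interpretation of \<open>par_succ\<close> at a code with denotation
  \<open>d\<close>.\<close>

definition succS :: "den \<Rightarrow> sch set" where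
  "succS d = allS (par_succ (fst d)) Iota (\<lambda>m.
    impS (Imp (N (fst m)) (Imp (Eps [fst m] (fst d)) (Eps [Succ (fst m)] (fst d)))) (natS (nf (fst m)))
      (impS (Imp (Eps [fst m] (fst d)) (Eps [Succ (fst m)] (fst d))) (snd d [nf (fst m)]) (snd d [Succ (nf (fst m))])))"

text \<open>\<open>X\<close> occurs to the left of two implications: it only restricts the schemes
  \<open>v\<close> that are quantified over.\<close>

lemma mono_natF: "mono natF"
  by (rule monoI) (fastforce simp: natF_def le_fun_def)

lemma natS_natF: "natS a = natF natS a"
  unfolding natS_def by (subst lfp_unfold[OF mono_natF]) simp

lemma natS_typed: "has_sort a Iota \<Longrightarrow> t \<in> natS (nf a) \<Longrightarrow> typed \<Gamma> t (N a)"
  using typed_cong[OF ty_cong_N[OF tm_eq_nf]] by (subst (asm) natS_natF) (auto simp: natF_def)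

lemma typed_par_succ:
  assumes "typed \<Gamma> v (par_succ c)" "has_sort m Iota"
  shows "typed \<Gamma> (TApp v m) (Imp (N m) (Imp (Eps [m] c) (Eps [Succ m] c)))"
  using ty_TApp[OF assms(1)[unfolded par_succ_def] assms(2)] by (simp add: inst_eq)

lemma succS_iff:
  assumes "d \<in> dens (Kappa 1)"
  shows "v \<in> succS d \<longleftrightarrow> typed \<Gamma> v (par_succ (fst d)) \<and>
    (\<forall>m w z. has_sort m Iota \<longrightarrow> w \<in> natS (nf m) \<longrightarrow> z \<in> snd d [nf m] \<longrightarrow>
      App (App (TApp v m) w) z \<in> snd d [Succ (nf m)])"
proof -
  have "typed \<Gamma> (App (TApp v m) w) (Imp (Eps [m] (fst d)) (Eps [Succ m] (fst d)))"
    if "typed \<Gamma> v (par_succ (fst d))" "has_sort m Iota" "w \<in> natS (nf m)" for m w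
    using typed_par_succ[OF that(1,2)] natS_typed[OF that(2,3)] by (rule ty_App)
  then show ?thesis
    by (auto simp: succS_def allS_def impS_def ball_dens_Iota iota_def intro: typed_par_succ)
qed

text \<open>The fixed point equation, reshaped into the interpretation of the right-hand side of the
  rule for \<open>N\<close>.\<close>

lemma natS_unfold:
  assumes a: "has_sort a Iota"
  shows "natS (nf a) = allS (Forall (Kappa 1) (N_body a)) (Kappa 1) (\<lambda>d.
    impS (Imp (par_zero (fst d)) (Imp (par_succ (fst d)) (Eps [a] (fst d)))) (snd d [Zero])
      (impS (Imp (par_succ (fst d)) (Eps [a] (fst d))) (succS d) (snd d [nf a])))"
    (is "_ = ?R")
proof -
  have n: "typed \<Gamma> t (N (nf a)) \<longleftrightarrow> typed \<Gamma> t (Forall (Kappa 1) (N_body a))" for t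
    using typed_cong[OF ty_cong_N[OF tm_eq_nf[OF a]]] typed_cong[OF N_cong[OF a]] by simp
  have t1: "typed \<Gamma> (TApp t (fst d)) (Imp (par_zero (fst d)) (Imp (par_succ (fst d)) (Eps [a] (fst d))))"
    if "typed \<Gamma> t (Forall (Kappa 1) (N_body a))" "d \<in> dens (Kappa 1)" for t d
    using ty_TApp[OF that(1) dens_sort[OF that(2)]] subst_N_body[of _ Var] by (simp add: inst_eq)
  have t2: "typed \<Gamma> (App (TApp t (fst d)) u) (Imp (par_succ (fst d)) (Eps [a] (fst d)))"
    if "typed \<Gamma> t (Forall (Kappa 1) (N_body a))" "d \<in> dens (Kappa 1)" "u \<in> snd d [Zero]" for t d u
    using t1[OF that(1,2)]
  proof (rule ty_App)
    show "typed \<Gamma> u (par_zero (fst d))"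
      using candD[OF dens_cand[OF that(2), of "[Zero]"] that(3)] by (simp add: par_zero_def)
  qed
  have "t \<in> natS (nf a) \<longleftrightarrow> typed \<Gamma> t (Forall (Kappa 1) (N_body a)) \<and> (\<forall>d \<in> dens (Kappa 1).
      \<forall>u \<in> snd d [Zero]. \<forall>v \<in> succS d. App (App (TApp t (fst d)) u) v \<in> snd d [nf a])" for t
    unfolding natS_natF[of "nf a"] natF_def mem_Collect_eq n using succS_iff by blast
  moreover have "t \<in> ?R \<longleftrightarrow> typed \<Gamma> t (Forall (Kappa 1) (N_body a)) \<and> (\<forall>d \<in> dens (Kappa 1).
      \<forall>u \<in> snd d [Zero]. \<forall>v \<in> succS d. App (App (TApp t (fst d)) u) v \<in> snd d [nf a])" for t
    unfolding allS_def impS_def mem_Collect_eq using t1 t2 by blast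
  ultimately show ?thesis by blast
qed

lemma cand_natS:
  assumes "has_sort a Iota"
  shows "natS (nf a) \<in> cand (N a)"
  unfolding natS_unfold[OF assms] cand_cong[OF N_cong[OF assms]]
proof (rule cand_allS)
  fix d assume d: "d \<in> dens (Kappa 1)"
  have "typed \<Gamma> u (par_zero (fst d))" if "u \<in> snd d [Zero]" for u
    using candD[OF dens_cand[OF d, of "[Zero]"] that] by (simp add: par_zero_def)
  moreover have "typed \<Gamma> v (par_succ (fst d))" if "v \<in> succS d" for v
    using that succS_iff[OF d] by blast
  ultimately have "impS (Imp (par_zero (fst d)) (Imp (par_succ (fst d)) (Eps [a] (fst d)))) (snd d [Zero])
      (impS (Imp (par_succ (fst d)) (Eps [a] (fst d))) (succS d) (snd d [nf a])) \<in>
    cand (Imp (par_zero (fst d)) (Imp (par_succ (fst d)) (Eps [a] (fst d))))"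
    by (intro cand_impS dens_cand1 d assms)
  then show "impS (Imp (par_zero (fst d)) (Imp (par_succ (fst d)) (Eps [a] (fst d)))) (snd d [Zero])
      (impS (Imp (par_succ (fst d)) (Eps [a] (fst d))) (succS d) (snd d [nf a])) \<in>
    cand (subst_ty (inst (Kappa 1) (fst d)) (N_body a))"
    using subst_N_body[of _ Var] by (simp add: inst_eq)
qed

definition null_body :: ty where
  "null_body = Imp (Eps [] (Var (Kappa 0) 0)) (Eps [] (Var (Kappa 0) 0))"

lemma typed0: "d \<in> dens (Kappa 0) \<Longrightarrow> t \<in> snd d [] \<Longrightarrow> typed \<Gamma> t (Eps [] (fst d))"
  using dens_cand[of d 0 "[]"] by (auto dest: candD)

lemma cand0: "d \<in> dens (Kappa 0) \<Longrightarrow> snd d [] \<in> cand (Eps [] (fst d))"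
  by (rule dens_cand) auto

lemma Null_Zero_cong: "has_sort a Iota \<Longrightarrow> nf a = Zero \<Longrightarrow> ty_cong (Null a) (Forall (Kappa 0) null_body)"
  using ty_cong_Null[OF tm_eq_nf, of a] ty_red_cong[OF red_Null_Zero] ty_cong_trans
  unfolding null_body_def by metis

lemma Null_Succ_cong: "has_sort a Iota \<Longrightarrow> nf a = Succ b \<Longrightarrow>
    ty_cong (Null a) (Forall (Kappa 0) (Eps [] (Var (Kappa 0) 0)))"
  using ty_cong_Null[OF tm_eq_nf, of a] ty_red_cong[OF red_Null_Succ[of b]] ty_cong_trans has_sort_nf[of a]
  by (metis has_sort_simps(3))

lemma nullS_Zero:
  assumes "has_sort a Iota" "nf a = Zero"
  shows "nullS a = allS (Forall (Kappa 0) null_body) (Kappa 0)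
    (\<lambda>d. impS (Imp (Eps [] (fst d)) (Eps [] (fst d))) (snd d []) (snd d []))"
proof -
  have "typed \<Gamma> (TApp t (fst d)) (Imp (Eps [] (fst d)) (Eps [] (fst d)))"
    if "typed \<Gamma> t (Forall (Kappa 0) null_body)" "d \<in> dens (Kappa 0)" for t d
    using ty_TApp[OF that(1) dens_sort[OF that(2)]] by (simp add: inst_eq null_body_def)
  then show ?thesis
    unfolding nullS_def allS_def impS_def mem_Collect_eq typed_cong[OF Null_Zero_cong[OF assms]] assms(2)
    by blast
qed

lemma nullS_Succ:
  assumes "has_sort a Iota" "nf a = Succ b"
  shows "nullS a = allS (Forall (Kappa 0) (Eps [] (Var (Kappa 0) 0))) (Kappa 0) (\<lambda>d. snd d [])"
  unfolding nullS_def allS_def typed_cong[OF Null_Succ_cong[OF assms]] assms(2) by blast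

lemma cand_typed: "{t. typed \<Gamma> t A} \<in> cand A"
  by (simp add: cand_def)

lemma cand_nullS:
  assumes a: "has_sort a Iota"
  shows "nullS a \<in> cand (Null a)"
proof (cases "nf a")
  case Zero
  show ?thesis
    unfolding nullS_Zero[OF a Zero] cand_cong[OF Null_Zero_cong[OF a Zero]]
  proof (rule cand_allS)
    fix d assume d: "d \<in> dens (Kappa 0)"
    have "impS (Imp (Eps [] (fst d)) (Eps [] (fst d))) (snd d []) (snd d []) \<in>
        cand (Imp (Eps [] (fst d)) (Eps [] (fst d)))"
      by (intro cand_impS typed0 cand0 d)
    then show "impS (Imp (Eps [] (fst d)) (Eps [] (fst d))) (snd d []) (snd d []) \<in>
        cand (subst_ty (inst (Kappa 0) (fst d)) null_body)"
      by (simp add: inst_eq null_body_def)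
  qed
next
  case (Succ b)
  show ?thesis
    unfolding nullS_Succ[OF a Succ] cand_cong[OF Null_Succ_cong[OF a Succ]]
    by (rule cand_allS) (simp add: inst_eq cand0)
qed (simp_all add: nullS_def cand_typed)

lemma env_wf_env_of:
  assumes "has_sort (Comp xs ys A bs) (Kappa (length cs))" "\<forall>a \<in> set cs. has_sort a Iota"
    and "\<And>b \<sigma>. b \<in> set bs \<Longrightarrow> has_sort b \<sigma> \<Longrightarrow> ev \<xi> b \<in> dens \<sigma>"
  shows "env_wf (env_of dflt (zip (keys xs ys) (map iota cs @ map (ev \<xi>) bs)))"
    (is "env_wf (env_of dflt (zip ?ks ?ds))")
  unfolding env_wf_def
proof (intro allI)
  fix \<sigma> i
  note l = comp_args_sorted[OF assms(1,2)]
  show "env_of dflt (zip ?ks ?ds) \<sigma> i \<in> dens \<sigma>"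
  proof (cases "(\<sigma>, i) \<in> set ?ks")
    case True
    then obtain j where j: "j < length ?ks" "?ks ! j = (\<sigma>, i)"
      and m: "map_of (zip ?ks ?ds) (\<sigma>, i) = Some (?ds ! j)"
      using map_of_zip_Some[of ?ks ?ds "(\<sigma>, i)"] l(1) by auto
    have s: "has_sort ((cs @ bs) ! j) \<sigma>" using l(2)[OF j(1)] j(2) by simp
    have "?ds ! j \<in> dens \<sigma>"
    proof (cases "j < length cs")
      case True
      then have "\<sigma> = Iota" using s assms(2) has_sort_unique by (fastforce simp: nth_append)
      then show ?thesis using True assms(2) by (auto simp: nth_append dens_Iota)
    next
      case False
      then have "(cs @ bs) ! j \<in> set bs" "?ds ! j = ev \<xi> ((cs @ bs) ! j)"
        using j(1) l(1) by (auto simp: nth_append)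
      then show ?thesis using assms(3) s by metis
    qed
    then show ?thesis using m by (simp add: env_of_def)
  next
    case False
    then show ?thesis using env_wf_dflt
      unfolding env_of_def map_of_zip_None[OF False] env_wf_def by simp
  qed
qed

text \<open>The case of \<open>Comp\<close> is where comprehension is justified: the set
  interpreting the index is itself a candidate, hence among those over which second-order
  quantifiers range.\<close>

lemma ev_red_cand:
  fixes a :: tm and A :: ty
  shows "has_sort a \<sigma> \<Longrightarrow> env_wf \<xi> \<Longrightarrow> ev \<xi> a \<in> dens \<sigma>"
    and "wf_ty A \<Longrightarrow> env_wf \<xi> \<Longrightarrow> red \<xi> A \<in> cand (subst_ty (tms \<xi>) A)"
proof (induction a and A arbitrary: \<xi> \<sigma> and \<xi>)
  case (Var \<tau> i)
  then show ?case by (simp add: env_wf_def)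
next
  case (Comp xs ys A bs)
  let ?bs = "map (subst_tm (tms \<xi>)) bs"
  let ?R = "\<lambda>cs. red (env_of dflt (zip (keys xs ys) (map iota cs @ map (ev \<xi>) bs))) A"
  have \<sigma>: "\<sigma> = Kappa (length xs)" using Comp.prems by (simp add: has_sort_Comp)
  have s: "has_sort (Comp xs ys A ?bs) \<sigma>"
    using has_sort_subst[OF env_wf_tms[OF Comp.prems(2)] Comp.prems(1)] by simp
  have "?R cs \<in> cand (Eps cs (Comp xs ys A ?bs))"
    if cs: "length cs = length xs" "\<forall>a \<in> set cs. has_sort a Iota" for cs
  proof -
    let ?\<zeta> = "env_of dflt (zip (keys xs ys) (map iota cs @ map (ev \<xi>) bs))"
    have k: "\<sigma> = Kappa (length cs)" using \<sigma> cs by simp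
    have "env_wf ?\<zeta>"
      using Comp.prems Comp.IH(2) cs by (intro env_wf_env_of) (auto simp: k)
    then have "red ?\<zeta> A \<in> cand (subst_ty (tms ?\<zeta>) A)"
      using Comp.prems(1) by (intro Comp.IH(1)) (auto simp: has_sort_Comp)
    moreover have "tms ?\<zeta> = subst_of (zip (keys xs ys) (cs @ ?bs))"
      by (simp add: tms_env_of_dflt comp_def iota_def)
    \<comment> \<open>Candidates depend on types only up to congruence, so the candidate for the
      unfolded type serves for the atom.\<close>
    moreover have "ty_cong (Eps cs (Comp xs ys A ?bs)) (subst_ty (subst_of (zip (keys xs ys) (cs @ ?bs))) A)"
      using s cs k by (intro ty_red_cong red_Comp) auto
    ultimately show ?thesis by (simp add: cand_cong)
  qed
  then show ?case using s \<sigma> by (simp add: dens_def)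
next
  case (Eps cs c)
  have "ev \<xi> c \<in> dens (Kappa (length cs))" using Eps by auto
  then have "snd (ev \<xi> c) (map (\<lambda>a. nf (fst (ev \<xi> a))) cs) \<in>
      cand (Eps (map (\<lambda>a. nf (fst (ev \<xi> a))) cs) (fst (ev \<xi> c)))"
    using Eps.prems env_wf_tms by (intro dens_cand) (auto intro!: has_sort_nf has_sort_subst)
  moreover have "ty_cong (Eps (map (\<lambda>a. nf (fst (ev \<xi> a))) cs) (fst (ev \<xi> c)))
      (Eps (map (subst_tm (tms \<xi>)) cs) (subst_tm (tms \<xi>) c))"
    using Eps.prems env_wf_tms
    by (intro ty_cong_Eps) (auto simp: list_all2_conv_all_nth intro!: equivclp_sym[OF tm_eq_nf] has_sort_subst)
  ultimately show ?case by (simp add: cand_cong)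
next
  case (Imp A B)
  then show ?case by (auto intro!: cand_impS dest: candD)
next
  case (Forall \<sigma> A)
  have "red (scons \<sigma> d \<xi>) A \<in> cand (subst_ty (inst \<sigma> (fst d)) (subst_ty (up \<sigma> (tms \<xi>)) A))"
    if "d \<in> dens \<sigma>" for d
    using Forall.IH[of "scons \<sigma> d \<xi>"] Forall.prems env_wf_scons[OF _ that] by simp
  then show ?case by (simp add: cand_allS)
next
  case (Eq a b)
  then show ?case using env_wf_tms by (auto intro!: cand_eqS has_sort_subst)
next
  case (N a)
  then show ?case using env_wf_tms by (auto intro!: cand_natS has_sort_subst)
next
  case (Null a)
  then show ?case using env_wf_tms by (auto intro!: cand_nullS has_sort_subst)
qed (use env_wf_tms in \<open>auto simp: iota_dens intro!: has_sort_subst\<close>)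

lemma ev_Iota: "has_sort a Iota \<Longrightarrow> env_wf \<xi> \<Longrightarrow> ev \<xi> a = iota (subst_tm (tms \<xi>) a)"
  by (metis ev_red_cand(1) dens_Iota fst_ev iota_def fst_conv)

section \<open>Invariance of the interpretation under the congruence\<close>

lemma ev_tm_red: "tm_red a b \<Longrightarrow> env_wf \<xi> \<Longrightarrow> agree (ev \<xi> a) (ev \<xi> b)"
proof (induction rule: tm_red.induct)
  case (Pred_Succ a)
  then have "tm_red (Pred (Succ (subst_tm (tms \<xi>) a))) (subst_tm (tms \<xi>) a)"
    by (intro tm_red.intros has_sort_subst env_wf_tms)
  then show ?case using Pred_Succ by (auto simp: agree_def ev_Iota iota_def)
next
  case (in_Comp b b' xs ys A bs cs)
  then have b: "agree (ev \<xi> b) (ev \<xi> b')" by simp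
  have "tm_red (subst_tm (tms \<xi>) (Comp xs ys A (bs @ b # cs))) (subst_tm (tms \<xi>) (Comp xs ys A (bs @ b' # cs)))"
    using in_Comp by (intro tm_red_subst env_wf_tms tm_red.intros)
  moreover have "agree (env_of dflt (zip (keys xs ys) (map iota es @ map (ev \<xi>) (bs @ b # cs))) \<sigma> i)
    (env_of dflt (zip (keys xs ys) (map iota es @ map (ev \<xi>) (bs @ b' # cs))) \<sigma> i)" for es \<sigma> i
  proof -
    have l: "list_all2 agree ds ds" for ds by (simp add: list_all2_same)
    show ?thesis unfolding map_append list.map
      by (intro agree_env_of list_all2_appendI l list.rel_intros(2) b)
  qed
  then have "snd (ev \<xi> (Comp xs ys A (bs @ b # cs))) = snd (ev \<xi> (Comp xs ys A (bs @ b' # cs)))"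
    unfolding ev.simps snd_conv fun_eq_iff by (intro allI agree_ev_red(2))
  ultimately show ?case unfolding agree_def fst_ev by blast
qed (auto simp: agree_def iota_def intro: tm_eq_Succ tm_eq_Pred r_into_equivclp tm_red.intros)

lemma ty_red_red: "ty_red A B \<Longrightarrow> env_wf \<xi> \<Longrightarrow> red \<xi> A = red \<xi> B"
proof (induction arbitrary: \<xi> rule: ty_red.induct)
  case (red_Comp xs ys A bs cs)
  note hs = red_Comp(1,2)
  let ?cs = "map (\<lambda>a. nf (fst (ev \<xi> a))) cs"
  let ?\<zeta> = "env_of dflt (zip (keys xs ys) (map iota ?cs @ map (ev \<xi>) bs))"
  \<comment> \<open>The two environments differ outside the keys, where one is \<open>dflt\<close>
    and the other comes from \<xi>, and by normalisation of the number arguments; they agree on the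
    free variables of \<open>A\<close>.\<close>
  have "red ?\<zeta> A = red (esub \<xi> (subst_of (zip (keys xs ys) (cs @ bs)))) A"
  proof (rule agree_ev_red(2))
    fix \<sigma> i assume "(\<sigma>, i) \<in> fv_ty A"
    then have k: "(\<sigma>, i) \<in> set (keys xs ys)" using hs(1) by (auto simp: has_sort_Comp)
    have l: "length (keys xs ys) = length (cs @ bs)" by (rule comp_args_sorted(1)[OF hs])
    have "agree (env_of dflt (zip (keys xs ys) (map iota ?cs @ map (ev \<xi>) bs)) \<sigma> i)
        (env_of dflt (zip (keys xs ys) (map (ev \<xi>) (cs @ bs))) \<sigma> i)"
    proof (intro agree_env_of)
      have "agree (iota (nf (fst (ev \<xi> a)))) (ev \<xi> a)" if "a \<in> set cs" for a
        using that hs(2) red_Comp.prems env_wf_tms[OF red_Comp.prems]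
        by (auto simp: agree_def iota_def ev_Iota intro!: equivclp_sym[OF tm_eq_nf] has_sort_subst)
      then show "list_all2 agree (map iota ?cs @ map (ev \<xi>) bs) (map (ev \<xi>) (cs @ bs))"
        by (auto simp: list_all2_conv_all_nth nth_append)
    qed
    moreover have "env_of dflt (zip (keys xs ys) (map (ev \<xi>) (cs @ bs))) \<sigma> i =
        esub \<xi> (subst_of (zip (keys xs ys) (cs @ bs))) \<sigma> i"
      using map_of_zip_Some[OF l k]
      unfolding env_of_def esub_def subst_of_def map_of_zip_map_option by auto
    ultimately show "agree (?\<zeta> \<sigma> i) (esub \<xi> (subst_of (zip (keys xs ys) (cs @ bs))) \<sigma> i)" by simp
  qed
  then show ?case by (simp add: red_subst)
next
  case (red_Eq a b)
  then show ?case
    using env_wf_tms eqS_unfold[of "subst_tm (tms \<xi>) a" "subst_tm (tms \<xi>) b"]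
    by (simp add: has_sort_subst eq_body_def ev_subst up_eq)
next
  case (red_N a)
  then show ?case
    using env_wf_tms natS_unfold[of "subst_tm (tms \<xi>) a"]
    by (simp add: has_sort_subst N_body_def ev_subst up_eq par_zero_def par_succ_def succS_def iota_def)
next
  case red_Null_Zero
  then show ?case
    using nullS_Zero[of Zero] by (simp add: iota_def null_body_def up_eq)
next
  case (red_Null_Succ a)
  then show ?case
    using env_wf_tms nullS_Succ[of "Succ (subst_tm (tms \<xi>) a)" "nf (subst_tm (tms \<xi>) a)"]
    by (simp add: has_sort_subst up_eq iota_def)
next
  case (in_Eq1 a a' b)
  then show ?case
    by (auto intro!: eqS_cong[OF tm_eq_subst equivclp_refl] env_wf_tms)
next
  case (in_Eq2 b b' a)
  then show ?case
    by (auto intro!: eqS_cong[OF equivclp_refl tm_eq_subst] env_wf_tms)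
next
  case (in_N a a')
  then show ?case
    by (auto intro!: arg_cong[of _ _ natS] nf_red tm_red_subst env_wf_tms)
next
  case (in_Null a a')
  then show ?case
    by (auto intro!: nullS_cong r_into_equivclp tm_red_subst env_wf_tms)
next
  case (in_Eps1 a a' as bs c)
  then have "nf (subst_tm (tms \<xi>) a) = nf (subst_tm (tms \<xi>) a')"
    by (intro nf_red tm_red_subst env_wf_tms)
  then show ?case by simp
next
  case (in_Eps2 c c' as)
  then show ?case using ev_tm_red[of c c' \<xi>] by (simp add: agree_def)
next
  case (in_Imp1 A A' B)
  then have "ty_cong (subst_ty (tms \<xi>) (Imp A B)) (subst_ty (tms \<xi>) (Imp A' B))"
    by (intro ty_cong_subst ty_red_cong ty_red.intros env_wf_tms)
  then show ?case using in_Imp1 typed_cong by (simp add: impS_def)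
next
  case (in_Imp2 B B' A)
  then have "ty_cong (subst_ty (tms \<xi>) (Imp A B)) (subst_ty (tms \<xi>) (Imp A B'))"
    by (intro ty_cong_subst ty_red_cong ty_red.intros env_wf_tms)
  then show ?case using in_Imp2 typed_cong by (simp add: impS_def)
next
  case (in_Forall A A' \<sigma>)
  then have "ty_cong (subst_ty (tms \<xi>) (Forall \<sigma> A)) (subst_ty (tms \<xi>) (Forall \<sigma> A'))"
    by (intro ty_cong_subst ty_red_cong ty_red.intros env_wf_tms)
  moreover have "red (scons \<sigma> d \<xi>) A = red (scons \<sigma> d \<xi>) A'" if "d \<in> dens \<sigma>" for d
    using in_Forall env_wf_scons[OF _ that] by blast
  ultimately show ?case using typed_cong by (simp add: allS_def)
qed

lemma red_cong: "ty_cong A B \<Longrightarrow> env_wf \<xi> \<Longrightarrow> red \<xi> A = red \<xi> B"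
  unfolding ty_cong_def by (rule equivclp_invariant[of ty_red]) (auto simp: ty_red_red)

end

section \<open>Reducibility of tagged schemes\<close>

lemma red_TApp:
  assumes "t \<in> red \<Gamma> \<xi> (Forall \<sigma> A)" "has_sort a \<sigma>" "env_wf \<Gamma> \<xi>"
  shows "TApp t (subst_tm (tms \<xi>) a) \<in> red \<Gamma> \<xi> (subst_ty (inst \<sigma> a) A)"
proof -
  have "ev \<Gamma> \<xi> a \<in> dens \<Gamma> \<sigma>" using assms by (intro ev_red_cand)
  then have "TApp t (fst (ev \<Gamma> \<xi> a)) \<in> red \<Gamma> (scons \<sigma> (ev \<Gamma> \<xi> a) \<xi>) A"
    using assms(1) unfolding red.simps allS_def by blast
  then show ?thesis by (simp add: red_subst inst_eq esub_scons)
qed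

lemma red_App: "t \<in> red \<Gamma> \<xi> (Imp A B) \<Longrightarrow> u \<in> red \<Gamma> \<xi> A \<Longrightarrow> App t u \<in> red \<Gamma> \<xi> B"
  by (simp add: impS_def)

lemma red_typed: "t \<in> red \<Gamma> \<xi> A \<Longrightarrow> wf_ty A \<Longrightarrow> env_wf \<Gamma> \<xi> \<Longrightarrow> typed \<Gamma> t (subst_ty (tms \<xi>) A)"
  by (blast intro: candD ev_red_cand)

text \<open>Adequacy, by induction on the typing derivation. The types of \<Delta> have distinct
  tags, so their instances under \<open>tms \<xi>\<close> stay distinct and each variable finds its
  own value in \<open>l\<close>; as the types of \<Gamma> have no tag, none of these instances is
  protected by \<Gamma>.\<close>

lemma red_well_tagged:
  assumes "\<And>S. S |\<in>| \<Gamma> \<Longrightarrow> tag S = None"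
  shows "typed \<Delta> t A \<Longrightarrow> well_tagged \<Delta> t \<Longrightarrow> env_wf \<Gamma> \<xi> \<Longrightarrow> typed_env \<Gamma> l \<Longrightarrow>
    (\<And>S. S |\<in>| \<Delta> \<Longrightarrow> tag S \<noteq> None) \<Longrightarrow>
    (\<And>S T. S |\<in>| \<Delta> \<Longrightarrow> T |\<in>| \<Delta> \<Longrightarrow> tag S = tag T \<Longrightarrow> S = T) \<Longrightarrow>
    (\<And>T. T \<in> fst ` set l \<Longrightarrow> \<exists>S. S |\<in>| \<Delta> \<and> T = subst_ty (tms \<xi>) S) \<Longrightarrow>
    (\<And>S. S |\<in>| \<Delta> \<Longrightarrow> \<exists>u. map_of l (subst_ty (tms \<xi>) S) = Some u \<and> u \<in> red \<Gamma> \<xi> S) \<Longrightarrow>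
    ssubst \<Gamma> l (subst_sch (tms \<xi>) t) \<in> red \<Gamma> \<xi> A"
proof (induction arbitrary: \<xi> l rule: typed.induct)
  case (ty_V S \<Delta>)
  obtain i where "tag S = Some i" using ty_V by blast
  then have "subst_ty (tms \<xi>) S |\<notin>| \<Gamma>" using assms tag_subst by fastforce
  moreover obtain u where "map_of l (subst_ty (tms \<xi>) S) = Some u" "u \<in> red \<Gamma> \<xi> S"
    using ty_V by blast
  ultimately show ?case by simp
next
  case (ty_Lam A \<Delta> t B)
  note wf = env_wf_tms[OF ty_Lam.prems(2)]
  let ?\<theta> = "tms \<xi>"
  let ?L = "ssubst \<Gamma> l (subst_sch ?\<theta> (Lam A t))"
  have L: "typed \<Gamma> ?L (subst_ty ?\<theta> (Imp A B))"
  proof (rule typed_ssubst)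
    show "typed (subst_ty ?\<theta> |`| \<Delta>) (subst_sch ?\<theta> (Lam A t)) (subst_ty ?\<theta> (Imp A B))"
      using ty_Lam.hyps wf by (intro typed_subst typed.ty_Lam)
    show "S |\<in>| \<Gamma> \<or> S \<in> fst ` set l" if S: "S |\<in>| subst_ty ?\<theta> |`| \<Delta>" for S
    proof -
      obtain S' where "S' |\<in>| \<Delta>" "S = subst_ty ?\<theta> S'" using S by auto
      then show ?thesis using ty_Lam.prems(7)[of S'] by (force dest: map_of_SomeD)
    qed
  qed (rule ty_Lam.prems)
  have "App ?L u \<in> red \<Gamma> \<xi> B" if u: "u \<in> red \<Gamma> \<xi> A" for u
  proof (rule cand_expand)
    let ?l = "(subst_ty ?\<theta> A, u) # l"
    have ut: "typed \<Gamma> u (subst_ty ?\<theta> A)" using u ty_Lam.hyps(1) ty_Lam.prems(2) by (rule red_typed)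
    show "red \<Gamma> \<xi> B \<in> cand \<Gamma> (subst_ty ?\<theta> B)"
      using ty_Lam.hyps ty_Lam.prems by (intro ev_red_cand) (auto dest: typed_wf)
    show "typed \<Gamma> (App ?L u) (subst_ty ?\<theta> B)" using L ut by (auto intro: ty_App)
    \<comment> \<open>The abstraction is contracted; by \<open>msubst_ssubst\<close> the result is
      the body under the substitution extended by \<open>u\<close>.\<close>
    have "wred \<Gamma> (App ?L u) (msubst \<Gamma> (subst_ty ?\<theta> A) u
        (ssubst (finsert (subst_ty ?\<theta> A) \<Gamma>) l (subst_sch ?\<theta> t)))"
      by (simp add: wred_Lam)
    then show "(wred \<Gamma>)\<^sup>*\<^sup>* (App ?L u) (ssubst \<Gamma> ?l (subst_sch ?\<theta> t))"
      by (simp add: msubst_ssubst ty_Lam.prems(3) r_into_rtranclp)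
    obtain i where i: "tag A = Some i" using ty_Lam.prems(1) by auto
    have n: "tag S \<noteq> tag A" if "S |\<in>| \<Delta>" for S using ty_Lam.prems(1) that by auto
    show "ssubst \<Gamma> ?l (subst_sch ?\<theta> t) \<in> red \<Gamma> \<xi> B"
    proof (rule ty_Lam.IH)
      show "well_tagged (finsert A \<Delta>) t" using ty_Lam.prems(1) by simp
      show "env_wf \<Gamma> \<xi>" by (rule ty_Lam.prems)
      show "typed_env \<Gamma> ?l" using ut ty_Lam.prems(3) by (simp add: typed_env_Cons)
      show "tag S \<noteq> None" if "S |\<in>| finsert A \<Delta>" for S using that i ty_Lam.prems(4) by auto
      show "S = T" if "S |\<in>| finsert A \<Delta>" "T |\<in>| finsert A \<Delta>" "tag S = tag T" for S T
        using that n ty_Lam.prems(5) by (metis finsert_iff)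
      show "\<exists>S. S |\<in>| finsert A \<Delta> \<and> T = subst_ty ?\<theta> S" if "T \<in> fst ` set ?l" for T
        using that ty_Lam.prems(6) by fastforce
      show "\<exists>w. map_of ?l (subst_ty ?\<theta> S) = Some w \<and> w \<in> red \<Gamma> \<xi> S" if "S |\<in>| finsert A \<Delta>" for S
      proof (cases "S = A")
        \<comment> \<open>The instance of an older type differs in its tag from that of
          \<open>A\<close>, so the new entry does not hide the older value.\<close>
        case False
        then have S: "S |\<in>| \<Delta>" using that by simp
        then obtain j where "tag S = Some j" "j \<noteq> i" using ty_Lam.prems(4) n i by fastforce
        then have "subst_ty ?\<theta> S \<noteq> subst_ty ?\<theta> A" using i tag_subst by (metis option.inject)
        then show ?thesis using ty_Lam.prems(7)[OF S] by simp
      qed (simp add: u)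
    qed
  qed
  then show ?case using L by (simp add: impS_def)
next
  case (ty_App \<Delta> t A B u)
  have "ssubst \<Gamma> l (subst_sch (tms \<xi>) t) \<in> red \<Gamma> \<xi> (Imp A B)"
    using ty_App.prems by (intro ty_App.IH(1)) auto
  moreover have "ssubst \<Gamma> l (subst_sch (tms \<xi>) u) \<in> red \<Gamma> \<xi> A"
    using ty_App.prems by (intro ty_App.IH(2)) auto
  ultimately show ?case by (simp add: red_App del: red.simps)
next
  case (ty_TLam \<sigma> \<Delta> t A)
  note wf = env_wf_tms[OF ty_TLam.prems(2)]
  let ?\<theta> = "tms \<xi>"
  let ?L = "ssubst \<Gamma> l (subst_sch ?\<theta> (TLam \<sigma> t))"
  have L: "typed \<Gamma> ?L (subst_ty ?\<theta> (Forall \<sigma> A))"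
  proof (rule typed_ssubst)
    show "typed (subst_ty ?\<theta> |`| \<Delta>) (subst_sch ?\<theta> (TLam \<sigma> t)) (subst_ty ?\<theta> (Forall \<sigma> A))"
      using ty_TLam.hyps wf by (intro typed_subst typed.ty_TLam)
    show "S |\<in>| \<Gamma> \<or> S \<in> fst ` set l" if S: "S |\<in>| subst_ty ?\<theta> |`| \<Delta>" for S
    proof -
      obtain S' where "S' |\<in>| \<Delta>" "S = subst_ty ?\<theta> S'" using S by auto
      then show ?thesis using ty_TLam.prems(7)[of S'] by (force dest: map_of_SomeD)
    qed
  qed (rule ty_TLam.prems)
  have "TApp ?L (fst d) \<in> red \<Gamma> (scons \<sigma> d \<xi>) A" if d: "d \<in> dens \<Gamma> \<sigma>" for d
  proof (rule cand_expand)
    let ?\<xi> = "scons \<sigma> d \<xi>"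
    have wf': "env_wf \<Gamma> ?\<xi>" using ty_TLam.prems(2) d by (rule env_wf_scons)
    show "red \<Gamma> ?\<xi> A \<in> cand \<Gamma> (subst_ty (tms ?\<xi>) A)"
      using ty_TLam.hyps wf' by (intro ev_red_cand) (auto dest: typed_wf)
    show "typed \<Gamma> (TApp ?L (fst d)) (subst_ty (tms ?\<xi>) A)"
      using typed.ty_TApp[OF L[unfolded subst_ty.simps] dens_sort[OF d]] by simp
    let ?\<Delta> = "subst_ty (up \<sigma> ?\<theta>) |`| lift_ty \<sigma> |`| \<Delta>"
    have t: "tag (subst_ty (inst \<sigma> (fst d)) S) \<noteq> None" if S: "S |\<in>| ?\<Delta>" for S
    proof -
      obtain S' where S': "S' |\<in>| \<Delta>" "S = subst_ty (up \<sigma> ?\<theta>) (lift_ty \<sigma> S')" using S by auto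
      then have "\<exists>i. tag S' = Some i" using ty_TLam.prems(4) by blast
      then show ?thesis using tag_subst S' by fastforce
    qed
    \<comment> \<open>Contraction instantiates the bound variable after the substitution has acted.
      Moving the instantiation inside is the step that relies on the tags.\<close>
    have "subst_sch (inst \<sigma> (fst d)) (ssubst (lift_ty \<sigma> |`| \<Gamma>) (lift_env \<sigma> l) (subst_sch (up \<sigma> ?\<theta>) t)) =
      ssubst (subst_ty (inst \<sigma> (fst d)) |`| lift_ty \<sigma> |`| \<Gamma>)
        (map (map_prod (subst_ty (inst \<sigma> (fst d))) (subst_sch (inst \<sigma> (fst d)))) (lift_env \<sigma> l))
        (subst_sch (inst \<sigma> (fst d)) (subst_sch (up \<sigma> ?\<theta>) t))"
    proof (rule subst_ssubst[of ?\<Delta>])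
      show "well_tagged ?\<Delta> (subst_sch (up \<sigma> ?\<theta>) t)"
        using ty_TLam.prems(1,4) by (intro well_tagged_subst) auto
      show "tag S \<noteq> None" if "S |\<in>| ?\<Delta>" for S
      proof -
        obtain S' where "S' |\<in>| \<Delta>" "S = subst_ty (up \<sigma> ?\<theta>) (lift_ty \<sigma> S')"
          using \<open>S |\<in>| ?\<Delta>\<close> by auto
        then show ?thesis using ty_TLam.prems(4)[of S'] tag_subst[of S'] by auto
      qed
      show "tag (subst_ty (inst \<sigma> (fst d)) S) \<noteq> tag (subst_ty (inst \<sigma> (fst d)) T)"
        if "S |\<in>| ?\<Delta>" "T |\<in>| lift_ty \<sigma> |`| \<Gamma>" for S T
        using t[OF that(1)] assms that(2) by auto
      show "S = T" if S: "S |\<in>| ?\<Delta>" and T: "T \<in> fst ` set (lift_env \<sigma> l)"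
        and eq: "tag (subst_ty (inst \<sigma> (fst d)) S) = tag (subst_ty (inst \<sigma> (fst d)) T)" for S T
      proof -
        obtain S' where S': "S' |\<in>| \<Delta>" "S = subst_ty (up \<sigma> ?\<theta>) (lift_ty \<sigma> S')" using S by auto
        obtain T1 where T1: "T1 \<in> fst ` set l" "T = lift_ty \<sigma> T1" using T by (auto simp: image_image)
        then obtain T' where T': "T' |\<in>| \<Delta>" "T1 = subst_ty ?\<theta> T'" using ty_TLam.prems(6) by blast
        obtain i j where ij: "tag S' = Some i" "tag T' = Some j"
          using ty_TLam.prems(4) S'(1) T'(1) by blast
        have "tag (subst_ty (csub (inst \<sigma> (fst d)) (csub (up \<sigma> ?\<theta>) (shift \<sigma>))) S') = Some i"
          "tag (subst_ty (csub (inst \<sigma> (fst d)) (csub (shift \<sigma>) ?\<theta>)) T') = Some j"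
          using ij by (simp_all only: tag_subst)
        then have "i = j" using eq S' T' T1 by simp
        then have "S' = T'" using ty_TLam.prems(5) S' T' ij by metis
        then show ?thesis using S' T' T1 by simp
      qed
    qed
    \<comment> \<open>Instantiation cancels the lifting of \<Gamma> and \<open>l\<close>.\<close>
    also have "\<dots> = ssubst \<Gamma> l (subst_sch (tms ?\<xi>) t)"
      by (simp add: fset.map_comp comp_def map_prod_def case_prod_beta)
    finally have e: "subst_sch (inst \<sigma> (fst d))
      (ssubst (lift_ty \<sigma> |`| \<Gamma>) (lift_env \<sigma> l) (subst_sch (up \<sigma> ?\<theta>) t)) = ssubst \<Gamma> l (subst_sch (tms ?\<xi>) t)" .
    show "(wred \<Gamma>)\<^sup>*\<^sup>* (TApp ?L (fst d)) (ssubst \<Gamma> l (subst_sch (tms ?\<xi>) t))"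
      unfolding e[symmetric] subst_sch.simps ssubst.simps by (intro r_into_rtranclp wred_TLam)
    show "ssubst \<Gamma> l (subst_sch (tms ?\<xi>) t) \<in> red \<Gamma> ?\<xi> A"
    proof (rule ty_TLam.IH[OF _ wf' ty_TLam.prems(3)])
      show "well_tagged (lift_ty \<sigma> |`| \<Delta>) t" using ty_TLam.prems(1) by simp
      show "tag S \<noteq> None" if "S |\<in>| lift_ty \<sigma> |`| \<Delta>" for S using that ty_TLam.prems(4) by auto
      show "S = T" if "S |\<in>| lift_ty \<sigma> |`| \<Delta>" "T |\<in>| lift_ty \<sigma> |`| \<Delta>" "tag S = tag T" for S T
        using that ty_TLam.prems(5) by auto
      show "\<exists>S. S |\<in>| lift_ty \<sigma> |`| \<Delta> \<and> T = subst_ty (tms ?\<xi>) S" if T: "T \<in> fst ` set l" for T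
      proof -
        obtain S where "S |\<in>| \<Delta>" "T = subst_ty ?\<theta> S" using ty_TLam.prems(6)[OF T] by blast
        then show ?thesis by (intro exI[of _ "lift_ty \<sigma> S"]) simp
      qed
      show "\<exists>u. map_of l (subst_ty (tms ?\<xi>) S) = Some u \<and> u \<in> red \<Gamma> ?\<xi> S"
        if "S |\<in>| lift_ty \<sigma> |`| \<Delta>" for S
        using that ty_TLam.prems(7) by (auto simp: red_subst)
    qed
  qed
  then show ?case using L by (simp add: allS_def)
next
  case (ty_TApp \<Delta> t \<sigma> A a)
  have "ssubst \<Gamma> l (subst_sch (tms \<xi>) t) \<in> red \<Gamma> \<xi> (Forall \<sigma> A)"
    using ty_TApp.prems by (intro ty_TApp.IH) auto
  then show ?case
    using red_TApp[OF _ ty_TApp.hyps(2) ty_TApp.prems(2)] by simp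
next
  case (ty_conv \<Delta> t A B)
  have "ssubst \<Gamma> l (subst_sch (tms \<xi>) t) \<in> red \<Gamma> \<xi> A"
    using ty_conv.prems by (intro ty_conv.IH) auto
  then show ?case using red_cong[OF ty_conv.hyps(2) ty_conv.prems(2)] by simp
qed

lemma ssubst_Nil [simp]: "ssubst \<Gamma> [] t = t"
  by (induction t arbitrary: \<Gamma>) auto

lemma red_well_tagged_closed:
  assumes "\<And>S. S |\<in>| \<Gamma> \<Longrightarrow> tag S = None" "typed {||} t A" "well_tagged {||} t"
  shows "t \<in> red \<Gamma> (dflt \<Gamma>) A"
proof -
  have "ssubst \<Gamma> [] (subst_sch (tms (dflt \<Gamma>)) t) \<in> red \<Gamma> (dflt \<Gamma>) A"
    by (rule red_well_tagged[OF assms(1) assms(2,3) env_wf_dflt]) (auto simp: typed_env_def)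
  then show ?thesis by (simp add: tms_dflt)
qed

section \<open>Numerals\<close>

lemma has_sort_num [simp]: "has_sort (num n) Iota"
  by (induction n) auto

lemma subst_num [simp]: "subst_tm \<theta> (num n) = num n"
  by (induction n) auto

lemma nf_num [simp]: "nf (num n) = num n"
  by (induction n) auto

lemma fv_num [simp]: "fv_tm (num n) = {}"
  by (induction n) auto

lemma num_irreducible: "\<not> tm_red (num n) a"
proof (induction n arbitrary: a)
  case 0
  show ?case by (auto elim: tm_red.cases)
next
  case (Suc n)
  show ?case by (auto elim: tm_red.cases simp: Suc)
qed

lemma par_distinct [simp]: "par_zero b \<noteq> par_succ c" "par_succ c \<noteq> par_zero b"
  by (simp_all add: par_zero_def par_succ_def)

lemma wf_par [simp]: "has_sort c (Kappa 1) \<Longrightarrow> wf_ty (par_zero c)" "has_sort c (Kappa 1) \<Longrightarrow> wf_ty (par_succ c)"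
  by (simp_all add: par_zero_def par_succ_def has_sort_subst)

lemma typed_N_elim:
  assumes "typed \<Gamma> t (N m)" "has_sort m Iota" "has_sort c (Kappa 1)"
    and "typed \<Gamma> u (par_zero c)" "typed \<Gamma> v (par_succ c)"
  shows "typed \<Gamma> (App (App (TApp t c) u) v) (Eps [m] c)"
proof -
  have "typed \<Gamma> (TApp t c) (Imp (par_zero c) (Imp (par_succ c) (Eps [m] c)))"
    using ty_TApp[OF ty_conv[OF assms(1) N_cong[OF assms(2)]] assms(3)] subst_N_body[of c Var m]
    by (simp add: inst_eq)
  then show ?thesis using assms(4,5) by (intro ty_App[OF ty_App])
qed

lemma typed_rho: "typed \<Gamma> (rho n) (N (num n))"
proof (rule typed_weaken)
  let ?c = "Var (Kappa 1) 0"
  let ?\<Delta> = "{|par_succ ?c, par_zero ?c|}"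
  have N: "ty_cong (Forall (Kappa 1) (Imp (par_zero ?c) (Imp (par_succ ?c) (Eps [num n] ?c)))) (N (num n))" for n
    using N_cong[of "num n"] by (simp add: N_body_def ty_cong_sym)
  show "typed {||} (rho n) (N (num n))"
  proof (induction n)
    case 0
    have "typed ?\<Delta> (V (par_zero ?c)) (Eps [num 0] ?c)"
      using ty_V[of "par_zero ?c" ?\<Delta>] by (simp add: par_zero_def)
    then show ?case unfolding rho.simps Let_def
      by (intro ty_conv[OF _ N] ty_TLam ty_Lam, unfold fimage_fempty) simp_all
  next
    case (Suc n)
    have z: "typed ?\<Delta> (V (par_zero ?c)) (par_zero ?c)" and s: "typed ?\<Delta> (V (par_succ ?c)) (par_succ ?c)"
      by (auto intro!: ty_V)
    have r: "typed ?\<Delta> (rho n) (N (num n))" by (rule typed_weaken[OF Suc.IH]) simp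
    have "typed ?\<Delta> (App (App (TApp (rho n) ?c) (V (par_zero ?c))) (V (par_succ ?c))) (Eps [num n] ?c)"
      by (rule typed_N_elim[OF r _ _ z s]) simp_all
    then have "typed ?\<Delta> (App (App (TApp (V (par_succ ?c)) (num n)) (rho n))
        (App (App (TApp (rho n) ?c) (V (par_zero ?c))) (V (par_succ ?c)))) (Eps [num (Suc n)] ?c)"
      using ty_App[OF typed_par_succ[OF s] r] by (auto intro: ty_App)
    then show ?case unfolding rho.simps Let_def
      by (intro ty_conv[OF _ N] ty_TLam ty_Lam, unfold fimage_fempty) simp_all
  qed
qed simp

lemma subst_rho [simp]: "subst_sch \<theta> (rho n) = rho n"
  by (induction n arbitrary: \<theta>) (simp_all add: Let_def up_eq)

lemma msubst_rho [simp]: "msubst \<Gamma> A u (rho n) = rho n"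
  by (rule msubst_closed[OF typed_rho[of "{||}"]]) simp

text \<open>The three head steps common to all numerals. The substitution of \<open>u\<close> takes
  place below the binder of type \<open>par_succ c\<close>, hence in the extended context.\<close>

lemma wred_rho_redex:
  "(wred \<Gamma>)\<^sup>*\<^sup>* (App (App (TApp (TLam (Kappa 1) (Lam (par_zero (Var (Kappa 1) 0))
      (Lam (par_succ (Var (Kappa 1) 0)) b))) c) u) v)
    (msubst \<Gamma> (par_succ c) v (msubst (finsert (par_succ c) \<Gamma>) (par_zero c) u (subst_sch (inst (Kappa 1) c) b)))"
proof -
  let ?b = "subst_sch (inst (Kappa 1) c) b"
  let ?t = "TLam (Kappa 1) (Lam (par_zero (Var (Kappa 1) 0)) (Lam (par_succ (Var (Kappa 1) 0)) b))"
  have "wred \<Gamma> (TApp ?t c) (Lam (par_zero c) (Lam (par_succ c) ?b))"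
    using wred_TLam[of \<Gamma> "Kappa 1" "Lam (par_zero (Var (Kappa 1) 0)) (Lam (par_succ (Var (Kappa 1) 0)) b)" c]
    by (simp add: inst_eq)
  then have "wred \<Gamma> (App (App (TApp ?t c) u) v) (App (App (Lam (par_zero c) (Lam (par_succ c) ?b)) u) v)"
    by (intro wred_App)
  moreover have "wred \<Gamma> (App (App (Lam (par_zero c) (Lam (par_succ c) ?b)) u) v)
      (App (Lam (par_succ c) (msubst (finsert (par_succ c) \<Gamma>) (par_zero c) u ?b)) v)"
    using wred_App[OF wred_Lam[of \<Gamma> "par_zero c" "Lam (par_succ c) ?b" u]] by simp
  moreover have "wred \<Gamma> (App (Lam (par_succ c) (msubst (finsert (par_succ c) \<Gamma>) (par_zero c) u ?b)) v)
      (msubst \<Gamma> (par_succ c) v (msubst (finsert (par_succ c) \<Gamma>) (par_zero c) u ?b))"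
    by (rule wred_Lam)
  ultimately show ?thesis by (meson converse_rtranclp_into_rtranclp rtranclp.rtrancl_refl)
qed

text \<open>The abstractions of a numeral are untagged, so adequacy does not cover it and its
  reductions are followed directly. The assumptions on \<Gamma> ensure that the minimal
  substitutions replace both variables.\<close>

lemma rho_red:
  assumes \<Gamma>: "\<And>c. par_zero c |\<notin>| \<Gamma>" "\<And>c. par_succ c |\<notin>| \<Gamma>"
  shows "rho n \<in> natS \<Gamma> (num n)"
proof (induction n)
  case 0
  show ?case
    unfolding natS_natF[of \<Gamma> "num 0"] natF_def mem_Collect_eq
  proof (intro conjI typed_rho ballI allI impI)
    fix d u v
    assume d: "d \<in> dens \<Gamma> (Kappa 1)" and u: "u \<in> snd d [Zero]" and v: "typed \<Gamma> v (par_succ (fst d))"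
    let ?c = "fst d"
    have ut: "typed \<Gamma> u (par_zero ?c)"
      using candD[OF dens_cand[OF d, of "[Zero]"] u] by (simp add: par_zero_def)
    have "(wred \<Gamma>)\<^sup>*\<^sup>* (App (App (TApp (rho 0) ?c) u) v) u"
      using wred_rho_redex[of \<Gamma> "V (par_zero (Var (Kappa 1) 0))" ?c u v] \<Gamma> msubst_closed[OF ut]
      by (simp add: Let_def inst_eq)
    moreover have "typed \<Gamma> (App (App (TApp (rho 0) ?c) u) v) (Eps [num 0] ?c)"
      by (rule typed_N_elim[OF typed_rho has_sort_num dens_sort[OF d] ut v])
    ultimately show "App (App (TApp (rho 0) ?c) u) v \<in> snd d [num 0]"
      using dens_cand1[OF d, of "num 0"] u by (auto intro: cand_expand)
  qed
next
  case (Suc n)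
  show ?case
    unfolding natS_natF[of \<Gamma> "num (Suc n)"] natF_def mem_Collect_eq
  proof (intro conjI typed_rho ballI allI impI)
    fix d u v
    assume d: "d \<in> dens \<Gamma> (Kappa 1)" and u: "u \<in> snd d [Zero]" and v: "typed \<Gamma> v (par_succ (fst d))"
      and s: "\<forall>m w z. has_sort m Iota \<longrightarrow> w \<in> natS \<Gamma> (nf m) \<longrightarrow> z \<in> snd d [nf m] \<longrightarrow>
        App (App (TApp v m) w) z \<in> snd d [Succ (nf m)]"
    let ?c = "fst d" and ?x = "Var (Kappa 1) 0"
    have ut: "typed \<Gamma> u (par_zero ?c)"
      using candD[OF dens_cand[OF d, of "[Zero]"] u] by (simp add: par_zero_def)
    let ?z = "App (App (TApp (rho n) ?c) u) v"
    \<comment> \<open>The recursive argument passed to \<open>v\<close>; the induction hypothesis is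
      used at the same \<open>d\<close>, \<open>u\<close> and \<open>v\<close>.\<close>
    have "?z \<in> snd d [num n]"
      using Suc.IH[unfolded natS_natF[of \<Gamma> "num n"] natF_def mem_Collect_eq] d u v s by blast
    then have r: "App (App (TApp v (num n)) (rho n)) ?z \<in> snd d [num (Suc n)]"
      using s[rule_format, of "num n" "rho n" ?z] Suc.IH by simp
    have "(wred \<Gamma>)\<^sup>*\<^sup>* (App (App (TApp (rho (Suc n)) ?c) u) v) (App (App (TApp v (num n)) (rho n)) ?z)"
      using wred_rho_redex[of \<Gamma> "App (App (TApp (V (par_succ ?x)) (num n)) (rho n))
          (App (App (TApp (rho n) ?x) (V (par_zero ?x))) (V (par_succ ?x)))" ?c u v] \<Gamma>
        msubst_closed[OF ut]
      by (simp add: Let_def inst_eq)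
    moreover have "typed \<Gamma> (App (App (TApp (rho (Suc n)) ?c) u) v) (Eps [num (Suc n)] ?c)"
      by (rule typed_N_elim[OF typed_rho has_sort_num dens_sort[OF d] ut v])
    ultimately show "App (App (TApp (rho (Suc n)) ?c) u) v \<in> snd d [num (Suc n)]"
      using dens_cand1[OF d, of "num (Suc n)"] r by (auto intro: cand_expand)
  qed
qed

section \<open>Existence of witnesses\<close>

lemma subst_to_eps:
  "subst_ty \<theta> (to_eps \<sigma> B c) = to_eps \<sigma> (subst_ty (up \<sigma> \<theta>) B) (subst_tm \<theta> c)"
  by (simp add: to_eps_def)

lemma has_sort_shift [simp]: "has_sort (shift \<sigma> \<tau> i) \<rho> \<longleftrightarrow> \<rho> = \<tau>"
  by (simp add: shift_def)

lemma wf_to_eps [simp]: "wf_ty (to_eps \<sigma> B c) \<longleftrightarrow> wf_ty B \<and> has_sort (lift_tm \<sigma> c) (Kappa 0)"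
  by (simp add: to_eps_def)

lemma wf_Exists: "wf_ty B \<Longrightarrow> wf_ty (Exists \<sigma> B)"
  by (simp add: Exists_def wf_ty_subst)

text \<open>The variable \<open>c\<close> is interpreted by the schemes that reduce to a witness.\<close>

lemma red_Exists_witness:
  fixes c :: tm and B :: ty
  defines "G \<equiv> to_eps Iota B c"
  assumes s: "s \<in> red {|G|} (dflt {|G|}) (Exists Iota B)" and B: "wf_ty B" and c: "c = Var (Kappa 0) k"
  shows "\<exists>a u. (wred {|G|})\<^sup>*\<^sup>* (App (TApp s c) (V G)) (App (TApp (V G) a) u) \<and>
    has_sort a Iota \<and> typed {|G|} u (subst_ty (inst Iota a) B)"
proof -
  let ?\<Gamma> = "{|G|}"
  let ?P = "\<lambda>t. \<exists>a u. (wred ?\<Gamma>)\<^sup>*\<^sup>* t (App (TApp (V G) a) u) \<and>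
    has_sort a Iota \<and> typed ?\<Gamma> u (subst_ty (inst Iota a) B)"
  \<comment> \<open>Closed under expansion by construction, since \<open>?P\<close> is stated
    through reduction sequences.\<close>
  let ?W = "{t. typed ?\<Gamma> t (Eps [] c) \<and> ?P t}"
  let ?d = "(c, \<lambda>_::tm list. ?W)"
  let ?B = "subst_ty (up Iota (shift (Kappa 0))) B"
  let ?\<xi> = "scons (Kappa 0) ?d (dflt ?\<Gamma>)"
  have "?W \<in> cand ?\<Gamma> (Eps [] c)"
    unfolding cand_def by (auto intro: rtranclp_trans)
  then have d: "?d \<in> dens ?\<Gamma> (Kappa 0)"
    by (simp add: dens_def c)
  then have wf: "env_wf ?\<Gamma> ?\<xi>" by (intro env_wf_scons env_wf_dflt)
  have t: "TApp s c \<in> red ?\<Gamma> ?\<xi> (Imp (to_eps Iota ?B (Var (Kappa 0) 0)) (Eps [] (Var (Kappa 0) 0)))"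
    using s d unfolding Exists_def red.simps(6) allS_def by force
  have wB: "wf_ty ?B" using B by (simp add: wf_ty_subst)
  have wG: "wf_ty G" using B c by (simp add: G_def)
  \<comment> \<open>No reduction is involved: applied to a term and a scheme, \<open>V G\<close>
    already has the required form, and from the reducibility of the scheme only its typing is
    retained.\<close>
  have "V G \<in> red ?\<Gamma> ?\<xi> (to_eps Iota ?B (Var (Kappa 0) 0))"
    unfolding to_eps_def red.simps(6) allS_def mem_Collect_eq ball_dens_Iota
  proof (intro conjI allI impI)
    have tG: "typed ?\<Gamma> (V G) G" using wG by (intro ty_V) auto
    moreover have "subst_ty (tms ?\<xi>) (to_eps Iota ?B (Var (Kappa 0) 0)) = G"
      unfolding subst_to_eps by (simp add: G_def tms_dflt up_eq)
    ultimately show "typed ?\<Gamma> (V G) (subst_ty (tms ?\<xi>)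
        (Forall Iota (Imp ?B (Eps [] (lift_tm Iota (Var (Kappa 0) 0))))))"
      by (simp only: to_eps_def)
    fix a assume a: "has_sort a Iota"
    let ?\<zeta> = "scons Iota (iota a) ?\<xi>"
    have wf': "env_wf ?\<Gamma> ?\<zeta>" by (rule env_wf_scons[OF wf]) (simp add: iota_dens a)
    have z: "tms ?\<zeta> = scons Iota a (scons (Kappa 0) c Var)"
      by (simp add: tms_dflt iota_def)
    have ty: "typed ?\<Gamma> (TApp (V G) a) (Imp (subst_ty (inst Iota a) B) (Eps [] c))"
      using ty_TApp[OF tG[unfolded G_def to_eps_def] a] by (simp add: G_def to_eps_def)
    have sB: "subst_ty (tms ?\<zeta>) ?B = subst_ty (inst Iota a) B"
      by (simp add: inst_eq up_eq tms_dflt iota_def)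
    have "TApp (V G) a \<in> red ?\<Gamma> ?\<zeta> (Imp ?B (Eps [] (Var (Kappa 0) 0)))"
      unfolding red.simps(5) impS_def mem_Collect_eq
    proof (intro conjI ballI)
      show "typed ?\<Gamma> (TApp (V G) a) (subst_ty (tms ?\<zeta>) (Imp ?B (Eps [] (Var (Kappa 0) 0))))"
        using ty sB by (simp add: z)
      fix u assume "u \<in> red ?\<Gamma> ?\<zeta> ?B"
      then have u: "typed ?\<Gamma> u (subst_ty (inst Iota a) B)"
        using red_typed[OF _ wB wf'] sB by simp
      then have "App (TApp (V G) a) u \<in> ?W" using ty a by (auto intro: ty_App)
      then show "App (TApp (V G) a) u \<in> red ?\<Gamma> ?\<zeta> (Eps [] (Var (Kappa 0) 0))" by simp
    qed
    then show "TApp (V G) (fst (iota a)) \<in> red ?\<Gamma> ?\<zeta> (Imp ?B (Eps [] (lift_tm Iota (Var (Kappa 0) 0))))"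
      by (simp add: iota_def)
  qed
  then have "App (TApp s c) (V G) \<in> red ?\<Gamma> ?\<xi> (Eps [] (Var (Kappa 0) 0))"
    using t by (rule red_App[rotated])
  then show ?thesis by simp
qed

section \<open>Provability of the instances at a witness\<close>

text \<open>A code of a provable type. Put for \<open>c\<close>, it makes the hypothesis
  \<open>to_eps Iota B c\<close> provable for every well-formed \<open>B\<close>.\<close>

definition e_true :: tm where
  "e_true = Comp [] [] (Forall (Kappa 0) null_body) []"

lemma has_sort_e_true [simp]: "has_sort e_true (Kappa 0)"
  by (auto simp: e_true_def has_sort_Comp null_body_def)

lemma subst_e_true [simp]: "subst_tm \<theta> e_true = e_true"
  by (simp add: e_true_def)

lemma e_true_cong: "ty_cong (Forall (Kappa 0) null_body) (Eps [] e_true)"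
proof -
  have "ty_red (Eps [] e_true)
      (subst_ty (subst_of (zip (keys [] []) ([] @ []))) (Forall (Kappa 0) null_body))"
    unfolding e_true_def by (rule red_Comp) (use has_sort_e_true in \<open>simp_all add: e_true_def\<close>)
  moreover have "subst_of (zip (keys [] []) ([] @ [])) = Var"
    by (simp add: subst_of_def fun_eq_iff)
  ultimately show ?thesis by (simp add: ty_red_cong ty_cong_sym)
qed

lemma typed_to_eps_e_true:
  assumes "wf_ty B"
  shows "\<exists>t. typed {||} t (to_eps Iota B e_true)"
proof -
  let ?v = "Eps [] (Var (Kappa 0) 0)"
  have "typed \<Gamma> (TLam (Kappa 0) (Lam ?v (V ?v))) (Eps [] e_true)" for \<Gamma>
    by (rule ty_conv[OF _ e_true_cong]) (auto simp: null_body_def intro!: ty_TLam ty_Lam ty_V)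
  then show ?thesis
    using assms by (auto simp: to_eps_def intro!: ty_TLam ty_Lam)
qed

lemma provable_cong: "ty_cong A B \<Longrightarrow> provable A \<Longrightarrow> provable B"
  unfolding provable_def by (blast intro: ty_conv)

text \<open>Second projection: the variable quantified in the conjunction is instantiated with a
  code of \<open>B\<close>.\<close>

lemma provable_Conj2:
  assumes "provable (Conj A B)" "wf_ty A" "wf_ty B"
  shows "provable B"
proof -
  obtain t where t: "typed {||} t (Conj A B)" using assms(1) unfolding provable_def by blast
  obtain b where b: "has_sort b (Kappa 0)" "ty_cong (Eps [] b) B" using ex_eps_cong[OF assms(3)] by blast
  have "typed {||} (TApp t b) (Imp (Imp A (Imp B (Eps [] b))) (Eps [] b))"
    using ty_TApp[OF t[unfolded Conj_def] b(1)] by (simp add: inst_eq)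
  moreover have "typed {||} (Lam A (Lam B (V B))) (Imp A (Imp B (Eps [] b)))"
    by (rule ty_conv[of _ _ "Imp A (Imp B B)"])
      (auto intro!: ty_Lam ty_V assms ty_cong_Imp ty_cong_refl ty_cong_sym[OF b(2)])
  ultimately have "typed {||} (App (TApp t b) (Lam A (Lam B (V B)))) (Eps [] b)" by (rule ty_App)
  then show ?thesis using b(2) unfolding provable_def by (blast intro: ty_conv)
qed

text \<open>Evaluation at the constant assignment \<open>m\<close>; truncated subtraction matches
  the rule for \<open>Pred Zero\<close>.\<close>

fun val :: "nat \<Rightarrow> tm \<Rightarrow> nat" where
  "val m (Var \<sigma> i) = m"
| "val m Zero = 0"
| "val m (Succ a) = Suc (val m a)"
| "val m (Pred a) = val m a - 1"
| "val m (Comp xs ys A bs) = 0"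

lemma nf_val: "has_sort a Iota \<Longrightarrow> (\<And>i. \<theta> Iota i = num m) \<Longrightarrow> nf (subst_tm \<theta> a) = num (val m a)"
proof (induction a)
  case (Pred a)
  then show ?case by (cases "val m a") auto
qed (auto simp: has_sort_Comp)

text \<open>A number term is built by \<open>Succ\<close> and \<open>Pred\<close> from zero or from
  one variable. Over zero it normalises to a numeral; over a variable its value has slope 1 once
  \<open>m\<close> is so large that no predecessor is truncated.\<close>

lemma val_nonconstant:
  "has_sort a Iota \<Longrightarrow> (\<exists>q. nf a = num q) \<or> (\<exists>M. \<forall>m\<ge>M. val (Suc m) a = Suc (val m a))"
proof (induction a)
  case Zero
  show ?case by (auto intro: exI[of _ 0])
next
  case (Succ a)
  then have "(\<exists>q. nf a = num q) \<or> (\<exists>M. \<forall>m\<ge>M. val (Suc m) a = Suc (val m a))" by simp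
  then show ?case
  proof
    assume "\<exists>q. nf a = num q"
    then obtain q where "nf (Succ a) = num (Suc q)" by auto
    then show ?thesis by blast
  qed auto
next
  case (Pred a)
  then have "(\<exists>q. nf a = num q) \<or> (\<exists>M. \<forall>m\<ge>M. val (Suc m) a = Suc (val m a))" by simp
  then show ?case
  proof
    assume "\<exists>q. nf a = num q"
    then obtain q where q: "nf a = num q" by blast
    have "nf (Pred a) = num (q - 1)" using q by (cases q) auto
    then show ?thesis by blast
  next
    assume "\<exists>M. \<forall>m\<ge>M. val (Suc m) a = Suc (val m a)"
    then obtain M where M: "\<forall>m\<ge>M. val (Suc m) a = Suc (val m a)" by blast
    \<comment> \<open>From \<open>Suc M\<close> on the value of \<open>a\<close> is positive, so
      that the predecessor subtracts exactly one.\<close>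
    have "val (Suc m) (Pred a) = Suc (val m (Pred a))" if m: "m \<ge> Suc M" for m
    proof -
      obtain m' where "m = Suc m'" "m' \<ge> M" using m by (cases m) auto
      then show ?thesis using M by simp
    qed
    then show ?thesis by blast
  qed
qed (auto simp: has_sort_Comp)

text \<open>A constant value excludes positive slope, so \<open>a\<close> normalises to some
  numeral; evaluation at 0 determines which.\<close>

lemma nf_eq_num:
  assumes "has_sort a Iota" "\<And>m. val m a = q"
  shows "nf a = num q"
proof -
  obtain q' where q': "nf a = num q'"
    using val_nonconstant[OF assms(1)] assms(2) by force
  let ?\<theta> = "\<lambda>\<sigma> i. if \<sigma> = Iota then num 0 else Var \<sigma> i"
  have "tm_eq (subst_tm ?\<theta> a) (subst_tm ?\<theta> (num q'))"
    using tm_eq_nf[OF assms(1)] q' by (intro tm_eq_subst) (auto simp: wsub_def)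
  then have "num (val 0 a) = num q'" using nf_eq nf_val[OF assms(1), of ?\<theta> 0] by fastforce
  then show ?thesis using assms(2) q' by simp
qed

lemma inst_abs_var: "subst_ty (inst \<sigma> a) (abs_var \<sigma> x A) = subst_ty (subst_of [((\<sigma>, x), a)]) A"
  unfolding abs_var_def subst_subst_ty
  by (rule arg_cong[of _ _ "\<lambda>\<theta>. subst_ty \<theta> A"]) (auto simp: fun_eq_iff csub_def inst_eq subst_of_def)

lemma subst_Conj: "subst_ty \<theta> (Conj A B) = Conj (subst_ty \<theta> A) (subst_ty \<theta> B)"
  by (simp add: Conj_def up_eq)

lemma wf_Conj: "wf_ty (Conj A B) \<longleftrightarrow> wf_ty (lift_ty (Kappa 0) A) \<and> wf_ty (lift_ty (Kappa 0) B)"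
  by (auto simp: Conj_def)

lemma wf_abs_var: "wf_ty A \<Longrightarrow> wf_ty (abs_var \<sigma> x A)"
  unfolding abs_var_def by (rule wf_ty_subst) (auto simp: wsub_def)

lemma wf_total_body: "wf_ty A \<Longrightarrow> wf_ty (total_body y A)"
  unfolding total_body_def by (rule wf_abs_var) (simp add: wf_Conj wf_ty_subst)

lemma fv_ty_substD: "v \<in> fv_ty (subst_ty \<theta> A) \<Longrightarrow> \<exists>\<sigma> i. (\<sigma>, i) \<in> fv_ty A \<and> v \<in> fv_tm (\<theta> \<sigma> i)"
  using fv_ty_subst by blast

lemma fv_total_body:
  assumes "fv_ty A \<subseteq> {(Iota, y)}"
  shows "fv_ty (total_body y A) \<subseteq> {(Iota, 0)}"
proof -
  have "fv_ty (lift_ty (Kappa 0) A) \<subseteq> {(Iota, y)}"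
    by (auto dest!: fv_ty_substD subsetD[OF assms])
  then have "fv_ty (Conj (N (Var Iota y)) A) \<subseteq> {(Iota, y)}"
    by (auto simp: Conj_def split: if_splits)
  then show ?thesis
    unfolding total_body_def abs_var_def by (auto dest!: fv_ty_substD)
qed

lemma fv_Exists:
  assumes "fv_ty B \<subseteq> {(Iota, 0)}"
  shows "fv_ty (Exists Iota B) = {}"
proof -
  have "fv_ty (subst_ty (up Iota (shift (Kappa 0))) B) \<subseteq> {(Iota, 0)}"
    by (auto dest!: fv_ty_substD subsetD[OF assms] simp: up_def)
  then show ?thesis by (auto simp: Exists_def to_eps_def split: if_splits)
qed

text \<open>A substitution turns the typing of \<open>u\<close> into a proof in the empty context:
  the variables of sort \<open>Kappa 0\<close> become \<open>e_true\<close>, so that the hypothesis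
  is provable and can be discharged, and all number variables become the numeral of
  \<open>m\<close>, so that \<open>a\<close> becomes congruent to the numeral of its value.\<close>

lemma witness_instance_provable:
  assumes A: "wf_ty A" "fv_ty A \<subseteq> {(Iota, y)}" and a: "has_sort a Iota"
    and u: "typed {|to_eps Iota (total_body y A) (Var (Kappa 0) k)|} u (subst_ty (inst Iota a) (total_body y A))"
  shows "provable (subst_ty (subst_of [((Iota, y), num (val m a))]) A)"
proof -
  let ?\<theta> = "\<lambda>\<sigma> i. if \<sigma> = Iota then num m else if \<sigma> = Kappa 0 then e_true else Var \<sigma> i"
  let ?B = "total_body y A"
  have \<theta>: "wsub ?\<theta>" by (simp add: wsub_def)
  let ?a = "subst_tm ?\<theta> a"
  have sa: "has_sort ?a Iota" by (rule has_sort_subst[OF \<theta> a])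
  \<comment> \<open>The only possible free variable of \<open>?B\<close> is the one bound by the
    quantifier, which the lifted substitution fixes.\<close>
  have "subst_ty (up Iota ?\<theta>) ?B = subst_ty Var ?B"
    using fv_total_body[OF A(2)] by (intro subst_ty_cong_fv) (auto simp: up_def)
  then have G: "subst_ty ?\<theta> (to_eps Iota ?B (Var (Kappa 0) k)) = to_eps Iota ?B e_true"
    by (simp add: subst_to_eps)
  have "subst_ty ?\<theta> (subst_ty (inst Iota a) ?B) = subst_ty (inst Iota ?a) (subst_ty (up Iota ?\<theta>) ?B)"
    by simp
  also have "\<dots> = subst_ty (inst Iota ?a) ?B"
    using \<open>subst_ty (up Iota ?\<theta>) ?B = subst_ty Var ?B\<close> by (simp only: subst_ty_Var)
  also have "\<dots> = Conj (N ?a) (subst_ty (subst_of [((Iota, y), ?a)]) A)"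
    unfolding total_body_def inst_abs_var subst_Conj by (simp add: subst_of_def)
  finally have "typed {|to_eps Iota ?B e_true|} (subst_sch ?\<theta> u) (Conj (N ?a) (subst_ty (subst_of [((Iota, y), ?a)]) A))"
    using typed_subst[OF u \<theta>] G by simp
  then have "typed {||} (Lam (to_eps Iota ?B e_true) (subst_sch ?\<theta> u))
      (Imp (to_eps Iota ?B e_true) (Conj (N ?a) (subst_ty (subst_of [((Iota, y), ?a)]) A)))"
    using wf_total_body[OF A(1)] by (intro ty_Lam) simp_all
  then have "provable (Conj (N ?a) (subst_ty (subst_of [((Iota, y), ?a)]) A))"
    unfolding provable_def using typed_to_eps_e_true[OF wf_total_body[OF A(1)]] ty_App by blast
  then have "provable (subst_ty (subst_of [((Iota, y), ?a)]) A)"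
    by (rule provable_Conj2) (auto simp: sa wsub_def subst_of_def intro!: wf_ty_subst A(1))
  moreover have "ty_cong (subst_ty (subst_of [((Iota, y), ?a)]) A)
      (subst_ty (subst_of [((Iota, y), num (val m a))]) A)"
    using tm_eq_nf[OF sa] nf_val[OF a, of ?\<theta> m]
    by (intro ty_cong_subst_cong) (auto simp: subst_of_def)
  ultimately show ?thesis by (rule provable_cong[rotated])
qed

section \<open>Application to numerals\<close>

lemma subst_abs_var:
  assumes "\<And>\<tau> i. subst_tm (up \<sigma> \<theta>) ((if \<tau> = \<sigma> then (if i = z then Var \<sigma> 0 else Var \<sigma> (Suc i)) else Var \<tau> i)) =
    subst_tm (\<lambda>\<tau> i. if \<tau> = \<sigma> then (if i = z then Var \<sigma> 0 else Var \<sigma> (Suc i)) else Var \<tau> i) (\<theta> \<tau> i)"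
  shows "subst_ty (up \<sigma> \<theta>) (abs_var \<sigma> z A) = abs_var \<sigma> z (subst_ty \<theta> A)"
  unfolding abs_var_def subst_subst_ty
  by (rule arg_cong[of _ _ "\<lambda>\<theta>. subst_ty \<theta> A"]) (simp add: fun_eq_iff csub_def assms)

text \<open>A numeral is closed and \<open>z\<close> is not replaced, so binding \<open>z\<close>
  commutes with the substitution.\<close>

lemma subst_num_abs_var:
  assumes "z \<noteq> x"
  shows "subst_ty (up Iota (subst_of [((Iota, x), num p)])) (abs_var Iota z A) =
    abs_var Iota z (subst_ty (subst_of [((Iota, x), num p)]) A)"
  by (rule subst_abs_var) (use assms in \<open>auto simp: up_def subst_of_def\<close>)

lemma subst_Exists: "subst_ty \<theta> (Exists \<sigma> B) = Exists \<sigma> (subst_ty (up \<sigma> \<theta>) B)"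
  by (simp add: Exists_def subst_to_eps) (simp add: up_eq)

lemma subst_total_type:
  assumes "x \<notin> set (xs @ [y])"
  shows "subst_ty (subst_of [((Iota, x), num p)]) (total_type xs y A) =
    total_type xs y (subst_ty (subst_of [((Iota, x), num p)]) A)"
  using assms
proof (induction xs)
  case Nil
  then show ?case
    by (simp add: total_type_def subst_Exists total_body_def subst_num_abs_var subst_Conj) (simp add: subst_of_def)
next
  case (Cons z xs)
  then have "subst_ty (subst_of [((Iota, x), num p)]) (total_type xs y A) =
    total_type xs y (subst_ty (subst_of [((Iota, x), num p)]) A)" by simp
  then show ?case using Cons.prems
    by (simp add: total_type_def subst_num_abs_var) (simp add: subst_of_def)
qed

lemma inst_nums_Cons:
  assumes "x \<notin> set xs"
  shows "inst_nums xs ps (subst_ty (subst_of [((Iota, x), num p)]) A) = inst_nums (x # xs) (p # ps) A"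
  unfolding inst_nums_def subst_subst_ty
  by (rule arg_cong[of _ _ "\<lambda>\<theta>. subst_ty \<theta> A"]) (auto simp: fun_eq_iff csub_def subst_of_def)

lemma inst_nums_Nil [simp]: "inst_nums [] [] A = A"
  unfolding inst_nums_def by (simp add: subst_of_def[abs_def])

lemma inst_nums_snoc:
  fixes ps :: "nat list"
  assumes "distinct (xs @ [y])" "length xs = length ps"
  shows "inst_nums (xs @ [y]) (ps @ [q]) A = subst_ty (subst_of [((Iota, y), num q)]) (inst_nums xs ps A)"
  using assms(2,1)
proof (induction xs ps arbitrary: A rule: list_induct2)
  case Nil
  show ?case unfolding inst_nums_Nil append_Nil by (simp add: inst_nums_def)
next
  case (Cons x xs p ps)
  then show ?case by (simp add: inst_nums_Cons[symmetric])
qed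

text \<open>Typing in the empty context, which the extraction demands, and reducibility in \<Gamma>,
  which yields the witness, are carried along together. Each argument uses the instance at the
  numeral and the reducibility of its \<open>rho\<close>.\<close>

lemma red_app_nums:
  fixes ps :: "nat list"
  assumes \<Gamma>: "\<And>c. par_zero c |\<notin>| \<Gamma>" "\<And>c. par_succ c |\<notin>| \<Gamma>"
  shows "length xs = length ps \<Longrightarrow> distinct (xs @ [y]) \<Longrightarrow> typed {||} t (total_type xs y A) \<Longrightarrow>
    t \<in> red \<Gamma> (dflt \<Gamma>) (total_type xs y A) \<Longrightarrow>
    typed {||} (app_nums t ps) (Exists Iota (total_body y (inst_nums xs ps A))) \<and>
    app_nums t ps \<in> red \<Gamma> (dflt \<Gamma>) (Exists Iota (total_body y (inst_nums xs ps A)))"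
proof (induction xs ps arbitrary: t A rule: list_induct2)
  case Nil
  show ?case using Nil by (simp add: total_type_def app_nums_def del: red.simps)
next
  case (Cons x xs p ps)
  let ?\<theta> = "subst_of [((Iota, x), num p)]"
  let ?C = "total_type xs y (subst_ty ?\<theta> A)"
  let ?t = "App (TApp t (num p)) (rho p)"
  have x: "x \<notin> set xs" using Cons.prems(1) by simp
  have T: "total_type (x # xs) y A = Forall Iota (abs_var Iota x (Imp (N (Var Iota x)) (total_type xs y A)))"
    by (simp add: total_type_def)
  have i: "subst_ty (inst Iota (num p)) (abs_var Iota x (Imp (N (Var Iota x)) (total_type xs y A))) = Imp (N (num p)) ?C"
    unfolding inst_abs_var using Cons.prems(1) by (simp add: subst_total_type) (simp add: subst_of_def)
  have "typed {||} ?t ?C"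
    using ty_TApp[OF Cons.prems(2)[unfolded T] has_sort_num[of p]] unfolding i
    by (rule ty_App) (rule typed_rho)
  moreover have "TApp t (num p) \<in> red \<Gamma> (dflt \<Gamma>) (Imp (N (num p)) ?C)"
    using red_TApp[OF Cons.prems(3)[unfolded T] has_sort_num[of p] env_wf_dflt] unfolding i subst_num .
  then have "?t \<in> red \<Gamma> (dflt \<Gamma>) ?C"
    by (rule red_App) (simp add: rho_red[OF \<Gamma>])
  ultimately have "typed {||} (app_nums ?t ps) (Exists Iota (total_body y (inst_nums xs ps (subst_ty ?\<theta> A)))) \<and>
    app_nums ?t ps \<in> red \<Gamma> (dflt \<Gamma>) (Exists Iota (total_body y (inst_nums xs ps (subst_ty ?\<theta> A))))"
    using Cons.prems(1) by (intro Cons.IH) auto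
  then show ?case by (simp add: inst_nums_Cons[OF x] app_nums_def del: red.simps)
qed

lemma wf_inst_nums: "wf_ty A \<Longrightarrow> wf_ty (inst_nums xs ps A)"
  unfolding inst_nums_def
  by (rule wf_ty_subst)
    (auto simp: wsub_def subst_of_def zip_map_map split: option.split dest!: map_of_SomeD)

lemma fv_inst_nums:
  fixes ps :: "nat list"
  assumes "fv_ty A \<subseteq> Pair Iota ` set (xs @ [y])" "length xs = length ps"
  shows "fv_ty (inst_nums xs ps A) \<subseteq> {(Iota, y)}"
proof
  fix v assume "v \<in> fv_ty (inst_nums xs ps A)"
  then obtain \<sigma> i where i: "(\<sigma>, i) \<in> fv_ty A"
    and v: "v \<in> fv_tm (subst_of (zip (map (Pair Iota) xs) (map num ps)) \<sigma> i)"
    unfolding inst_nums_def by (blast dest: subsetD[OF fv_ty_subst])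
  show "v \<in> {(Iota, y)}"
  proof (cases "(\<sigma>, i) \<in> set (map (Pair Iota) xs)")
    case True
    then show ?thesis
      using map_of_zip_Some[of "map (Pair Iota) xs" "map num ps" "(\<sigma>, i)"] assms(2) v
      by (auto simp: subst_of_def)
  next
    case False
    then have "(\<sigma>, i) = (Iota, y)" using i assms(1) by auto
    then show ?thesis using v unfolding subst_of_def map_of_zip_None[OF False] by simp
  qed
qed

text \<open>A number term has no variables of the sorts \<open>Kappa n\<close>; in particular,
  substituting \<open>e\<close> for \<open>c\<close> leaves the witness unchanged.\<close>

lemma subst_Iota_id: "has_sort a Iota \<Longrightarrow> (\<And>i. \<theta> Iota i = Var Iota i) \<Longrightarrow> subst_tm \<theta> a = a"
  by (induction a) (auto simp: has_sort_Comp)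

lemma wred_irreducible: "\<not> wred \<Gamma> (App (TApp (V G) a) u) t"
  by (auto elim: wred.cases)

theorem theorem3:
  fixes n :: nat and f :: "nat list \<Rightarrow> nat" and xs :: "nat list" and y :: nat and A :: ty
  assumes "computable n f"
    and "provably_total_via n f xs y A"
  shows "\<exists>t. \<forall>ps. length ps = n \<longrightarrow>
    (\<forall>k. \<exists>w. extracted_witness Iota (total_body y (inst_nums xs ps A)) k (app_nums t ps) w \<and>
      normal_form_of tm_red w (num (f ps)))"
proof -
  have xs: "length xs = n" "distinct (xs @ [y])" and A: "wf_ty A" "fv_ty A \<subseteq> Pair Iota ` set (xs @ [y])"
    and f: "\<And>ps q. length ps = n \<Longrightarrow> provable (inst_nums (xs @ [y]) (ps @ [q]) A) \<Longrightarrow> q = f ps"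
    and "provable (total_type xs y A)"
    using assms(2) unfolding provably_total_via_def by auto
  \<comment> \<open>The scheme is fixed here, before \<open>ps\<close> and \<open>k\<close>: a
    tagged version of the given proof of totality.\<close>
  then obtain t where t: "typed {||} t (total_type xs y A)" "well_tagged {||} t"
    unfolding provable_def using typed_well_tagged[of "{||}" _ _ "{||}"] by blast
  show ?thesis
  proof (intro exI[of _ t] allI impI)
    fix ps :: "nat list" and k assume ps: "length ps = n"
    let ?A = "inst_nums xs ps A"
    let ?B = "total_body y ?A"
    let ?c = "Var (Kappa 0) k"
    define G where "G = to_eps Iota ?B ?c"
    let ?s = "app_nums t ps"
    have wB: "wf_ty ?B" by (intro wf_total_body wf_inst_nums A)
    have fA: "fv_ty ?A \<subseteq> {(Iota, y)}" using A(2) xs(1) ps by (intro fv_inst_nums) simp_all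
    \<comment> \<open>The context meets the conditions of adequacy and of \<open>rho_red\<close>:
      \<open>G\<close> is quantified, hence untagged, and the consequent under its quantifier is an
      atom, unlike in \<open>par_succ\<close>.\<close>
    have tagG: "tag S = None" if "S |\<in>| {|G|}" for S using that by (simp add: G_def to_eps_def)
    have parG: "par_zero c |\<notin>| {|G|}" "par_succ c |\<notin>| {|G|}" for c
      by (simp_all add: G_def to_eps_def par_zero_def par_succ_def)
    have "t \<in> red {|G|} (dflt {|G|}) (total_type xs y A)"
      by (rule red_well_tagged_closed[OF tagG t])
    then have s: "typed {||} ?s (Exists Iota ?B)" "?s \<in> red {|G|} (dflt {|G|}) (Exists Iota ?B)"
      using red_app_nums[OF parG _ xs(2) t(1)] xs(1) ps by simp_all
    obtain a u where r: "(wred {|G|})\<^sup>*\<^sup>* (App (TApp ?s ?c) (V G)) (App (TApp (V G) a) u)"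
      and a: "has_sort a Iota" and u: "typed {|G|} u (subst_ty (inst Iota a) ?B)"
      using red_Exists_witness[OF s(2)[unfolded G_def] wB refl] unfolding G_def by blast
    \<comment> \<open>For each assignment \<open>m\<close> the instance of \<open>A\<close> at the
      value of \<open>a\<close> is provable, and only the instance at \<open>f ps\<close>
      is.\<close>
    have "val m a = f ps" for m
    proof (rule f[OF ps])
      show "provable (inst_nums (xs @ [y]) (ps @ [val m a]) A)"
        using witness_instance_provable[OF wf_inst_nums[OF A(1)] fA a u[unfolded G_def]]
          inst_nums_snoc[OF xs(2), of ps] xs(1) ps by simp
    qed
    then have "nf a = num (f ps)" by (rule nf_eq_num[OF a])
    then have "normal_form_of tm_red a (num (f ps))"
      using red_nf[OF a] num_irreducible by (simp add: normal_form_of_def)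
    moreover have "a = subst_tm (subst_of [((Kappa 0, k), Comp [] [] (Exists Iota ?B) [])]) a"
      by (rule subst_Iota_id[OF a, symmetric]) (simp add: subst_of_def)
    then have "extracted_witness Iota ?B k ?s a"
      unfolding extracted_witness_def Let_def normal_form_of_def
      using wf_Exists[OF wB] fv_Exists[OF fv_total_body[OF fA]] s(1) r[unfolded G_def] wred_irreducible by blast
    ultimately show "\<exists>w. extracted_witness Iota ?B k ?s w \<and> normal_form_of tm_red w (num (f ps))"
      by blast
  qed
qed

end
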